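(* For all integers $n>m > 1$, $$\overline{a}(n)^2 > \overline{a}(n-m)\,\overline{a}(n+m).$$
   Context: The cubic overpartition function $\overline{a}(n)$ is defined by $\sum_{n\ge 0}\overline{a}(n)q^n=\frac{(-q;q)_\infty(-q^2;q^2)_\infty}{(q;q)_\infty(q^2;q^2)_\infty}$ for $|q|<1$, where $(a;q)_\infty=\prod_{j\ge 0}(1-aq^j)$. *)

theory Defs
  imports "HOL-Computational_Algebra.Formal_Power_Series"
begin

text \<open>The generating function
  (-q;q)_inf (-q^2;q^2)_inf / ((q;q)_inf (q^2;q^2)_inf)
  = prod over j >= 1 of (1+q^j)(1+q^(2j)) / ((1-q^j)(1-q^(2j))),
  as a formal power series truncated to the factors j = 1..N.
  Factors with j > N are congruent to 1 modulo q^(N+1), so the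
  coefficient of q^n is the same for every N >= n.\<close>

definition cubic_overpartition_gf :: "nat \<Rightarrow> real fps" where
  "cubic_overpartition_gf N =
     (\<Prod>j\<in>{1..N}. ((1 + fps_X ^ j) * (1 + fps_X ^ (2 * j)))
                     / ((1 - fps_X ^ j) * (1 - fps_X ^ (2 * j))))"

definition cubic_overpartition :: "nat \<Rightarrow> real" where
  "cubic_overpartition n = fps_nth (cubic_overpartition_gf n) n"

end

theory Submission
  imports
    Defs
    "HOL-Complex_Analysis.Complex_Analysis"
    "HOL-Probability.Characteristic_Functions"
begin

text \<open>Gauss's identity rewrites the generating function as F(q) = 1/(theta(q) theta(q^2)) with
  theta(q) = sum of (-1)^k q^(k^2) over all integers k. Poisson summation inverts theta, so for
  q = exp(-z) with z near 0 the function F is K z exp(c/z), c = 3 pi^2/8, up to an error O(z). Away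
  from z = 0 the product formula for theta saves almost exp(2/x) against the value of F at the real
  point exp(-x), x = Re z. Integrating F(exp(-z)) exp(nz) along a vertical segment therefore
  approximates the n-th coefficient by K times the residue of z exp(c/z + nz), which is a power series of
  Bessel type in n, with an exponentially small relative error. A Riccati equation for the logarithmic
  derivative of that series makes it log-concave with a gap of order n^(-3/2), and this gap absorbs the
  error for n at least 400. The coefficients up to index 401 are computed exactly: strict
  log-concavity holds from n = 10 on, so the quotients of consecutive coefficients decrease there,
  and they stay below all earlier ones.\<close>

section \<open>Gauss's theta identity\<close>

text \<open>Under inversion each theta factor contributes a root \<open>csqrt (pi / z)\<close>. The
  two roots multiply to a multiple of 1/z, so the main term is single valued with 0 as its only
  singularity. Its integral over the vertical segment can therefore be closed to a rectangle, and
  the abscissa x of the segment matters for the error only: it need not be the saddle point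
  sqrt(c/n). After the saving the error grows like exp(n x + (c - 2)/x), which is least near x =
  sqrt((c - 2)/n), about 1.3/sqrt n. Its exponent is then roughly 2.6 sqrt n, against 2 sqrt(c n),
  about 3.85 sqrt n, for the main term. This margin has to beat the gap n^(-3/2), a lower order term
  in 1/sqrt x and all powers of n lost on the way already at n = 400, low enough for an exact
  computation of the rest; hence the explicit constants everywhere. Log-concavity at distance 1
  fails at n = 3, 5, 7 and 9. The condition m > 1 removes just these cases, but a reduction to
  neighbouring coefficients alone breaks down there, which is why early quotients are compared
  directly and n < 10 is checked pair by pair.\<close>

text \<open>Every summand of the correction contains q^(n+1), so the truncated series and the
  truncated product agree below that order. Working in a commutative ring, with \<open>e j\<close>
  as an inverse of \<open>1 + q ^ j\<close>, covers formal power series as well as numbers, where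
  the correction tends to 0.\<close>

lemma finite_gauss_identity:
  fixes q :: "'a :: comm_ring_1" and e :: "nat \<Rightarrow> 'a"
  assumes e: "\<And>j. j \<ge> 1 \<Longrightarrow> (1 + q ^ j) * e j = 1"
  shows "1 + 2 * (\<Sum>k=1..n. (-1) ^ k * q ^ (k\<^sup>2)) =
    (\<Prod>j=1..n. (1 - q ^ j) * e j) +
    2 * (\<Sum>k=1..n. (-1) ^ k * (\<Prod>j=k+1..n. (1 - q ^ j) * e j) * e k * q ^ (k * (n + 1)))"
proof (induction n)
  case 0
  then show ?case by simp
next
  case (Suc n)
  define p where "p k m = (\<Prod>j=k+1..m. (1 - q ^ j) * e j)" for k m
  \<comment> \<open>Telescoping term: passing from n to n + 1 changes the k-th correction summand by
    A (k - 1) - A k. The boundary term A 0 accounts for the changed product; A n together with the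
    new summand k = n + 1 produces the new term of the theta series.\<close>
  define A where "A k = (-1) ^ k * p k n * q ^ ((k + 1) * (n + 1)) * e (n + 1)" for k
  have pSuc: "p k (Suc n) = p k n * ((1 - q ^ (n+1)) * e (n+1))" if "k \<le> n" for k
    using that by (simp add: p_def)
  have pdown: "p (k - 1) n = ((1 - q ^ k) * e k) * p k n" if "1 \<le> k" "k \<le> n" for k
    using that by (simp add: p_def prod.atLeast_Suc_atMost)
  have qe: "q ^ (n+1) * e (n+1) = 1 - e (n+1)"
    using e[of "n+1"] by (simp add: algebra_simps)
  have "(-1) ^ k * p k (Suc n) * e k * q ^ (k * (n + 2)) - (-1) ^ k * p k n * e k * q ^ (k * (n + 1))
         = A (k - 1) - A k" if k: "k \<in> {1..n}" for k
  proof -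
    have ek: "q ^ k * e k = 1 - e k"
      using e[of k] k by (simp add: algebra_simps)
    have en: "e (n+1) + q ^ (n+1) * e (n+1) = 1"
      using e[of "n+1"] by (simp add: algebra_simps)
    have "(-1) ^ k * p k (Suc n) * e k * q ^ (k * (n + 2)) - (-1) ^ k * p k n * e k * q ^ (k * (n + 1))
      = (-1) ^ k * p k n * q ^ (k * (n+1)) * (e k * (((1 - q ^ (n+1)) * e (n+1)) * q ^ k - 1))"
      using k by (simp add: pSuc algebra_simps power_add)
    also have "e k * (((1 - q ^ (n+1)) * e (n+1)) * q ^ k - 1)
        = - ((1 - q ^ k) * e k * e (n+1) + q ^ (n+1) * e (n+1))"
    proof -
      have "e k * (((1 - q ^ (n+1)) * e (n+1)) * q ^ k - 1) =
        (q ^ k * e k) * e (n+1) - (q ^ k * e k) * (q ^ (n+1) * e (n+1)) - e k"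
        by (simp add: algebra_simps)
      also have "\<dots> = (1 - e k) * e (n+1) - (1 - e k) * (1 - e (n+1)) - e k"
        unfolding ek qe ..
      also have "\<dots> = - ((e k - (1 - e k)) * e (n+1) + (1 - e (n+1)))"
        by (simp add: algebra_simps)
      also have "\<dots> = - ((e k - q ^ k * e k) * e (n+1) + q ^ (n+1) * e (n+1))"
        unfolding ek qe ..
      finally show ?thesis by (simp add: algebra_simps)
    qed
    also have "(-1) ^ k * p k n * q ^ (k * (n+1)) * \<dots> = A (k - 1) - A k"
    proof -
      obtain i where i: "k = Suc i" using k by (cases k) auto
      have "A (k - 1) = (-1) ^ i * ((1 - q ^ k) * e k * p k n) * q ^ (k * (n + 1)) * e (n+1)"
        using pdown[of k] k by (simp add: A_def i)
      moreover have "A k = (-1) ^ k * p k n * q ^ (k * (n + 1)) * q ^ (n + 1) * e (n+1)"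
        by (simp add: A_def algebra_simps power_add)
      ultimately show ?thesis by (simp add: i algebra_simps)
    qed
    finally show ?thesis .
  qed
  hence "(\<Sum>k=1..n. (-1) ^ k * p k (Suc n) * e k * q ^ (k * (n + 2))) -
    (\<Sum>k=1..n. (-1) ^ k * p k n * e k * q ^ (k * (n + 1))) = (\<Sum>k=1..n. A (k - 1) - A k)"
    by (simp add: sum_subtractf[symmetric])
  also have "\<dots> = A 0 - A n"
    by (induction n) auto
  finally have 1: "(\<Sum>k=1..n. (-1) ^ k * p k (Suc n) * e k * q ^ (k * (n + 2))) =
    (\<Sum>k=1..n. (-1) ^ k * p k n * e k * q ^ (k * (n + 1))) + A 0 - A n"
    by (simp add: algebra_simps)
  have An: "A n = (-1) ^ n * q ^ ((n + 1)\<^sup>2) * e (n+1)"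
    by (simp add: A_def p_def power2_eq_square)
  have A0: "2 * A 0 = p 0 n - p 0 (Suc n)"
  proof -
    have "p 0 n - p 0 (Suc n) = p 0 n * ((1 - e (n+1)) + q ^ (n+1) * e (n+1))"
      by (simp add: pSuc algebra_simps)
    also have "\<dots> = 2 * A 0" unfolding A_def qe[symmetric] by (simp add: algebra_simps)
    finally show ?thesis ..
  qed
  have last: "q ^ (Suc n * (n + 2)) * e (n+1) = q ^ ((n+1)\<^sup>2) - q ^ ((n+1)\<^sup>2) * e (n+1)"
  proof -
    have "Suc n * (n + 2) = (n+1)\<^sup>2 + (n + 1)" by (simp add: power2_eq_square)
    hence "q ^ (Suc n * (n + 2)) * e (n+1) = q ^ ((n+1)\<^sup>2) * (q ^ (n + 1) * e (n+1))"
      by (simp only: power_add mult.assoc)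
    thus ?thesis unfolding qe by (simp add: algebra_simps)
  qed
  have "p 0 (Suc n) + 2 * (\<Sum>k=1..Suc n. (-1) ^ k * p k (Suc n) * e k * q ^ (k * (n + 2)))
    = p 0 (Suc n) + 2 * ((\<Sum>k=1..n. (-1) ^ k * p k (Suc n) * e k * q ^ (k * (n + 2)))
       - (-1) ^ n * (q ^ (Suc n * (n + 2)) * e (n+1)))"
    by (simp add: p_def algebra_simps)
  also have "\<dots> = p 0 (Suc n) + (2 * (\<Sum>k=1..n. (-1) ^ k * p k n * e k * q ^ (k * (n + 1)))
      + 2 * A 0 - 2 * (A n + (-1) ^ n * (q ^ (Suc n * (n + 2)) * e (n+1))))"
    unfolding 1 by (simp add: algebra_simps)
  also have "\<dots> = p 0 n + 2 * (\<Sum>k=1..n. (-1) ^ k * p k n * e k * q ^ (k * (n + 1)))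
      - 2 * ((-1) ^ n * q ^ ((n + 1)\<^sup>2))"
    unfolding A0 An last by (simp add: algebra_simps)
  also have "\<dots> = 1 + 2 * (\<Sum>k=1..Suc n. (-1) ^ k * q ^ (k\<^sup>2))"
    using Suc.IH by (simp add: p_def algebra_simps)
  finally show ?case by (simp add: p_def)
qed

text \<open>Coefficients of theta(q^d). The sign (-1)^j is written as (-1)^(j^2) with j^2 =
  \<open>k div d\<close>, so that no square root has to be chosen.\<close>

definition theta_coeff :: "nat \<Rightarrow> nat \<Rightarrow> 'a :: comm_ring_1" where
  "theta_coeff d k = (if k = 0 then 1 else if \<exists>j. k = d * j\<^sup>2 then 2 * (-1) ^ (k div d) else 0)"

lemma theta_coeff_0 [simp]: "theta_coeff d 0 = 1"
  by (simp add: theta_coeff_def)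

lemma of_int_theta_coeff [simp]: "of_int (theta_coeff d k) = theta_coeff d k"
  by (simp add: theta_coeff_def)

lemma theta_coeff_cutoff:
  assumes "k \<le> n" "d \<ge> 1"
  shows "fps_nth (1 + 2 * (\<Sum>i=1..n. (-1) ^ i * (fps_X ^ d) ^ (i\<^sup>2))) k = (theta_coeff d k :: 'a :: comm_ring_1)"
proof -
  have *: "fps_nth ((-1) ^ i * (fps_X ^ d) ^ (i\<^sup>2) :: 'a fps) k = (if k = d * i\<^sup>2 then (-1) ^ (k div d) else 0)" for i
  proof -
    have "((-1) ^ i * (fps_X ^ d) ^ (i\<^sup>2) :: 'a fps) = fps_const ((-1) ^ i) * fps_X ^ (d * i\<^sup>2)"
      by (simp add: power_mult flip: fps_const_power fps_const_neg)
    hence "fps_nth ((-1) ^ i * (fps_X ^ d) ^ (i\<^sup>2) :: 'a fps) k = (-1) ^ i * (if k = d * i\<^sup>2 then 1 else 0)"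
      by (simp only: fps_mult_left_const_nth fps_X_power_nth)
    moreover have "(-1) ^ i = ((-1) ^ (i\<^sup>2) :: 'a)" by (cases "even i") auto
    ultimately show ?thesis using assms by auto
  qed
  have "fps_nth (1 + 2 * (\<Sum>i=1..n. (-1) ^ i * (fps_X ^ d) ^ (i\<^sup>2))) k =
    (if k = 0 then 1 else 0) + 2 * (\<Sum>i=1..n. (if k = d * i\<^sup>2 then (-1) ^ (k div d) else 0 :: 'a))"
    by (simp add: numeral_fps_const fps_sum_nth *)
  also have "\<dots> = theta_coeff d k"
  proof (cases "\<exists>j. k = d * j\<^sup>2 \<and> j \<ge> 1")
    case True
    then obtain j where j: "k = d * j\<^sup>2" "j \<ge> 1" by auto
    have "1 * j \<le> (d * j) * j" using j assms by (intro mult_le_mono) auto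
    hence "j \<le> d * j\<^sup>2" by (simp only: mult.assoc mult_1 power2_eq_square)
    hence "j \<le> n" using j assms by linarith
    have "(\<Sum>i=1..n. (if k = d * i\<^sup>2 then (-1) ^ (k div d) else 0 :: 'a)) =
        (\<Sum>i=1..n. (if j = i then (-1) ^ (k div d) else 0 :: 'a))"
      using j assms by (intro sum.cong) auto
    thus ?thesis using j \<open>j \<le> n\<close> assms by (auto simp: theta_coeff_def)
  next
    case False
    hence "(\<Sum>i=1..n. (if k = d * i\<^sup>2 then (-1) ^ (k div d) else 0 :: 'a)) = 0" by (intro sum.neutral) auto
    moreover have "k = 0 \<or> \<not> (\<exists>j. k = d * j\<^sup>2)" using False
      by (metis One_nat_def Suc_leI mult_is_0 neq0_conv zero_eq_power2)
    ultimately show ?thesis by (auto simp: theta_coeff_def)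
  qed
  finally show ?thesis .
qed

definition theta_fps :: "nat \<Rightarrow> 'a :: comm_ring_1 fps" where
  "theta_fps d = Abs_fps (theta_coeff d)"

lemma fps_nth_theta_fps [simp]: "fps_nth (theta_fps d) k = theta_coeff d k"
  by (simp add: theta_fps_def)

text \<open>The identity is applied with q = X^d; each correction term starts at an exponent d i (n
  + 1) > k and is invisible in the coefficient.\<close>

lemma theta_coeff_prod:
  assumes "k \<le> n" "d \<ge> 1"
  shows "fps_nth (\<Prod>j=1..n. (1 - fps_X ^ (d * j)) * inverse (1 + fps_X ^ (d * j))) k =
    (theta_coeff d k :: 'a :: field)"
proof -
  define q where "q = (fps_X ^ d :: 'a fps)"
  define e where "e j = inverse (1 + q ^ j)" for j
  define B where "B k = (-1) ^ k * (\<Prod>j=k+1..n. (1 - q ^ j) * e j) * e k" for k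
  have e: "(1 + q ^ j) * e j = 1" if "j \<ge> 1" for j
    unfolding e_def by (rule inverse_mult_eq_1') (use that assms in \<open>simp add: q_def flip: power_mult\<close>)
  have "fps_nth (B i * q ^ (i * (n + 1))) k = 0" if "i \<in> {1..n}" for i
  proof -
    have "1 * (n + 1) \<le> d * i * (n + 1)" using that assms by (intro mult_le_mono) auto
    hence "n + 1 \<le> d * (i * (n + 1))" by (simp only: mult.assoc mult_1)
    hence "k < d * (i * (n + 1))" using assms by linarith
    thus ?thesis
      by (simp add: q_def fps_X_power_mult_right_nth flip: power_mult)
  qed
  hence "fps_nth (2 * (\<Sum>i=1..n. B i * q ^ (i * (n + 1)))) k = 0"
    by (simp add: numeral_fps_const fps_sum_nth)
  moreover have "1 + 2 * (\<Sum>k=1..n. (-1) ^ k * q ^ (k\<^sup>2)) = (\<Prod>j=1..n. (1 - q ^ j) * e j) +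
      2 * (\<Sum>i=1..n. B i * q ^ (i * (n + 1)))"
    unfolding B_def by (rule finite_gauss_identity) (rule e)
  ultimately have "fps_nth (\<Prod>j=1..n. (1 - q ^ j) * e j) k = fps_nth (1 + 2 * (\<Sum>k=1..n. (-1) ^ k * q ^ (k\<^sup>2))) k"
    by (simp only: fps_add_nth add_0_right)
  also have "\<dots> = theta_coeff d k"
    unfolding q_def by (rule theta_coeff_cutoff[OF assms])
  finally show ?thesis by (simp only: q_def e_def power_mult)
qed

text \<open>The truncated generating function is exactly inverse to the product of two truncated
  theta products. Only coefficients up to n enter, and up to there the truncated products may be
  replaced by the full theta series.\<close>

lemma cubic_overpartition_eq:
  "cubic_overpartition n = fps_nth (inverse (theta_fps 1 * theta_fps 2)) n"
proof -
  define P where "P d = (\<Prod>j=1..n. (1 - fps_X ^ (d * j)) * inverse (1 + fps_X ^ (d * j)) :: real fps)" for d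
  define G where "G = cubic_overpartition_gf n"
  define T where "T = (theta_fps 1 * theta_fps 2 :: real fps)"
  have inv: "f * inverse f = 1" if "fps_nth f 0 \<noteq> 0" for f :: "real fps"
    using inverse_mult_eq_1'[OF that] by simp
  have "G * (P 1 * P 2) = 1"
  proof -
    have "G * (P 1 * P 2) = (\<Prod>j=1..n. ((1 + fps_X ^ j) * (1 + fps_X ^ (2 * j)))
        / ((1 - fps_X ^ j) * (1 - fps_X ^ (2 * j))) * (((1 - fps_X ^ j) * inverse (1 + fps_X ^ j)) *
        ((1 - fps_X ^ (2 * j)) * inverse (1 + fps_X ^ (2 * j)))))"
      by (simp add: G_def P_def cubic_overpartition_gf_def prod.distrib)
    also have "\<dots> = 1"
    proof (rule prod.neutral, rule ballI, goal_cases)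
      case (1 j)
      define x y where "x = (fps_X ^ j :: real fps)" and "y = (fps_X ^ (2 * j) :: real fps)"
      have 0: "fps_nth x 0 = 0" "fps_nth y 0 = 0" using 1 by (auto simp: x_def y_def power_0_left)
      have i: "(1 + x) * inverse (1 + x) = 1" "(1 + y) * inverse (1 + y) = 1"
           "((1 - x) * (1 - y)) * inverse ((1 - x) * (1 - y)) = 1"
        by (rule inv; simp add: 0)+
      have "((1 + x) * (1 + y)) / ((1 - x) * (1 - y)) * (((1 - x) * inverse (1 + x)) * ((1 - y) * inverse (1 + y)))
        = ((1 + x) * inverse (1 + x)) * ((1 + y) * inverse (1 + y)) * (((1 - x) * (1 - y)) * inverse ((1 - x) * (1 - y)))"
        by (subst fps_divide_unit) (simp_all add: 0 mult_ac)
      also have "\<dots> = 1" unfolding i by simp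
      finally show ?case by (simp add: x_def y_def)
    qed
    finally show ?thesis .
  qed
  have PT: "fps_nth (P 1 * P 2) k = fps_nth T k" if "k \<le> n" for k
    unfolding T_def P_def fps_mult_nth
    by (intro sum.cong refl arg_cong2[of _ _ _ _ "(*)"]; subst theta_coeff_prod) (use that in auto)
  have GT: "fps_nth (G * T) k = fps_nth 1 k" if "k \<le> n" for k
  proof -
    have "fps_nth (G * T) k = fps_nth (G * (P 1 * P 2)) k"
      unfolding fps_mult_nth[of G] using PT that by (intro sum.cong) auto
    thus ?thesis using \<open>G * (P 1 * P 2) = 1\<close> by simp
  qed
  have T: "T * inverse T = 1" by (rule inv) (simp add: T_def)
  have "cubic_overpartition n = fps_nth (G * (T * inverse T)) n"
    unfolding T by (simp add: cubic_overpartition_def G_def)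
  also have "\<dots> = fps_nth ((G * T) * inverse T) n" by (simp add: mult.assoc)
  also have "\<dots> = fps_nth (1 * inverse T) n"
    unfolding fps_mult_nth[of _ "inverse T"] using GT by (intro sum.cong) auto
  finally show ?thesis by (simp add: T_def)
qed

section \<open>Exact values of the coefficients\<close>

text \<open>Lists hold the coefficients computed so far, most recent first. Started with g = k = d - 1,
  \<open>alt_sum\<close> visits the positions d j^2 before the next coefficient: k counts the entries to skip,
  and g is one less than the current difference d (2 j + 1) of these positions.\<close>

fun alt_sum :: "nat \<Rightarrow> nat \<Rightarrow> nat \<Rightarrow> int list \<Rightarrow> int" where
  "alt_sum d g k [] = 0"
| "alt_sum d g (Suc k) (x # xs) = alt_sum d g k xs"
| "alt_sum d g 0 (x # xs) = x - alt_sum d (d + d + g) (d + d + g) xs"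

text \<open>\<open>ps\<close> lists the coefficients of 1/theta(q) and \<open>as\<close> those of
  1/(theta(q) theta(q^2)). Division by theta(q^d) is the recursion f(n) = (right side at n) + 2 (f(n
  - d) - f(n - 4 d) + f(n - 9 d) - ...). The auxiliary \<open>cop_list'\<close> binds the new entry
  of \<open>ps\<close>, which is used twice.\<close>

fun cop_list :: "nat \<Rightarrow> int list \<Rightarrow> int list \<Rightarrow> int list" and
  cop_list' :: "nat \<Rightarrow> int \<Rightarrow> int list \<Rightarrow> int list \<Rightarrow> int list"  where
  "cop_list 0 ps as = as"
| "cop_list (Suc n) ps as = cop_list' n (2 * alt_sum 1 0 0 ps) ps as"
| "cop_list' n p ps as = cop_list n (p # ps) ((p + 2 * alt_sum 2 1 1 as) # as)"

fun log_concave_list :: "int list \<Rightarrow> bool" where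
 "log_concave_list (x # y # z # xs) = (0 < x \<and> x * z < y * y \<and> log_concave_list (y # z # xs))"
| "log_concave_list _ = True"

definition down_list :: "(nat \<Rightarrow> int) \<Rightarrow> nat \<Rightarrow> int list" where
  "down_list f n = map f (rev [0..<n])"

lemma down_list_0 [simp]: "down_list f 0 = []"
  and down_list_Suc: "down_list f (Suc n) = f n # down_list f n"
  by (simp_all add: down_list_def)

lemma alt_sum_down_list:
  "alt_sum d g k (down_list f n) = (if n \<le> k then 0 else
     f (n - k - 1) - alt_sum d (d + d + g) (d + d + g) (down_list f (n - k - 1)))"
proof (induction n arbitrary: k)
  case 0
  then show ?case by simp
next
  case (Suc n)
  then show ?case by (cases k) (auto simp: down_list_Suc)
qed

lemma square_between:
  assumes "d * j\<^sup>2 < i" "i < d * (Suc j)\<^sup>2"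
  shows "i \<noteq> d * k\<^sup>2"
proof
  assume "i = d * k\<^sup>2"
  hence "j\<^sup>2 < k\<^sup>2" "k\<^sup>2 < (Suc j)\<^sup>2" using assms by auto
  hence "j < k" "k < Suc j" by (meson power2_less_imp_less zero_le)+
  thus False by simp
qed

text \<open>Induction from one square to the next: theta has no coefficients strictly between d j^2
  and d (j + 1)^2, and d (2 j + 1) - 1 is the state of \<open>alt_sum\<close> after j
  positions.\<close>

lemma alt_sum_theta:
  assumes "d \<ge> 1" "d * j\<^sup>2 \<le> n"
  shows "(\<Sum>i\<in>{d*j\<^sup>2<..n}. theta_coeff d i * f (n - i)) =
    2 * (-1) ^ Suc j * alt_sum d (d * (2 * j + 1) - 1) (d * (2 * j + 1) - 1) (down_list f (n - d * j\<^sup>2))"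
  using assms
proof (induction "n - d * j\<^sup>2" arbitrary: j rule: less_induct)
  case less
  define g where "g = d * (2 * j + 1) - 1"
  have g: "Suc g = d * (2 * j + 1)" using less.prems by (simp add: g_def)
  have sq: "d * (Suc j)\<^sup>2 = d * j\<^sup>2 + Suc g" by (simp add: g power2_eq_square algebra_simps)
  have zero: "theta_coeff d i = (0 :: int)" if "d * j\<^sup>2 < i" "i < d * (Suc j)\<^sup>2" for i
    using square_between[OF that] that by (auto simp: theta_coeff_def)
  show ?case
  proof (cases "n < d * (Suc j)\<^sup>2")
    case True
    hence "(\<Sum>i\<in>{d*j\<^sup>2<..n}. theta_coeff d i * f (n - i)) = 0"
      by (intro sum.neutral) (auto simp: zero)
    moreover have "n - d * j\<^sup>2 \<le> g" using True sq by simp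
    ultimately show ?thesis unfolding g_def[symmetric] by (subst alt_sum_down_list) simp
  next
    case False
    hence le: "d * (Suc j)\<^sup>2 \<le> n" by simp
    have "{d*j\<^sup>2<..n} = {d*j\<^sup>2<..<d*(Suc j)\<^sup>2} \<union> {d * (Suc j)\<^sup>2} \<union> {d*(Suc j)\<^sup>2<..n}"
      using le sq by auto
    moreover have "{d*j\<^sup>2<..<d*(Suc j)\<^sup>2} \<inter> {d*(Suc j)\<^sup>2<..n} = {}" by auto
    ultimately have "(\<Sum>i\<in>{d*j\<^sup>2<..n}. theta_coeff d i * f (n - i)) =
      (\<Sum>i\<in>{d*j\<^sup>2<..<d*(Suc j)\<^sup>2}. theta_coeff d i * f (n - i)) +
      theta_coeff d (d * (Suc j)\<^sup>2) * f (n - d * (Suc j)\<^sup>2) +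
      (\<Sum>i\<in>{d*(Suc j)\<^sup>2<..n}. theta_coeff d i * f (n - i))"
      by (simp add: sum.union_disjoint)
    also have "(\<Sum>i\<in>{d*j\<^sup>2<..<d*(Suc j)\<^sup>2}. theta_coeff d i * f (n - i)) = 0"
      by (intro sum.neutral) (auto simp: zero)
    also have "theta_coeff d (d * (Suc j)\<^sup>2) = (2 * (-1) ^ Suc j :: int)"
      using less.prems by (cases "even j") (auto simp: theta_coeff_def)
    also have "(\<Sum>i\<in>{d*(Suc j)\<^sup>2<..n}. theta_coeff d i * f (n - i)) =
      2 * (-1) ^ Suc (Suc j) * alt_sum d (d * (2 * Suc j + 1) - 1) (d * (2 * Suc j + 1) - 1)
        (down_list f (n - d * (Suc j)\<^sup>2))"
      using le sq less.prems by (intro less.hyps) auto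
    also have "d * (2 * Suc j + 1) - 1 = d + d + g" using g by (simp add: algebra_simps)
    also have "n - d * (Suc j)\<^sup>2 = n - d * j\<^sup>2 - g - 1" using sq by simp
    finally show ?thesis unfolding g_def[symmetric]
      using le sq by (subst alt_sum_down_list) (auto simp: algebra_simps)
  qed
qed

lemma theta_mult_nth_int:
  assumes "d \<ge> 1"
  shows "fps_nth (theta_fps d * f) n = fps_nth f n - 2 * alt_sum d (d - 1) (d - 1) (down_list (fps_nth f) n)"
proof -
  have "{0..n} = insert 0 {0<..n}" by auto
  hence "fps_nth (theta_fps d * f) n = fps_nth f n + (\<Sum>i\<in>{0<..n}. theta_coeff d i * fps_nth f (n - i))"
    by (simp add: fps_mult_nth)
  thus ?thesis using alt_sum_theta[of d 0 n "fps_nth f"] assms by simp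
qed

lemma cop_list_correct:
  assumes "theta_fps 1 * p = 1" "theta_fps 2 * a = p"
  shows "cop_list k (down_list (fps_nth p) (Suc n)) (down_list (fps_nth a) (Suc n)) =
     down_list (fps_nth a) (Suc n + k)"
proof (induction k arbitrary: n)
  case (Suc k)
  have "fps_nth p (Suc n) = 2 * alt_sum 1 0 0 (down_list (fps_nth p) (Suc n))"
    using theta_mult_nth_int[of 1 p "Suc n"] assms by simp
  moreover have "fps_nth a (Suc n) = fps_nth p (Suc n) + 2 * alt_sum 2 1 1 (down_list (fps_nth a) (Suc n))"
    using theta_mult_nth_int[of 2 a "Suc n"] assms by simp
  ultimately show ?case using Suc.IH[of "Suc n"] by (simp add: down_list_Suc)
qed simp

text \<open>Both theta series have constant term 1 and are invertible over the integers;
  \<open>fps_right_inverse\<close> is used because \<open>int\<close> is not a field.\<close>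

definition cop_int :: "nat \<Rightarrow> int" where
  "cop_int n = fps_nth (fps_right_inverse (theta_fps 2) 1 * fps_right_inverse (theta_fps 1) 1) n"

lemma cop_list_cop_int: "cop_list k [1] [1] = down_list cop_int (Suc k)"
proof -
  define p where "p = fps_right_inverse (theta_fps 1) (1::int)"
  define a where "a = fps_right_inverse (theta_fps 2) (1::int) * p"
  have r: "theta_fps d * fps_right_inverse (theta_fps d) (1::int) = 1" for d
    by (rule fps_right_inverse) simp
  have p: "theta_fps 1 * p = 1" unfolding p_def by (rule r)
  have a: "theta_fps 2 * a = p" unfolding a_def mult.assoc[symmetric] r by simp
  have "fps_nth p 0 = 1" by (simp add: p_def)
  moreover have "fps_nth a 0 = 1" by (simp add: p_def a_def)
  moreover have "cop_int = fps_nth a" by (simp add: fun_eq_iff cop_int_def a_def p_def)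
  ultimately show ?thesis using cop_list_correct[OF p a, of k 0] by (simp add: down_list_Suc)
qed

text \<open>The coefficientwise embedding \<open>R\<close> of integer into real power series is
  multiplicative, so it carries the integer inverse to an inverse of the real theta product, which
  is unique.\<close>

lemma cubic_overpartition_cop_int: "cubic_overpartition n = real_of_int (cop_int n)"
proof -
  define p where "p = fps_right_inverse (theta_fps 1) (1::int)"
  define a where "a = fps_right_inverse (theta_fps 2) (1::int) * p"
  define R where "R f = Abs_fps (\<lambda>n. real_of_int (fps_nth f n))" for f
  have Rm: "R (f * g) = R f * R g" for f g
    by (simp add: R_def fps_eq_iff fps_mult_nth)
  have Rt: "R (theta_fps d) = theta_fps d" for d
    by (simp add: R_def fps_eq_iff)
  have r: "theta_fps d * fps_right_inverse (theta_fps d) (1::int) = 1" for d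
    by (rule fps_right_inverse) simp
  have "theta_fps 1 * theta_fps 2 * a =
     (theta_fps 1 * fps_right_inverse (theta_fps 1) 1) * (theta_fps 2 * fps_right_inverse (theta_fps 2) (1::int))"
    unfolding a_def p_def by (simp add: mult_ac)
  hence "theta_fps 1 * theta_fps 2 * a = 1" by (simp add: r)
  hence "R (theta_fps 1 * theta_fps 2 * a) = 1" by (simp add: R_def fps_eq_iff)
  hence 1: "theta_fps 1 * theta_fps 2 * R a = 1" by (simp add: Rm Rt)
  have Ra: "R a = inverse (theta_fps 1 * theta_fps 2)"
    using fps_inverse_unique[OF 1] by simp
  hence "fps_nth (inverse (theta_fps 1 * theta_fps 2)) n = fps_nth (R a) n" by (simp only:)
  also have "\<dots> = real_of_int (fps_nth a n)" by (simp add: R_def)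
  finally have "fps_nth (inverse (theta_fps 1 * theta_fps 2)) n = real_of_int (fps_nth a n)" .
  thus ?thesis by (simp add: cubic_overpartition_eq cop_int_def a_def p_def)
qed

text \<open>The first l entries of \<open>down_list f N\<close> have the indices N - 1 down to N -
  l, hence the middle index n of a triple ranges over N - l + 1 <= n <= N - 2.\<close>

lemma log_concave_list_down_list:
  assumes "log_concave_list (take l (down_list f N))" "n + 1 < N" "N \<le> n + l - 1" "n \<ge> 1"
  shows "0 < f (n + 1) \<and> f (n + 1) * f (n - 1) < f n * f n"
  using assms
proof (induction N arbitrary: l)
  case (Suc N)
  have "3 \<le> l" using Suc.prems by linarith
  then obtain l' where l: "l = Suc (Suc (Suc l'))"
    by (intro that[of "l - 3"]) simp
  show ?case
  proof (cases "N = n + 1")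
    case True
    then show ?thesis using Suc.prems l by (cases n) (auto simp: down_list_Suc)
  next
    case False
    have "2 \<le> N" using Suc.prems by linarith
    then obtain N' where N': "N = Suc (Suc N')"
      by (intro that[of "N - 2"]) simp
    show ?thesis
      by (rule Suc.IH[of "l - 1"]) (use Suc.prems False l in \<open>auto simp: N' down_list_Suc\<close>)
  qed
qed simp

section \<open>Inversion of the theta series on the positive axis\<close>

text \<open>The substitution x = cos(pi v)^2 maps the half period bijectively to [0,1].
  Orthogonality to all cosines passes to all polynomials in x, and Bernstein polynomials approximate
  D uniformly, so the integral of D^2 is at most e times that of |D| for every e > 0.\<close>

lemma orthogonal_to_cosines:
  fixes D :: "real \<Rightarrow> real"
  assumes cont: "continuous_on {0..1/2} D"
    and orth: "\<And>j::nat. integral {0..1/2} (\<lambda>v. D v * cos (2 * pi * j * v)) = 0"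
    and v: "v \<in> {0..1/2}"
  shows "D v = 0"
proof -
  define x where "x v = (1 + cos (2 * pi * v)) / 2" for v :: real
  have xcont: "continuous_on S x" for S unfolding x_def by (intro continuous_intros) auto
  have intg: "(\<lambda>v. D v * g v) integrable_on {0..1/2}" if "continuous_on {0..1/2} g" for g
    by (intro integrable_continuous_interval continuous_intros cont that)
  \<comment> \<open>Negative frequencies are needed because multiplying by x shifts j to j + 1 and j
    - 1.\<close>
  have orth_int: "integral {0..1/2} (\<lambda>v. D v * cos (2 * pi * real_of_int j * v)) = 0" for j :: int
  proof (cases "j \<ge> 0")
    case True
    thus ?thesis using orth[of "nat j"] by simp
  next
    case False
    have "cos (2 * pi * real_of_int j * v) = cos (2 * pi * real (nat (-j)) * v)" for v
      using cos_minus[of "2 * pi * real_of_int j * v"] False by simp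
    thus ?thesis using orth[of "nat (-j)"] by simp
  qed
  have cx: "D v * (cos (2 * pi * real_of_int j * v) * (x v * g v)) =
     (1/2) * (D v * (cos (2 * pi * real_of_int j * v) * g v))
   + ((1/4) * (D v * (cos (2 * pi * real_of_int (j + 1) * v) * g v))
   + (1/4) * (D v * (cos (2 * pi * real_of_int (j - 1) * v) * g v)))" for j v g
    by (simp add: x_def algebra_simps cos_add cos_diff)
  have step: "integral {0..1/2} (\<lambda>v. D v * (cos (2 * pi * real_of_int j * v) * (x v * g v))) = 0"
    if g: "continuous_on {0..1/2} g" and
       *: "\<And>j. integral {0..1/2} (\<lambda>v. D v * (cos (2 * pi * real_of_int j * v) * g v)) = 0" for g j
  proof -
    define h where "h = (\<lambda>j v. D v * (cos (2 * pi * real_of_int j * v) * g v))"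
    have c: "continuous_on {0..1/2} (\<lambda>v. cos (2 * pi * real_of_int j * v) * g v)" for j
      by (intro continuous_intros g)
    have "(h j has_integral 0) {0..1/2}" for j
      using *[of j] integrable_integral[OF intg[OF c[of j]]] by (simp add: h_def)
    hence "((\<lambda>v. (1/2) * h j v + ((1/4) * h (j + 1) v + (1/4) * h (j - 1) v)) has_integral
      (1/2) * 0 + ((1/4) * 0 + (1/4) * 0)) {0..1/2}"
      by (intro has_integral_add has_integral_mult_right)
    hence "((\<lambda>v. D v * (cos (2 * pi * real_of_int j * v) * (x v * g v))) has_integral 0) {0..1/2}"
      unfolding h_def cx[symmetric] by simp
    thus ?thesis by (rule integral_unique)
  qed
  have poly: "integral {0..1/2} (\<lambda>v. D v * (cos (2 * pi * real_of_int j * v) * (x v ^ k * (1 - x v) ^ l))) = 0" for j k l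
  proof (induction l arbitrary: k j)
    case 0
    show ?case
    proof (induction k arbitrary: j)
      case 0
      then show ?case using orth_int by simp
    next
      case (Suc k)
      have "integral {0..1/2} (\<lambda>v. D v * (cos (2 * pi * real_of_int j * v) * (x v * x v ^ k))) = 0"
        by (rule step) (use Suc in \<open>auto intro!: continuous_intros xcont\<close>)
      thus ?case by simp
    qed
  next
    case (Suc l)
    define h where "h = (\<lambda>k v. D v * (cos (2 * pi * real_of_int j * v) * (x v ^ k * (1 - x v) ^ l)))"
    have eq: "D v * (cos (2 * pi * real_of_int j * v) * (x v ^ k * (1 - x v) ^ Suc l)) = h k v - h (Suc k) v" for v
      by (simp add: h_def algebra_simps)
    have c: "continuous_on {0..1/2} (\<lambda>v. cos (2 * pi * real_of_int j * v) * (x v ^ k * (1 - x v) ^ l))" for k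
      by (intro continuous_intros xcont)
    have "(h k has_integral 0) {0..1/2}" for k
      using Suc.IH[of j k] integrable_integral[OF intg[OF c[of k]]] by (simp add: h_def)
    hence "((\<lambda>v. h k v - h (Suc k) v) has_integral 0 - 0) {0..1/2}"
      by (intro has_integral_diff)
    hence "((\<lambda>v. D v * (cos (2 * pi * real_of_int j * v) * (x v ^ k * (1 - x v) ^ Suc l))) has_integral 0) {0..1/2}"
      unfolding eq[symmetric] by simp
    thus ?case by (rule integral_unique)
  qed
  \<comment> \<open>D transported to [0,1] by the inverse of x, the form in which the approximation
    theorem applies.\<close>
  define f where "f y = D (arccos (2 * y - 1) / (2 * pi))" for y
  have fx: "f (x v) = D v" if "v \<in> {0..1/2}" for v
    using that by (simp add: f_def x_def arccos_cos field_simps)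
  have fcont: "continuous_on {0..1} f"
    unfolding f_def
  proof (intro continuous_on_compose2[OF cont] continuous_intros)
    show "(\<lambda>y. arccos (2 * y - 1) / (2 * pi)) ` {0..1} \<subseteq> {0..1/2}"
    proof safe
      fix y :: real assume "y \<in> {0..1}"
      hence "0 \<le> arccos (2 * y - 1)" "arccos (2 * y - 1) \<le> pi" by (auto intro: arccos_lbound arccos_ubound)
      thus "arccos (2 * y - 1) / (2 * pi) \<in> {0..1/2}" by (auto simp: field_simps)
    qed
  qed auto
  define I where "I = integral {0..1/2} (\<lambda>v. \<bar>D v\<bar>)"
  have Icont: "(\<lambda>v. \<bar>D v\<bar>) integrable_on {0..1/2}"
    by (intro integrable_continuous_interval continuous_intros cont)
  have I0: "I \<ge> 0" unfolding I_def by (rule integral_nonneg[OF Icont]) auto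
  have D2: "integral {0..1/2} (\<lambda>v. D v * D v) \<le> e * I" if e: "e > 0" for e
  proof -
    obtain n where n: "\<And>y. y \<in> {0..1} \<Longrightarrow> \<bar>f y - (\<Sum>k\<le>n. f (k/n) * Bernstein n k y)\<bar> < e"
      using Bernstein_Weierstrass[OF fcont e] by blast
    define B where "B y = (\<Sum>k\<le>n. f (k/n) * Bernstein n k y)" for y
    have Bcont: "continuous_on {0..1/2} (\<lambda>v. B (x v))"
      unfolding B_def Bernstein_def by (intro continuous_intros xcont)
    have "integral {0..1/2} (\<lambda>v. D v * B (x v)) =
      integral {0..1/2} (\<lambda>v. (\<Sum>k\<le>n. (f (k/n) * of_nat (n choose k)) *
         (D v * (cos (2 * pi * real_of_int 0 * v) * (x v ^ k * (1 - x v) ^ (n - k))))))"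
      by (simp add: B_def Bernstein_def sum_distrib_left mult_ac)
    also have "\<dots> = (\<Sum>k\<le>n. integral {0..1/2} (\<lambda>v. (f (k/n) * of_nat (n choose k)) *
         (D v * (cos (2 * pi * real_of_int 0 * v) * (x v ^ k * (1 - x v) ^ (n - k))))))"
      by (intro integral_sum integrable_on_mult_right intg continuous_intros xcont) auto
    also have "\<dots> = 0" by (simp only: integral_mult_right poly) simp
    finally have DB: "integral {0..1/2} (\<lambda>v. D v * B (x v)) = 0" .
    have "integral {0..1/2} (\<lambda>v. D v * D v) = integral {0..1/2} (\<lambda>v. D v * D v) - integral {0..1/2} (\<lambda>v. D v * B (x v))"
      by (simp add: DB)
    also have "\<dots> = integral {0..1/2} (\<lambda>v. D v * D v - D v * B (x v))"
      by (intro integral_diff[symmetric] intg cont Bcont)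
    also have "\<dots> \<le> integral {0..1/2} (\<lambda>v. e * \<bar>D v\<bar>)"
    proof (intro integral_le integrable_diff intg cont Bcont integrable_on_mult_right Icont)
      fix v :: real assume v: "v \<in> {0..1/2}"
      have xv: "x v \<in> {0..1}"
      proof -
        have "(1 + c) / 2 \<in> {0..1}" if "-1 \<le> c" "c \<le> 1" for c :: real using that by auto
        thus ?thesis unfolding x_def by (simp only: cos_ge_minus_one cos_le_one)
      qed
      have "\<bar>D v - B (x v)\<bar> < e"
        using n[OF xv] fx[OF v] by (simp add: B_def)
      hence "\<bar>D v\<bar> * \<bar>D v - B (x v)\<bar> \<le> \<bar>D v\<bar> * e"
        by (intro mult_left_mono) auto
      moreover have "D v * (D v - B (x v)) \<le> \<bar>D v\<bar> * \<bar>D v - B (x v)\<bar>"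
        by (metis abs_ge_self abs_mult)
      ultimately have "D v * (D v - B (x v)) \<le> \<bar>D v\<bar> * e" by linarith
      thus "D v * D v - D v * B (x v) \<le> e * \<bar>D v\<bar>" by (simp add: algebra_simps)
    qed
    also have "\<dots> = e * I" by (simp add: I_def)
    finally show ?thesis .
  qed
  have "integral {0..1/2} (\<lambda>v. D v * D v) \<le> 0"
  proof (rule ccontr)
    assume "\<not> ?thesis"
    hence p: "integral {0..1/2} (\<lambda>v. D v * D v) > 0" by simp
    define J where "J = integral {0..1/2} (\<lambda>v. D v * D v)"
    \<comment> \<open>This e is chosen to make e I less than J; adding 1 avoids a division by zero
      when I = 0.\<close>
    have "J \<le> J / (2 * (I + 1)) * I" unfolding J_def by (rule D2) (use p I0 in auto)
    also have "\<dots> = J * (I / (2 * (I + 1)))" by simp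
    also have "\<dots> < J * 1"
      using p I0 by (intro mult_strict_left_mono) (auto simp: J_def)
    finally show False by simp
  qed
  moreover have "integral {0..1/2} (\<lambda>v. D v * D v) \<ge> 0"
    by (intro integral_nonneg intg cont) auto
  ultimately have "\<forall>v\<in>{0..1/2}. D v * D v = 0"
    by (subst integral_eq_0_iff[symmetric]) (auto intro!: continuous_intros cont)
  thus ?thesis using v by auto
qed

section \<open>Gaussian integrals and Poisson summation\<close>

text \<open>Real part of the characteristic function of the standard normal distribution, rescaled
  by s = sqrt(2 b).\<close>

lemma gauss_cos_integral:
  assumes "b > (0::real)"
  defines "f \<equiv> (\<lambda>w x. exp (- b * x\<^sup>2) * cos (w * x))"
  shows "integrable lborel (f w)" "integral\<^sup>L lborel (f w) = sqrt (pi / b) * exp (- (w\<^sup>2 / (4 * b)))"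
proof -
  interpret real_distribution std_normal_distribution by (rule real_dist_normal_dist)
  define s where "s = sqrt (2 * b)"
  have s: "s > 0" "s\<^sup>2 = 2 * b" using assms by (auto simp: s_def)
  define t where "t = w / s"
  have iint: "integrable std_normal_distribution (\<lambda>x. iexp (t * x))"
    by (intro integrable_const_bound[where B = 1]) auto
  have "of_real (exp (- (t\<^sup>2) / 2)) = char std_normal_distribution t"
    by (simp add: char_std_normal_distribution)
  also have "\<dots> = (CLINT x|lborel. std_normal_density x *\<^sub>R iexp (t * x))"
    unfolding char_def by (subst integral_density) (auto simp: normal_density_nonneg)
  finally have 1: "(CLINT x|lborel. std_normal_density x *\<^sub>R iexp (t * x)) = of_real (exp (- (t\<^sup>2) / 2))" ..
  have 2: "integrable lborel (\<lambda>x. std_normal_density x *\<^sub>R iexp (t * x))"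
    using iint by (subst (asm) integrable_density) (auto simp: normal_density_nonneg)
  have "(LINT x|lborel. Re (std_normal_density x *\<^sub>R iexp (t * x))) = exp (- (t\<^sup>2) / 2)"
    using integral_Re[OF 2] 1 by simp
  moreover have "integrable lborel (\<lambda>x. Re (std_normal_density x *\<^sub>R iexp (t * x)))"
    using 2 by (rule integrable_Re)
  moreover have "Re (std_normal_density x *\<^sub>R iexp (t * x)) = std_normal_density x * cos (t * x)" for x
    by (simp add: Re_exp)
  ultimately have 3: "(LINT x|lborel. std_normal_density x * cos (t * x)) = exp (- (t\<^sup>2) / 2)"
     "integrable lborel (\<lambda>x. std_normal_density x * cos (t * x))" by (simp_all only:)
  have eq: "std_normal_density (0 + s * x) * cos (t * (0 + s * x)) = f w x / sqrt (2 * pi)" for x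
    using s by (simp add: std_normal_density_def f_def t_def power_mult_distrib field_simps)
  have "integrable lborel (\<lambda>x. f w x / sqrt (2 * pi))"
    using lborel_integrable_real_affine[OF 3(2), of s 0] s unfolding eq by simp
  hence "integrable lborel (\<lambda>x. sqrt (2 * pi) * (f w x / sqrt (2 * pi)))"
    by (rule integrable_mult_right)
  thus "integrable lborel (f w)" by simp
  have "exp (- (t\<^sup>2) / 2) = s * (LINT x|lborel. f w x / sqrt (2 * pi))"
    using lborel_integral_real_affine[of s "\<lambda>x. std_normal_density x * cos (t * x)" 0] s 3
    unfolding eq by simp
  hence "integral\<^sup>L lborel (f w) = sqrt (2 * pi) / s * exp (- (t\<^sup>2) / 2)"
    using s by (simp add: field_simps)
  also have "sqrt (2 * pi) / s = sqrt (pi / b)" by (simp add: s_def real_sqrt_divide real_sqrt_mult)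
  also have "- (t\<^sup>2) / 2 = - (w\<^sup>2 / (4 * b))" using s by (simp add: t_def power_divide)
  finally show "integral\<^sup>L lborel (f w) = sqrt (pi / b) * exp (- (w\<^sup>2 / (4 * b)))"
    by simp
qed

text \<open>The intervals are those covered by finitely many integer translates of a period centred
  at 0, which is how the integral arises in Poisson summation.\<close>

lemma gauss_cos_partial:
  assumes "b > (0::real)"
  defines "f \<equiv> (\<lambda>w x. exp (- b * x\<^sup>2) * cos (w * x))"
  shows "(\<lambda>N. integral {-(real N + 1/2)..real N + 1/2} (f w))
     \<longlonglongrightarrow> sqrt (pi / b) * exp (- (w\<^sup>2 / (4 * b)))"
proof -
  define A where "A N = {-(real N + 1/2)..real N + 1/2}" for N
  have i: "integrable lborel (f w)" unfolding f_def by (rule gauss_cos_integral) fact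
  have hi: "(f w has_integral sqrt (pi / b) * exp (- (w\<^sup>2 / (4 * b)))) UNIV"
    using has_integral_integral_lborel[OF i] gauss_cos_integral(2)[OF assms(1), of w] by (simp add: f_def)
  have "(\<lambda>N. integral UNIV (\<lambda>x. if x \<in> A N then f w x else 0)) \<longlonglongrightarrow> integral UNIV (f w)"
  proof (rule dominated_convergence)
    show "(\<lambda>x. \<bar>f w x\<bar>) integrable_on UNIV"
      using has_integral_integral_lborel[OF integrable_abs[OF i]] by (rule has_integral_integrable)
    show "(\<lambda>x. if x \<in> A N then f w x else 0) integrable_on UNIV" for N
      unfolding A_def f_def integrable_restrict_UNIV
      by (intro integrable_continuous_interval continuous_intros)
    show "(\<lambda>N. if x \<in> A N then f w x else 0) \<longlonglongrightarrow> f w x" for x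
    proof (rule tendsto_eventually)
      obtain N0 :: nat where "\<bar>x\<bar> < N0" using reals_Archimedean2 by blast
      thus "\<forall>\<^sub>F N in sequentially. (if x \<in> A N then f w x else 0) = f w x"
        by (intro eventually_sequentiallyI[of N0]) (auto simp: A_def)
    qed
  qed auto
  hence "(\<lambda>N. integral (A N) (f w)) \<longlonglongrightarrow> integral UNIV (f w)"
    by (simp only: integral_restrict_UNIV)
  thus ?thesis using hi by (simp add: A_def integral_unique)
qed

lemma integral_cos_cos_half:
  fixes j k :: nat
  shows "integral {0..1/2} (\<lambda>v. cos (2 * pi * k * v) * cos (2 * pi * j * v)) =
     (if j = k then if j = 0 then 1/2 else 1/4 else 0)"
proof -
  have *: "((\<lambda>v. cos (2 * pi * real_of_int m * v)) has_integral (if m = 0 then 1/2 else 0)) {0..1/2}" for m :: int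
  proof (cases "m = 0")
    case True
    thus ?thesis using has_integral_const_real[of "1::real" 0 "1/2"] by simp
  next
    case False
    have "((\<lambda>v. cos (2 * pi * real_of_int m * v)) has_integral
      sin (2 * pi * real_of_int m * (1/2)) / (2 * pi * real_of_int m) -
      sin (2 * pi * real_of_int m * 0) / (2 * pi * real_of_int m)) {0..1/2}"
      using False by (intro fundamental_theorem_of_calculus)
       (auto intro!: derivative_eq_intros simp: has_real_derivative_iff_has_vector_derivative[symmetric])
    moreover have "sin (2 * pi * real_of_int m * (1/2)) = 0"
      by (simp add: sin_zero_iff_int2)
    ultimately show ?thesis using False by simp
  qed
  have eq: "cos (2 * pi * k * v) * cos (2 * pi * j * v) =
    (1/2) * cos (2 * pi * real_of_int (int k - int j) * v) + (1/2) * cos (2 * pi * real_of_int (int k + int j) * v)" for v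
    by (simp add: algebra_simps cos_add cos_diff)
  show ?thesis unfolding eq
    by (rule integral_unique, rule has_integral_eq_rhs, rule has_integral_add, (rule has_integral_mult_right, rule *)+) auto
qed

text \<open>Both sides of Poisson's formula, as functions of the shift v, have the same cosine
  coefficients on the half period.\<close>

lemma poisson_gauss:
  assumes b: "b > (0::real)" and v: "v \<in> {0..1/2}"
  defines "h \<equiv> (\<lambda>k v. case k of 0 \<Rightarrow> exp (- b * v\<^sup>2)
      | Suc k \<Rightarrow> exp (- b * (v + real (Suc k))\<^sup>2) + exp (- b * (v - real (Suc k))\<^sup>2))"
  defines "g \<equiv> (\<lambda>k v. case k of 0 \<Rightarrow> 1
      | Suc k \<Rightarrow> 2 * (exp (- ((pi\<^sup>2 / b) * (real (Suc k))\<^sup>2)) * cos (2 * pi * real (Suc k) * v)))"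
  shows "(\<Sum>k. h k v) = sqrt (pi / b) * (\<Sum>k. g k v)"
proof -
  define t where "t = pi\<^sup>2 / b"
  have t: "t > 0" using b by (simp add: t_def)
  define Mh where "Mh k = (case k of 0 \<Rightarrow> 1 | Suc k \<Rightarrow> 2 * exp (-b) ^ k)" for k
  define Mg where "Mg k = (case k of 0 \<Rightarrow> 1 | Suc k \<Rightarrow> 2 * exp (-t) ^ k)" for k
  have Mh: "summable Mh" and Mg: "summable Mg"
    using b t by (subst summable_Suc_iff[symmetric]; simp add: Mh_def Mg_def summable_geometric)+
  have hb: "\<bar>h k v\<bar> \<le> Mh k" if v: "v \<in> {0..1/2}" for k v
  proof (cases k)
    case 0
    then show ?thesis using b by (simp add: h_def Mh_def)
  next
    case (Suc i)
    have 1: "real i \<le> (v + real k)\<^sup>2"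
    proof -
      have "real i * 1 \<le> (v + real k) * (v + real k)" using v Suc by (intro mult_mono) auto
      thus ?thesis by (simp add: power2_eq_square)
    qed
    \<comment> \<open>With k = i + 1 and v at most 1/2 the translate nearest to 0 is still at
      distance at least i + 1/2.\<close>
    have 2: "real i \<le> (v - real k)\<^sup>2"
    proof -
      have "(real i + 1/2)\<^sup>2 \<le> (real k - v)\<^sup>2" using v Suc by (intro power_mono) auto
      moreover have "real i \<le> (real i + 1/2)\<^sup>2" by (simp add: power2_eq_square algebra_simps)
      ultimately show ?thesis by (simp add: power2_commute)
    qed
    have "exp (-b) ^ i = exp (- b * real i)" by (simp add: exp_of_nat_mult[symmetric] mult.commute)
    moreover have "exp (- b * (v + real k)\<^sup>2) \<le> exp (- b * real i)" "exp (- b * (v - real k)\<^sup>2) \<le> exp (- b * real i)"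
      using 1 2 b by auto
    ultimately have "exp (- b * (v + real k)\<^sup>2) + exp (- b * (v - real k)\<^sup>2) \<le> 2 * exp (-b) ^ i" by linarith
    thus ?thesis unfolding Suc by (simp add: h_def Mh_def)
  qed
  have gb: "\<bar>g k v\<bar> \<le> Mg k" for k v
  proof (cases k)
    case (Suc i)
    have "real i * 1 \<le> (real k) * (real k)" using Suc by (intro mult_mono) auto
    hence "exp (- (t * (real k)\<^sup>2)) \<le> exp (- (t * real i))" using t by (simp add: power2_eq_square)
    also have "\<dots> = exp (-t) ^ i" by (simp add: exp_of_nat_mult[symmetric] mult.commute)
    finally have "exp (- (t * (real k)\<^sup>2)) * \<bar>cos (2 * pi * real k * v)\<bar> \<le> exp (-t) ^ i * 1"
      by (intro mult_mono) auto
    then show ?thesis using Suc by (simp add: g_def Mg_def t_def abs_mult)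
  qed (simp add: g_def Mg_def)
  have hc: "continuous_on S (h k)" and gc: "continuous_on S (g k)" for S k
    unfolding h_def g_def by (cases k; auto intro!: continuous_intros)+
  have uh: "uniform_limit {0..1/2} (\<lambda>n v. \<Sum>k<n. h k v * cos (2 * pi * real j * v))
      (\<lambda>v. \<Sum>k. h k v * cos (2 * pi * real j * v)) sequentially" for j
  proof (rule Weierstrass_m_test[OF _ Mh])
    fix n and v :: real assume "v \<in> {0..1/2}"
    hence "\<bar>h n v\<bar> * \<bar>cos (2 * pi * real j * v)\<bar> \<le> Mh n * 1"
      using hb[of v n] by (intro mult_mono) (auto intro: order_trans[OF abs_ge_zero])
    thus "norm (h n v * cos (2 * pi * real j * v)) \<le> Mh n" by (simp add: abs_mult)
  qed
  have ug: "uniform_limit {0..1/2} (\<lambda>n v. \<Sum>k<n. g k v * cos (2 * pi * real j * v))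
      (\<lambda>v. \<Sum>k. g k v * cos (2 * pi * real j * v)) sequentially" for j
  proof (rule Weierstrass_m_test[OF _ Mg])
    fix n and v :: real assume "v \<in> {0..1/2}"
    hence "\<bar>g n v\<bar> * \<bar>cos (2 * pi * real j * v)\<bar> \<le> Mg n * 1"
      using gb[of n v] by (intro mult_mono) (auto intro: order_trans[OF abs_ge_zero])
    thus "norm (g n v * cos (2 * pi * real j * v)) \<le> Mg n" by (simp add: abs_mult)
  qed
  define H where "H v = (\<Sum>k. h k v)" for v
  define G where "G v = (\<Sum>k. g k v)" for v
  have sh: "summable (\<lambda>k. h k v)" if "v \<in> {0..1/2}" for v
    by (rule summable_comparison_test'[OF Mh, of 0]) (use hb that in auto)
  have sg: "summable (\<lambda>k. g k v)" for v
    by (rule summable_comparison_test'[OF Mg, of 0]) (use gb in auto)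
  have Hc: "continuous_on {0..1/2} H"
    using uniform_limit_theorem[OF _ uh[of 0]] unfolding H_def
    by (auto intro!: continuous_intros hc always_eventually)
  have Gc: "continuous_on {0..1/2} G"
    using uniform_limit_theorem[OF _ ug[of 0]] unfolding G_def
    by (auto intro!: continuous_intros gc always_eventually)
  have Hj: "integral {0..1/2} (\<lambda>v. H v * cos (2 * pi * real j * v)) =
      sqrt (pi / b) * exp (- (t * (real j)\<^sup>2)) / 2" for j
  proof -
    define w where "w = 2 * pi * real j"
    define f where "f x = exp (- b * x\<^sup>2) * cos (w * x)" for x
    have fi: "f integrable_on {x..y}" for x y
      unfolding f_def by (intro integrable_continuous_interval continuous_intros)
    have f_neg: "f (-x) = f x" for x by (simp add: f_def)
    have cos_shift: "cos (w * (x + real k)) = cos (w * x)" "cos (w * (x - real k)) = cos (w * x)" for x k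
    proof -
      have e: "w * (x + real k) = w * x + 2 * pi * real_of_int (int (j * k))"
              "w * (x - real k) = w * x - 2 * pi * real_of_int (int (j * k))"
        by (simp_all add: w_def algebra_simps)
      have p: "cos (2 * pi * real_of_int m) = 1" "sin (2 * pi * real_of_int m) = 0" for m :: int
        by (rule cos_int_2pin sin_int_2pin)+
      show "cos (w * (x + real k)) = cos (w * x)" "cos (w * (x - real k)) = cos (w * x)"
        unfolding e cos_add cos_diff p by simp_all
    qed
    \<comment> \<open>Unfolding: w is a multiple of 2 pi, so the cosine does not change under
      integer shifts. The k-th pair of Gaussians then covers [k, k + 1/2] directly and [k - 1/2, k]
      after a reflection, and the pieces fill [0, n + 1/2].\<close>
    have partial: "integral {0..1/2} (\<lambda>v. \<Sum>k<Suc n. h k v * cos (w * v)) =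
        integral {-(real n + 1/2)..real n + 1/2} f / 2" for n
    proof -
      have "integral {-(real n + 1/2)..0} f = integral {0..real n + 1/2} f"
        using Henstock_Kurzweil_Integration.integral_reflect_real[of "real n + 1/2" 0 f]
        by (simp only: f_neg minus_zero)
      hence even: "integral {0..real n + 1/2} f = integral {-(real n + 1/2)..real n + 1/2} f / 2"
        using Henstock_Kurzweil_Integration.integral_combine[of "-(real n + 1/2)" 0 "real n + 1/2" f] fi
        by (simp add: f_neg)
      have "integral {0..1/2} (\<lambda>v. \<Sum>k<Suc n. h k v * cos (w * v)) = integral {0..real n + 1/2} f"
      proof (induction n)
        case 0
        show ?case by (simp add: h_def f_def)
      next
        case (Suc n)
        have i: "(\<lambda>v. h k v * cos (w * v)) integrable_on {0..1/2}" for k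
          by (intro integrable_continuous_interval continuous_intros hc)
        have "h (Suc n) v * cos (w * v) = f (v + real (Suc n)) + f (v - real (Suc n))" for v
          by (simp only: h_def f_def cos_shift nat.case distrib_right)
        moreover have "(\<lambda>v. f (v + real (Suc n))) integrable_on {0..1/2}" "(\<lambda>v. f (v - real (Suc n))) integrable_on {0..1/2}"
          unfolding f_def by (intro integrable_continuous_interval continuous_intros)+
        ultimately have "integral {0..1/2} (\<lambda>v. h (Suc n) v * cos (w * v)) =
            integral {0..1/2} (\<lambda>v. f (v + real (Suc n))) + integral {0..1/2} (\<lambda>v. f (v - real (Suc n)))"
          by (simp add: integral_add)
        also have "integral {0..1/2} (\<lambda>v. f (v + real (Suc n))) = integral {real (Suc n)..real (Suc n) + 1/2} f"
          using integral_shift_Icc_real[of 0 "1/2" f "real (Suc n)"] by (simp add: o_def add_ac)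
        also have "integral {0..1/2} (\<lambda>v. f (v - real (Suc n))) = integral {-(real n + 1)..-(real n + 1/2)} f"
        proof -
          have "f \<circ> (+) (- real (Suc n)) = (\<lambda>v. f (v - real (Suc n)))"
            by (simp add: fun_eq_iff del: of_nat_Suc)
          moreover have "0 + - real (Suc n) = -(real n + 1)" "1/2 + - real (Suc n) = -(real n + 1/2)"
            by simp_all
          ultimately show ?thesis using integral_shift_Icc_real[of 0 "1/2" f "- real (Suc n)"] by (simp only:)
        qed
        also have "\<dots> = integral {real n + 1/2..real n + 1} f"
          using Henstock_Kurzweil_Integration.integral_reflect_real[of "real n + 1" "real n + 1/2" f]
          by (simp only: f_neg)
        finally have last: "integral {0..1/2} (\<lambda>v. h (Suc n) v * cos (w * v)) =
           integral {real n + 1/2..real n + 1} f + integral {real n + 1..real n + 1 + 1/2} f"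
          by (simp add: add_ac)
        have "integral {0..1/2} (\<lambda>v. \<Sum>k<Suc (Suc n). h k v * cos (w * v)) =
           integral {0..real n + 1/2} f + (integral {real n + 1/2..real n + 1} f +
           integral {real n + 1..real n + 1 + 1/2} f)"
        proof -
          have "(\<lambda>v. \<Sum>k<Suc n. h k v * cos (w * v)) integrable_on {0..1/2}"
            by (intro integrable_sum i) auto
          from integral_add[OF this i[of "Suc n"]] Suc.IH show ?thesis
            by (simp only: sum.lessThan_Suc[of _ "Suc n"] last)
        qed
        also have "integral {real n + 1/2..real n + 1} f + integral {real n + 1..real n + 1 + 1/2} f =
            integral {real n + 1/2..real n + 1 + 1/2} f"
          using fi by (intro Henstock_Kurzweil_Integration.integral_combine) auto
        also have "integral {0..real n + 1/2} f + \<dots> = integral {0..real n + 1 + 1/2} f"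
          using fi by (intro Henstock_Kurzweil_Integration.integral_combine) auto
        finally show ?case by (simp add: add_ac)
      qed
      thus ?thesis using even by simp
    qed
    obtain I J where IJ: "\<And>n. ((\<lambda>v. \<Sum>k<n. h k v * cos (w * v)) has_integral I n) {0..1/2}"
      "((\<lambda>v. \<Sum>k. h k v * cos (w * v)) has_integral J) {0..1/2}" "I \<longlonglongrightarrow> J"
      by (rule uniform_limit_integral[OF uh[of j, folded w_def]])
        (auto intro!: continuous_intros hc)
    have "I (Suc n) = integral {-(real n + 1/2)..real n + 1/2} f / 2" for n
      using IJ(1)[of "Suc n"] partial[of n] by (simp add: integral_unique)
    hence "(\<lambda>n. integral {-(real n + 1/2)..real n + 1/2} f / 2) = (\<lambda>n. I (Suc n))" by (simp only:)
    hence "(\<lambda>n. integral {-(real n + 1/2)..real n + 1/2} f / 2) \<longlonglongrightarrow> J"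
      using LIMSEQ_Suc[OF IJ(3)] by (simp only:)
    moreover have "(\<lambda>n. integral {-(real n + 1/2)..real n + 1/2} f / 2) \<longlonglongrightarrow>
        sqrt (pi / b) * exp (- (w\<^sup>2 / (4 * b))) / 2"
      unfolding f_def by (intro tendsto_intros gauss_cos_partial b) auto
    ultimately have "J = sqrt (pi / b) * exp (- (w\<^sup>2 / (4 * b))) / 2" by (rule LIMSEQ_unique)
    also have "w\<^sup>2 / (4 * b) = t * (real j)\<^sup>2" by (simp add: w_def t_def power_mult_distrib)
    finally have "J = sqrt (pi / b) * exp (- (t * (real j)\<^sup>2)) / 2" .
    moreover have "integral {0..1/2} (\<lambda>v. H v * cos (w * v)) = J"
    proof -
      have "integral {0..1/2} (\<lambda>v. H v * cos (w * v)) = integral {0..1/2} (\<lambda>v. \<Sum>k. h k v * cos (w * v))"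
        by (intro integral_cong) (simp add: H_def suminf_mult2[OF sh])
      thus ?thesis using IJ(2) by (simp add: integral_unique)
    qed
    ultimately show ?thesis by (simp add: w_def)
  qed
  have Gj: "integral {0..1/2} (\<lambda>v. G v * cos (2 * pi * real j * v)) = exp (- (t * (real j)\<^sup>2)) / 2" for j
  proof -
    define w where "w = 2 * pi * real j"
    have coef: "((\<lambda>v. g k v * cos (w * v)) has_integral (if k = j then exp (- (t * (real j)\<^sup>2)) / 2 else 0)) {0..1/2}" for k
    proof -
      define c where "c = (if k = 0 then 1 else 2 * exp (- (t * (real k)\<^sup>2)))"
      have eq: "g k v * cos (w * v) = c * (cos (2 * pi * real k * v) * cos (2 * pi * real j * v))" for v
        by (cases k) (auto simp: g_def c_def t_def w_def)
      have "((\<lambda>v. cos (2 * pi * real k * v) * cos (2 * pi * real j * v)) has_integral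
        (if j = k then if j = 0 then 1/2 else 1/4 else 0)) {0..1/2}"
        unfolding integral_cos_cos_half[symmetric]
        by (intro integrable_integral integrable_continuous_interval continuous_intros)
      from has_integral_mult_right[OF this, of c] show ?thesis
        unfolding eq by (rule has_integral_eq_rhs) (auto simp: c_def)
    qed
    obtain I J where IJ: "\<And>n. ((\<lambda>v. \<Sum>k<n. g k v * cos (w * v)) has_integral I n) {0..1/2}"
      "((\<lambda>v. \<Sum>k. g k v * cos (w * v)) has_integral J) {0..1/2}" "I \<longlonglongrightarrow> J"
      by (rule uniform_limit_integral[OF ug[of j, folded w_def]])
        (auto intro!: continuous_intros gc)
    have "I n = exp (- (t * (real j)\<^sup>2)) / 2" if "n \<ge> Suc j" for n
    proof -
      have "((\<lambda>v. \<Sum>k<n. g k v * cos (w * v)) has_integral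
         (\<Sum>k<n. (if k = j then exp (- (t * (real j)\<^sup>2)) / 2 else 0))) {0..1/2}"
        by (intro has_integral_sum coef) auto
      thus ?thesis using IJ(1)[of n] that by (auto dest: has_integral_unique)
    qed
    hence "I \<longlonglongrightarrow> exp (- (t * (real j)\<^sup>2)) / 2"
      by (intro tendsto_eventually eventually_sequentiallyI[of "Suc j"])
    hence "J = exp (- (t * (real j)\<^sup>2)) / 2" using IJ(3) LIMSEQ_unique by blast
    moreover have "integral {0..1/2} (\<lambda>v. G v * cos (w * v)) = J"
    proof -
      have "integral {0..1/2} (\<lambda>v. G v * cos (w * v)) = integral {0..1/2} (\<lambda>v. \<Sum>k. g k v * cos (w * v))"
        by (intro integral_cong) (simp add: G_def suminf_mult2[OF sg])
      thus ?thesis using IJ(2) by (simp add: integral_unique)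
    qed
    ultimately show ?thesis by (simp add: w_def)
  qed
  have "H v - sqrt (pi / b) * G v = 0"
  proof (rule orthogonal_to_cosines[OF _ _ v])
    show "continuous_on {0..1/2} (\<lambda>v. H v - sqrt (pi / b) * G v)"
      by (intro continuous_intros Hc Gc)
    fix j :: nat
    have i: "(\<lambda>v. H v * cos (2 * pi * real j * v)) integrable_on {0..1/2}"
       "(\<lambda>v. G v * cos (2 * pi * real j * v)) integrable_on {0..1/2}"
      by (intro integrable_continuous_interval continuous_intros Hc Gc)+
    have "integral {0..1/2} (\<lambda>v. H v * cos (2 * pi * real j * v) - sqrt (pi / b) * (G v * cos (2 * pi * real j * v))) = 0"
      unfolding integral_diff[OF i(1) integrable_on_mult_right[OF i(2)]] integral_mult_right Hj Gj by simp
    thus "integral {0..1/2} (\<lambda>v. (H v - sqrt (pi / b) * G v) * cos (2 * pi * real j * v)) = 0"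
      by (simp add: algebra_simps)
  qed
  thus ?thesis by (simp add: H_def G_def)
qed

section \<open>The series theta and psi and their inversion\<close>

definition theta :: "'a :: {real_normed_field, banach} \<Rightarrow> 'a" where
  "theta q = 1 + 2 * (\<Sum>k. (-1) ^ Suc k * q ^ (Suc k)\<^sup>2)"

text \<open>Since (k + 1/2)^2 = k (k + 1) + 1/4, this is Jacobi's theta_2 divided by 2 q^(1/4), with
  k and -k - 1 paired.\<close>

definition psi :: "'a :: {real_normed_field, banach} \<Rightarrow> 'a" where
  "psi q = (\<Sum>k. q ^ (k * (k + 1)))"

lemma summable_lacunary:
  fixes q :: "'a :: {real_normed_field, banach}"
  assumes "norm q < 1" "\<And>k. norm (c k) \<le> 1" "\<And>k. k \<le> g k"
  shows "summable (\<lambda>k. c k * q ^ g k)"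
proof (rule summable_comparison_test')
  show "summable (\<lambda>k. norm q ^ k)" using assms by (simp add: summable_geometric)
  show "norm (c k * q ^ g k) \<le> norm q ^ k" if "k \<ge> 0" for k
  proof -
    have "norm (c k * q ^ g k) \<le> 1 * norm q ^ g k"
      unfolding norm_mult norm_power using assms by (intro mult_right_mono) auto
    also have "\<dots> \<le> norm q ^ k" using assms by (simp add: power_decreasing)
    finally show ?thesis .
  qed
qed

lemma summable_theta:
  fixes q :: "'a :: {real_normed_field, banach}"
  shows "norm q < 1 \<Longrightarrow> summable (\<lambda>k. (-1) ^ Suc k * q ^ (Suc k)\<^sup>2)"
  by (rule summable_lacunary) (auto simp: norm_power power2_eq_square)

lemma summable_psi:
  fixes q :: "'a :: {real_normed_field, banach}"
  shows "norm q < 1 \<Longrightarrow> summable (\<lambda>k. q ^ (k * (k + 1)))"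
  using summable_lacunary[of q "\<lambda>_. 1" "\<lambda>k. k * (k + 1)"] by simp

text \<open>Poisson's formula at the shift v = 1/2: there cos(2 pi k v) = (-1)^k gives the
  alternating signs of theta, and the other side consists of Gaussians at half integers, hence
  psi.\<close>

lemma theta_inversion_real:
  assumes t: "t > (0::real)"
  shows "theta (exp (- t)) = 2 * sqrt (pi / t) * exp (- (pi\<^sup>2 / (4 * t))) * psi (exp (- (pi\<^sup>2 / t)))"
proof -
  define b where "b = pi\<^sup>2 / t"
  have b: "b > 0" "pi\<^sup>2 / b = t" using t by (auto simp: b_def)
  define h :: "nat \<Rightarrow> real" where "h k = (case k of 0 \<Rightarrow> exp (- b * (1/2)\<^sup>2)
      | Suc k \<Rightarrow> exp (- b * (1/2 + real (Suc k))\<^sup>2) + exp (- b * (1/2 - real (Suc k))\<^sup>2))" for k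
  define g :: "nat \<Rightarrow> real" where "g k = (case k of 0 \<Rightarrow> 1
      | Suc k \<Rightarrow> 2 * (exp (- (t * (real (Suc k))\<^sup>2)) * cos (2 * pi * real (Suc k) * (1/2))))" for k
  have eq: "(\<Sum>k. h k) = sqrt (pi / b) * (\<Sum>k. g k)"
    unfolding h_def g_def by (rule poisson_gauss[OF b(1), of "1/2", unfolded b(2)]) simp
  have g: "g sums theta (exp (- t))"
  proof -
    have "exp (- t) ^ (Suc k)\<^sup>2 = exp (- (t * (real (Suc k))\<^sup>2))" for k
      by (simp add: exp_of_nat_mult[symmetric] mult.commute)
    moreover have "cos (2 * pi * real (Suc k) * (1/2)) = (-1) ^ Suc k" for k
      using cos_npi2[of "Suc k"] by simp
    ultimately have "g (Suc k) = 2 * ((-1) ^ Suc k * exp (- t) ^ (Suc k)\<^sup>2)" for k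
      by (simp only: g_def nat.case mult_ac)
    moreover have "(\<lambda>k. 2 * ((-1) ^ Suc k * exp (- t) ^ (Suc k)\<^sup>2)) sums
       (2 * (\<Sum>k. (-1) ^ Suc k * exp (- t) ^ (Suc k)\<^sup>2))"
      using t by (intro sums_mult summable_sums summable_theta) auto
    ultimately have "(\<lambda>k. g (Suc k)) sums (theta (exp (- t)) - g 0)"
      by (simp only: theta_def) (simp add: g_def)
    thus ?thesis by (simp only: sums_Suc_iff) simp
  qed
  define P where "P = exp (- b / 4) * psi (exp (- b))"
  define p where "p k = exp (- b * (1/2 + real k)\<^sup>2)" for k
  have p: "p sums P"
  proof -
    have "p = (\<lambda>k. exp (- b / 4) * exp (- b) ^ (k * (k + 1)))"
      by (simp add: fun_eq_iff p_def exp_of_nat_mult[symmetric] power2_eq_square algebra_simps flip: exp_add)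
    moreover have "(\<lambda>k. exp (- b / 4) * exp (- b) ^ (k * (k + 1))) sums P"
      unfolding P_def psi_def using b by (intro sums_mult summable_sums summable_psi) auto
    ultimately show ?thesis by (simp only:)
  qed
  have h: "h sums (2 * P)"
  proof -
    have "h (Suc k) = p (Suc k) + p k" for k
    proof -
      have "(1/2 - real (Suc k))\<^sup>2 = (1/2 + real k)\<^sup>2" by (simp add: power2_eq_square algebra_simps)
      thus ?thesis by (simp only: h_def p_def nat.case)
    qed
    moreover have "(\<lambda>k. p (Suc k) + p k) sums (P - p 0 + P)"
      using p by (intro sums_add) (simp_all add: sums_Suc_iff)
    ultimately have "(\<lambda>k. h (Suc k)) sums (P - p 0 + P)" by (simp only:)
    hence "h sums (P - p 0 + P + h 0)" by (simp only: sums_Suc_iff)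
    moreover have "h 0 = p 0" by (simp add: h_def p_def)
    ultimately show ?thesis by simp
  qed
  have "2 * P = sqrt (pi / b) * theta (exp (- t))"
    using eq sums_unique[OF h] sums_unique[OF g] by simp
  moreover have "sqrt (pi / b) * sqrt (pi / t) = 1"
    using t by (simp add: b_def power2_eq_square flip: real_sqrt_mult)
  ultimately have "sqrt (pi / t) * (2 * P) = 1 * theta (exp (- t))"
    by (simp only: mult.assoc[symmetric] mult.commute[of "sqrt (pi / t)"])
  hence "theta (exp (- t)) = 2 * sqrt (pi / t) * (exp (- b / 4) * psi (exp (- b)))"
    unfolding P_def by (simp only: mult_1 mult_ac)
  moreover have "b / 4 = pi\<^sup>2 / (4 * t)" by (simp add: b_def)
  ultimately show ?thesis by (simp add: b_def)
qed

section \<open>The theta product in the unit disc\<close>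

text \<open>Expanding the logarithm in odd powers, only the linear term is treated exactly; this is
  what saves a factor away from the positive real axis.\<close>

lemma norm_ratio_saving:
  fixes w :: complex
  assumes "norm w < 1"
  shows "norm (1 + w) / norm (1 - w) \<le> exp (2 * Re w - 2 * norm w) * ((1 + norm w) / (1 - norm w))"
proof -
  \<comment> \<open>Coefficients of log((1 + w)/(1 - w)): 2/n for odd n and 0 for even n.\<close>
  define a where "a n = (-1) ^ Suc n / of_nat n * (1 - (-1) ^ n :: real)" for n :: nat
  have S: "(\<lambda>n. of_real (a n) * z ^ n) sums (Ln (1 + z) - Ln (1 - z))" if "norm z < 1" for z :: complex
  proof -
    have "(\<lambda>n. (-1) ^ Suc n / of_nat n * z ^ n - (-1) ^ Suc n / of_nat n * (- z) ^ n) sums (Ln (1 + z) - Ln (1 + (- z)))"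
      using that by (intro sums_diff Ln_series) auto
    moreover have "(-1) ^ Suc n / of_nat n * z ^ n - (-1) ^ Suc n / of_nat n * (- z) ^ n = of_real (a n) * z ^ n" for n
      by (simp add: a_def power_minus[of z] algebra_simps add_divide_distrib diff_divide_distrib)
    ultimately show ?thesis by simp
  qed
  have a: "a n \<ge> 0" for n by (cases "even n") (auto simp: a_def)
  define R where "R z = Re (Ln (1 + z) - Ln (1 - z))" for z
  have expR: "exp (R z) = norm (1 + z) / norm (1 - z)" if "norm z < 1" for z
  proof -
    have "1 + z \<noteq> 0" "1 - z \<noteq> 0" using that
      by (metis add.inverse_inverse add_eq_0_iff norm_minus_cancel norm_one order_less_irrefl,
          metis eq_iff_diff_eq_0 norm_one order_less_irrefl)
    thus ?thesis unfolding R_def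
      by (subst norm_exp_eq_Re[symmetric]) (simp add: exp_diff norm_divide)
  qed
  define \<rho> where "\<rho> = norm w"
  have s1: "(\<lambda>n. Re (of_real (a n) * w ^ n)) sums R w"
    unfolding R_def by (rule sums_Re[OF S[OF assms]])
  have s2: "(\<lambda>n. Re (of_real (a n) * of_real \<rho> ^ n)) sums R (of_real \<rho>)"
    unfolding R_def using assms by (intro sums_Re S) (simp add: \<rho>_def)
  have s3: "(\<lambda>n. if n = 1 then 2 * Re w - 2 * \<rho> else 0) sums (2 * Re w - 2 * \<rho>)"
    by (rule sums_single)
  have "R w \<le> R (of_real \<rho>) + (2 * Re w - 2 * \<rho>)"
  proof (rule sums_le[OF _ s1 sums_add[OF s2 s3]])
    fix n
    have "Re (w ^ n) \<le> \<rho> ^ n" using complex_Re_le_cmod[of "w ^ n"] by (simp add: norm_power \<rho>_def)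
    hence "a n * Re (w ^ n) \<le> a n * \<rho> ^ n" using a by (intro mult_left_mono) auto
    moreover have "Re (of_real (a n) * of_real \<rho> ^ n) = a n * \<rho> ^ n"
      by (simp flip: of_real_power of_real_mult)
    ultimately show "Re (of_real (a n) * w ^ n) \<le> Re (of_real (a n) * of_real \<rho> ^ n) + (if n = 1 then 2 * Re w - 2 * \<rho> else 0)"
      by (auto simp: a_def)
  qed
  hence "exp (R w) \<le> exp (R (of_real \<rho>)) * exp (2 * Re w - 2 * \<rho>)" by (simp flip: exp_add)
  also have "exp (R (of_real \<rho>)) = (1 + \<rho>) / (1 - \<rho>)"
  proof -
    have "norm (1 + complex_of_real \<rho>) = 1 + \<rho>" "norm (1 - complex_of_real \<rho>) = 1 - \<rho>"
      using assms norm_of_real[of "1 + \<rho>", where 'a = complex] norm_of_real[of "1 - \<rho>", where 'a = complex]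
      by (auto simp: \<rho>_def)
    thus ?thesis using expR[of "of_real \<rho>"] assms by (simp add: \<rho>_def)
  qed
  finally show ?thesis using expR[OF assms] by (simp add: \<rho>_def mult.commute)
qed

lemma psi_ge_1: "0 \<le> r \<Longrightarrow> r < 1 \<Longrightarrow> psi (r :: real) \<ge> 1"
  unfolding psi_def using sum_le_suminf[OF summable_psi[of r], of "{0}"] by auto

section \<open>Convergence of the product to the theta series\<close>

text \<open>Positivity is not visible in the alternating series; after inversion every factor is
  positive.\<close>

lemma theta_pos:
  assumes "0 \<le> r" "r < (1::real)"
  shows "theta r > 0"
proof (cases "r = 0")
  case False
  define t where "t = - ln r"
  have t: "t > 0" "r = exp (- t)" using False assms by (auto simp: t_def)
  have "psi (exp (- (pi\<^sup>2 / t))) \<ge> 1" using t by (intro psi_ge_1) auto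
  thus ?thesis unfolding t(2) theta_inversion_real[OF t(1)] using t by simp
qed (simp add: theta_def power_0_left)

definition theta_prod :: "nat \<Rightarrow> 'a :: real_normed_field \<Rightarrow> 'a" where
  "theta_prod n q = (\<Prod>j=1..n. (1 - q ^ j) / (1 + q ^ j))"

lemma one_plus_power_nz:
  fixes q :: "'a :: real_normed_field"
  assumes "norm q < 1" "j \<ge> 1"
  shows "1 + q ^ j \<noteq> 0" "1 - q ^ j \<noteq> 0"
proof -
  have "norm (q ^ j) < 1" using assms by (simp add: norm_power power_less_one_iff)
  thus "1 + q ^ j \<noteq> 0" "1 - q ^ j \<noteq> 0"
    by (metis add_eq_0_iff norm_minus_cancel norm_one order_less_irrefl,
        metis eq_iff_diff_eq_0 norm_one order_less_irrefl)
qed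

text \<open>In the finite identity the correction is at most n r^n C/(1 - r) once the tail products
  are bounded by C. For real q one can take C = 1; for complex q the bound has to come from the real
  case.\<close>

lemma theta_prod_limit_aux:
  fixes q :: "'a :: {real_normed_field, banach}"
  assumes q: "norm q < 1" and C: "\<And>k n. k \<le> n \<Longrightarrow> norm (\<Prod>j=k+1..n. (1 - q ^ j) / (1 + q ^ j)) \<le> C"
  shows "(\<lambda>n. theta_prod n q) \<longlonglongrightarrow> theta q"
proof -
  define r where "r = norm q"
  have r: "0 \<le> r" "r < 1" using q by (auto simp: r_def)
  define S where "S n = 1 + 2 * (\<Sum>k=1..n. (-1) ^ k * q ^ k\<^sup>2)" for n
  define e where "e j = 1 / (1 + q ^ j)" for j
  define E where "E n = (\<Sum>k=1..n. (-1) ^ k * (\<Prod>j=k+1..n. (1 - q ^ j) * e j) * e k * q ^ (k * (n + 1)))" for n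
  have C0: "C \<ge> 0" using C[of 0 0] by simp
  have "S n = theta_prod n q + 2 * E n" for n
    unfolding S_def E_def theta_prod_def
    using finite_gauss_identity[of q e n] one_plus_power_nz[OF q] by (simp add: e_def)
  hence tp: "theta_prod n q = S n - 2 * E n" for n by simp
  have "norm (E n) \<le> real n * r ^ n * (C / (1 - r))" for n
  proof -
    have "norm (E n) \<le> (\<Sum>k=1..n. r ^ n * (C / (1 - r)))"
      unfolding E_def
    proof (intro sum_norm_le)
      fix k assume k: "k \<in> {1..n}"
      have "1 - r \<le> 1 - r ^ k" using k r power_decreasing[of 1 k r] by simp
      also have "\<dots> \<le> norm (1 + q ^ k)"
        using norm_triangle_ineq2[of 1 "- (q ^ k)"] by (simp add: norm_power r_def)
      finally have ek: "norm (e k) \<le> 1 / (1 - r)"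
        unfolding e_def norm_divide norm_one using r by (intro divide_left_mono) (auto intro!: mult_pos_pos)
      have "1 * (n + 1) \<le> k * (n + 1)" using k by (intro mult_le_mono) auto
      hence "norm (q ^ (k * (n + 1))) \<le> r ^ n"
        unfolding norm_power r_def[symmetric] using r by (intro power_decreasing) auto
      hence "norm ((-1) ^ k * (\<Prod>j=k+1..n. (1 - q ^ j) * e j) * e k * q ^ (k * (n + 1))) \<le> (1 * C * (1 / (1 - r))) * r ^ n"
        unfolding norm_mult using ek C[of k n] k r C0
        by (intro mult_mono mult_nonneg_nonneg) (auto simp: norm_power e_def)
      thus "norm ((-1) ^ k * (\<Prod>j=k+1..n. (1 - q ^ j) * e j) * e k * q ^ (k * (n + 1))) \<le> r ^ n * (C / (1 - r))"
        by (simp add: mult.commute)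
    qed
    thus ?thesis by simp
  qed
  moreover have "(\<lambda>n. real n * r ^ n * (C / (1 - r))) \<longlonglongrightarrow> 0 * (C / (1 - r))"
    using r by (intro tendsto_mult tendsto_const powser_times_n_limit_0) auto
  ultimately have "E \<longlonglongrightarrow> 0"
    by (intro Lim_null_comparison[of E "\<lambda>n. real n * r ^ n * (C / (1 - r))"]) (auto intro!: always_eventually)
  moreover have "S \<longlonglongrightarrow> theta q"
  proof -
    have "(\<lambda>n. \<Sum>k<n. (-1) ^ Suc k * q ^ (Suc k)\<^sup>2) \<longlonglongrightarrow> (\<Sum>k. (-1) ^ Suc k * q ^ (Suc k)\<^sup>2)"
      using summable_theta[OF q] by (rule summable_LIMSEQ)
    moreover have "(\<Sum>k<n. (-1) ^ Suc k * q ^ (Suc k)\<^sup>2) = (\<Sum>k=1..n. (-1) ^ k * q ^ k\<^sup>2)" for n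
      by (rule sum.reindex_bij_witness[of _ "\<lambda>k. k - 1" Suc]) auto
    ultimately show ?thesis unfolding S_def theta_def by (intro tendsto_intros) simp
  qed
  ultimately have "(\<lambda>n. S n - 2 * E n) \<longlonglongrightarrow> theta q - 2 * 0" by (intro tendsto_intros)
  thus ?thesis by (simp add: tp)
qed

lemma theta_prod_limit_real:
  assumes "0 \<le> r" "r < (1::real)"
  shows "(\<lambda>n. theta_prod n r) \<longlonglongrightarrow> theta r"
proof (rule theta_prod_limit_aux)
  fix k n :: nat
  have "0 \<le> (\<Prod>j=k+1..n. (1 - r ^ j) / (1 + r ^ j))" "(\<Prod>j=k+1..n. (1 - r ^ j) / (1 + r ^ j)) \<le> 1"
    using assms by (auto intro!: prod_nonneg prod_le_1 simp: power_le_one add_nonneg_pos divide_le_eq)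
  thus "norm (\<Prod>j=k+1..n. (1 - r ^ j) / (1 + r ^ j)) \<le> 1" by simp
qed (use assms in auto)

lemma theta_prod_pos: "0 \<le> r \<Longrightarrow> r < (1::real) \<Longrightarrow> theta_prod n r > 0"
  unfolding theta_prod_def
  by (intro prod_pos) (auto intro!: divide_pos_pos add_pos_nonneg simp: power_less_one_iff)

lemma theta_le_theta_prod:
  assumes "0 \<le> r" "r < (1::real)"
  shows "theta r \<le> theta_prod n r"
proof (rule LIMSEQ_le_const2[OF theta_prod_limit_real[OF assms]], rule exI[of _ n], safe)
  fix m assume "n \<le> m"
  thus "theta_prod m r \<le> theta_prod n r"
  proof (induction rule: dec_induct)
    case (step m)
    have "(1 - r ^ Suc m) / (1 + r ^ Suc m) \<le> 1" using assms by (simp add: divide_le_eq add_nonneg_pos)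
    hence "theta_prod m r * ((1 - r ^ Suc m) / (1 + r ^ Suc m)) \<le> theta_prod m r * 1"
      using theta_prod_pos[OF assms, of m] by (intro mult_left_mono) auto
    thus ?case using step.IH by (simp add: theta_prod_def)
  qed auto
qed

text \<open>Replacing q^j by r^j in the worst direction turns a tail product into
  \<open>theta_prod k r / theta_prod n r\<close>, which is at most \<open>1 / theta r\<close>. So
  the positivity obtained from inversion supplies the uniform bound.\<close>

lemma theta_prod_limit:
  assumes q: "norm (q :: complex) < 1"
  shows "(\<lambda>n. theta_prod n q) \<longlonglongrightarrow> theta q"
proof (rule theta_prod_limit_aux[OF q])
  fix k n :: nat assume "k \<le> n"
  define r where "r = norm q"
  have r: "0 \<le> r" "r < 1" using q by (auto simp: r_def)
  have rj: "r ^ j < 1" if "j \<ge> 1" for j using r that by (simp add: power_less_one_iff)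
  have "norm (\<Prod>j=k+1..n. (1 - q ^ j) / (1 + q ^ j)) \<le> (\<Prod>j=k+1..n. (1 + r ^ j) / (1 - r ^ j))"
    unfolding prod_norm[symmetric]
  proof (intro prod_mono conjI)
    fix j assume j: "j \<in> {k+1..n}"
    have "norm (1 - q ^ j) \<le> 1 + r ^ j"
      using norm_triangle_ineq4[of 1 "q ^ j"] by (simp add: norm_power r_def)
    moreover have "1 - r ^ j \<le> norm (1 + q ^ j)"
      using norm_triangle_ineq2[of 1 "- (q ^ j)"] by (simp add: norm_power r_def)
    ultimately show "norm ((1 - q ^ j) / (1 + q ^ j)) \<le> (1 + r ^ j) / (1 - r ^ j)"
      unfolding norm_divide using rj[of j] j r by (intro frac_le) auto
  qed auto
  also have "\<dots> = theta_prod k r / theta_prod n r"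
  proof -
    have "theta_prod n r = theta_prod k r * (\<Prod>j=k+1..n. (1 - r ^ j) / (1 + r ^ j))"
    proof -
      have "{1..n} = {1..k} \<union> {k+1..n}" using \<open>k \<le> n\<close> by auto
      thus ?thesis unfolding theta_prod_def by (simp add: prod.union_disjoint)
    qed
    moreover have "(\<Prod>j=k+1..n. (1 + r ^ j) / (1 - r ^ j)) = 1 / (\<Prod>j=k+1..n. (1 - r ^ j) / (1 + r ^ j))"
      by (simp add: prod_dividef)
    ultimately show ?thesis using theta_prod_pos[OF r, of k] by simp
  qed
  also have "\<dots> \<le> 1 / theta r"
  proof (intro frac_le)
    show "theta_prod k r \<le> 1" unfolding theta_prod_def
      using r by (intro prod_le_1) (auto simp: power_le_one add_nonneg_pos divide_le_eq)
  qed (use r theta_pos theta_le_theta_prod in auto)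
  finally show "norm (\<Prod>j=k+1..n. (1 - q ^ j) / (1 + q ^ j)) \<le> 1 / theta r" .
qed

text \<open>\<open>norm_ratio_saving\<close> at w = q^j, multiplied over all j: the linear terms add
  up to geometric series, which explains q/(1 - q) and r/(1 - r).\<close>

lemma theta_saving:
  assumes q: "norm (q :: complex) < 1"
  defines "r \<equiv> norm q"
  shows "theta r \<le> norm (theta q) * exp (2 * Re (q / (1 - q)) - 2 * r / (1 - r))"
proof -
  have r: "0 \<le> r" "r < 1" using q by (auto simp: r_def)
  define X where "X n = (\<Sum>j=1..n. 2 * Re (q ^ j) - 2 * r ^ j)" for n
  have X: "X \<longlonglongrightarrow> 2 * Re (q / (1 - q)) - 2 * r / (1 - r)"
  proof -
    have geo: "(\<lambda>n. z * (z ^ n)) sums (z * (1 / (1 - z)))" if "norm z < 1" for z :: complex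
      using that by (intro sums_mult geometric_sums)
    have geo_r: "(\<lambda>n. r * (r ^ n)) sums (r * (1 / (1 - r)))"
      using r by (intro sums_mult geometric_sums) auto
    have "(\<lambda>n. 2 * Re (q * q ^ n) - 2 * (r * r ^ n)) sums (2 * Re (q * (1 / (1 - q))) - 2 * (r * (1 / (1 - r))))"
      by (rule sums_diff, rule sums_mult, rule sums_Re, rule geo, rule q, rule sums_mult, rule geo_r)
    hence "(\<lambda>n. \<Sum>j<n. 2 * Re (q ^ Suc j) - 2 * r ^ Suc j) \<longlonglongrightarrow> 2 * Re (q / (1 - q)) - 2 * r / (1 - r)"
      by (simp add: sums_def)
    moreover have "(\<Sum>j<n. 2 * Re (q ^ Suc j) - 2 * r ^ Suc j) = X n" for n unfolding X_def
      by (rule sum.reindex_bij_witness[of _ "\<lambda>k. k - 1" Suc]) auto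
    ultimately show ?thesis by simp
  qed
  have le: "theta_prod n r \<le> norm (theta_prod n q) * exp (X n)" for n
  proof -
    have "theta_prod n r \<le> (\<Prod>j=1..n. norm ((1 - q ^ j) / (1 + q ^ j)) * exp (2 * Re (q ^ j) - 2 * r ^ j))"
      unfolding theta_prod_def
    proof (intro prod_mono conjI)
      fix j assume j: "j \<in> {1..n}"
      define w where "w = q ^ j"
      have w: "norm w = r ^ j" by (simp add: w_def r_def norm_power)
      have rj: "r ^ j < 1" "0 \<le> r ^ j" using r j by (auto simp: power_less_one_iff)
      have nz: "norm (1 + w) > 0" "norm (1 - w) > 0" using one_plus_power_nz[OF q, of j] j by (auto simp: w_def)
      have "norm (1 + w) / norm (1 - w) \<le> exp (2 * Re w - 2 * r ^ j) * ((1 + r ^ j) / (1 - r ^ j))"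
        using norm_ratio_saving[of w] rj by (simp add: w)
      hence "(1 - r ^ j) / (1 + r ^ j) \<le> norm (1 - w) / norm (1 + w) * exp (2 * Re w - 2 * r ^ j)"
        using nz rj by (simp add: field_simps)
      thus "(1 - r ^ j) / (1 + r ^ j) \<le> norm ((1 - q ^ j) / (1 + q ^ j)) * exp (2 * Re (q ^ j) - 2 * r ^ j)"
        by (simp add: w_def norm_divide)
      show "0 \<le> (1 - r ^ j) / (1 + r ^ j)" using rj by simp
    qed
    also have "\<dots> = norm (theta_prod n q) * exp (X n)"
      by (simp add: prod.distrib theta_prod_def X_def exp_sum prod_norm)
    finally show ?thesis .
  qed
  show ?thesis
  proof (rule LIMSEQ_le)
    show "(\<lambda>n. theta_prod n r) \<longlonglongrightarrow> theta r" by (rule theta_prod_limit_real[OF r])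
    show "(\<lambda>n. norm (theta_prod n q) * exp (X n)) \<longlonglongrightarrow> norm (theta q) * exp (2 * Re (q / (1 - q)) - 2 * r / (1 - r))"
      by (intro tendsto_intros theta_prod_limit q X)
  qed (use le in auto)
qed

lemma theta_nz: "norm (q :: complex) < 1 \<Longrightarrow> theta q \<noteq> 0"
  using theta_saving[of q] theta_pos[of "norm q"] by auto

section \<open>Complex inversion and the generating function\<close>

text \<open>Filling the gaps with zero coefficients makes theta and psi ordinary power series, from
  which holomorphy follows.\<close>

lemma lacunary_sums:
  fixes q :: complex
  assumes "strict_mono g" "norm q < 1" "\<And>k. norm (c k) \<le> 1"
  shows "(\<lambda>n. (if n \<in> range g then c (inv g n) else 0) * q ^ n) sums (\<Sum>k. c k * q ^ g k)"
proof -
  have "(\<lambda>k. c k * q ^ g k) sums (\<Sum>k. c k * q ^ g k)"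
    using assms seq_suble[OF assms(1)] by (intro summable_sums summable_lacunary)
  hence "(\<lambda>k. (if g k \<in> range g then c (inv g (g k)) else 0) * q ^ g k) sums (\<Sum>k. c k * q ^ g k)"
    using strict_mono_imp_inj_on[OF assms(1)] by (simp add: inv_f_f)
  thus ?thesis by (subst (asm) sums_mono_reindex[OF assms(1)]) auto
qed

lemma lacunary_holomorphic:
  assumes "strict_mono g" "\<And>k. norm (c k) \<le> 1"
  shows "(\<lambda>q :: complex. \<Sum>k. c k * q ^ g k) holomorphic_on ball 0 1"
proof (rule power_series_holomorphic)
  fix w :: complex assume "w \<in> ball 0 1"
  thus "(\<lambda>n. (if n \<in> range g then c (inv g n) else 0) * (w - 0) ^ n) sums (\<Sum>k. c k * w ^ g k)"
    using lacunary_sums[of g w c] assms by simp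
qed

lemma theta_holomorphic: "(theta :: complex \<Rightarrow> complex) holomorphic_on ball 0 1"
proof -
  have "(\<lambda>q :: complex. \<Sum>k. (-1) ^ Suc k * q ^ (Suc k)\<^sup>2) holomorphic_on ball 0 1"
    by (rule lacunary_holomorphic) (auto simp: strict_mono_def norm_power power_strict_mono)
  thus ?thesis unfolding theta_def[abs_def] by (intro holomorphic_intros)
qed

lemma psi_holomorphic: "(psi :: complex \<Rightarrow> complex) holomorphic_on ball 0 1"
proof -
  have "strict_mono (\<lambda>k. k * (k + 1) :: nat)" by (auto simp: strict_mono_Suc_iff)
  hence "(\<lambda>q :: complex. \<Sum>k. 1 * q ^ (k * (k + 1))) holomorphic_on ball 0 1"
    by (rule lacunary_holomorphic) auto
  thus ?thesis unfolding psi_def[abs_def] by simp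
qed

lemma theta_of_real: "norm r < 1 \<Longrightarrow> theta (complex_of_real r) = of_real (theta r)"
  unfolding theta_def using summable_theta[of r]
  by (simp only: of_real_add of_real_mult of_real_1 of_real_numeral) (simp add: suminf_of_real)

lemma psi_of_real: "norm r < 1 \<Longrightarrow> psi (complex_of_real r) = of_real (psi r)"
  unfolding psi_def using summable_psi[of r] by (simp add: suminf_of_real)

lemma Re_inverse_pos: "Re z > 0 \<Longrightarrow> Re (1 / z) > 0"
  by (simp add: Re_divide sum_power2_gt_zero_iff)

lemma Re_real_divide: "Re (complex_of_real a / z) = a * Re (1 / z)"
  by (simp add: Re_divide)

text \<open>Analytic continuation of the real formula to the right half plane; pi/z has positive
  real part there, so it avoids the branch cut of \<open>csqrt\<close>.\<close>

lemma theta_inversion: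
  assumes "Re z > 0"
  shows "theta (exp (- z)) = 2 * csqrt (of_real pi / z) * exp (- (of_real (pi\<^sup>2 / 4) / z)) * psi (exp (- (of_real (pi\<^sup>2) / z)))"
proof -
  define S where "S = {z. Re z > 0}"
  define f where "f z = theta (exp (- z)) - 2 * csqrt (of_real pi / z) * exp (- (of_real (pi\<^sup>2 / 4) / z)) *
     psi (exp (- (of_real (pi\<^sup>2) / z)))" for z :: complex
  have "f z = 0"
  proof (rule analytic_continuation[of f S "of_real ` {0<..}" 1])
    show "open S" unfolding S_def by (rule open_halfspace_Re_gt)
    show "connected S" unfolding S_def by (intro convex_connected convex_halfspace_Re_gt)
    have nz: "z \<noteq> 0" if "z \<in> S" for z using that by (auto simp: S_def)
    have pos: "Re (of_real a / z) > 0" if "z \<in> S" "a > 0" for a z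
      unfolding Re_real_divide using that Re_inverse_pos[of z] by (simp add: S_def)
    show "f holomorphic_on S" unfolding f_def
    proof (intro holomorphic_intros holomorphic_on_compose_gen[OF _ theta_holomorphic, unfolded o_def]
         holomorphic_on_compose_gen[OF _ psi_holomorphic, unfolded o_def])
      show "(\<lambda>z. exp (- z)) ` S \<subseteq> ball 0 1" by (auto simp: S_def)
      show "(\<lambda>z. exp (- (of_real (pi\<^sup>2) / z))) ` S \<subseteq> ball 0 1"
        using pos[of _ "pi\<^sup>2"] by auto
      show "of_real pi / z \<notin> \<real>\<^sub>\<le>\<^sub>0" if "z \<in> S" for z
        using pos[OF that pi_gt_zero] by (auto simp: complex_nonpos_Reals_iff)
    qed (use nz in auto)
    show "of_real ` {0<..} \<subseteq> S" by (auto simp: S_def)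
    show "(1::complex) \<in> S" by (simp add: S_def)
    show "(1::complex) islimpt of_real ` {0<..}"
      unfolding islimpt_approachable
    proof (intro allI impI)
      fix e :: real assume "e > 0"
      have "complex_of_real (1 + e / 2) \<in> complex_of_real ` {0<..}" using \<open>e > 0\<close> by (intro imageI) simp
      moreover have "complex_of_real (1 + e / 2) \<noteq> 1" using \<open>e > 0\<close> by (simp only: of_real_eq_1_iff)
      moreover have "dist (complex_of_real (1 + e / 2)) 1 < e"
        using \<open>e > 0\<close> dist_of_real[of "1 + e / 2" 1, where 'a = complex] by (simp add: dist_real_def)
      ultimately show "\<exists>x'\<in>complex_of_real ` {0<..}. x' \<noteq> 1 \<and> dist x' 1 < e" by blast
    qed
    fix w :: complex assume "w \<in> of_real ` {0<..}"
    then obtain t :: real where t: "t > 0" "w = of_real t" by auto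
    have e: "exp (- w) = of_real (exp (- t))" "exp (- (of_real (pi\<^sup>2) / w)) = of_real (exp (- (pi\<^sup>2 / t)))"
       "exp (- (of_real (pi\<^sup>2 / 4) / w)) = of_real (exp (- (pi\<^sup>2 / (4 * t))))"
      unfolding t(2) by (simp_all flip: exp_of_real)
    have "csqrt (of_real pi / w) = of_real (sqrt (pi / t))"
      using t(1) of_real_sqrt[of "pi / t"] by (simp add: t(2))
    thus "f w = 0" unfolding f_def e using t theta_inversion_real[OF t(1)]
      by (simp add: theta_of_real psi_of_real)
  qed (use assms in \<open>simp add: S_def\<close>)
  thus ?thesis by (simp add: f_def)
qed

section \<open>The generating function as an analytic function on the disc\<close>

lemma theta_coeff_sums:
  fixes q :: complex
  assumes "norm q < 1" "d \<ge> 1"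
  shows "(\<lambda>k. theta_coeff d k * q ^ k) sums theta (q ^ d)"
proof -
  define g where "g k = d * (Suc k)\<^sup>2" for k
  have g: "strict_mono g" using assms by (auto simp: g_def strict_mono_def power_strict_mono)
  define f where "f n = (theta_coeff d n - (if n = 0 then 1 else 0)) * q ^ n" for n
  have fg: "f (g k) = 2 * ((-1) ^ Suc k * (q ^ d) ^ (Suc k)\<^sup>2)" for k
  proof -
    have "g k > 0" "\<exists>j. g k = d * j\<^sup>2" "g k div d = (Suc k)\<^sup>2" using assms by (auto simp: g_def)
    moreover have "(-1) ^ (Suc k)\<^sup>2 = ((-1) ^ Suc k :: complex)" by (cases "even k") auto
    ultimately have "theta_coeff d (g k) = (2 * (-1) ^ Suc k :: complex)" unfolding theta_coeff_def by simp
    thus ?thesis using \<open>g k > 0\<close> by (simp add: f_def) (simp add: g_def power_mult)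
  qed
  have "norm (q ^ d) < 1" using assms by (simp add: norm_power power_less_one_iff)
  hence "(\<lambda>k. 2 * ((-1) ^ Suc k * (q ^ d) ^ (Suc k)\<^sup>2)) sums (theta (q ^ d) - 1)"
    unfolding theta_def by (simp only: add_diff_cancel_left' add.commute[of 1] add_diff_cancel)
      (intro sums_mult summable_sums summable_theta)
  hence "(\<lambda>k. f (g k)) sums (theta (q ^ d) - 1)" by (simp only: fg)
  hence "f sums (theta (q ^ d) - 1)"
  proof (subst (asm) sums_mono_reindex[OF g])
    fix n assume n: "n \<notin> range g"
    show "f n = 0"
    proof (cases "n = 0")
      case False
      have "\<not> (\<exists>j. n = d * j\<^sup>2)"
      proof safe
        fix j assume "n = d * j\<^sup>2"
        moreover from this False obtain i where "j = Suc i" by (cases j) auto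
        ultimately have "n = g i" by (simp add: g_def)
        thus False using n by auto
      qed
      thus ?thesis using False by (simp add: f_def theta_coeff_def)
    qed (simp add: f_def)
  qed
  hence "(\<lambda>n. f n + (if n = 0 then 1 else 0)) sums (theta (q ^ d) - 1 + 1)"
    by (intro sums_add sums_single)
  moreover have "f n + (if n = 0 then 1 else 0) = theta_coeff d n * q ^ n" for n
    by (simp add: f_def algebra_simps)
  ultimately show ?thesis by simp
qed

lemma theta_has_fps_expansion:
  assumes "d \<ge> 1"
  shows "(\<lambda>q :: complex. theta (q ^ d)) has_fps_expansion theta_fps d"
  unfolding has_fps_expansion_def
proof
  have "conv_radius (theta_coeff d :: nat \<Rightarrow> complex) \<ge> ereal 1"
  proof (rule conv_radius_geI_ex')
    fix r assume "0 < r" "ereal r < ereal 1"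
    thus "summable (\<lambda>n. theta_coeff d n * (of_real r :: complex) ^ n)"
      using theta_coeff_sums[of "of_real r" d] assms by (auto simp: sums_iff)
  qed
  hence "fps_conv_radius (theta_fps d :: complex fps) \<ge> ereal 1"
    by (simp add: fps_conv_radius_def)
  thus "fps_conv_radius (theta_fps d :: complex fps) > 0"
    by (rule less_le_trans[rotated]) simp
  have "eventually (\<lambda>q. q \<in> ball 0 1) (nhds (0::complex))" by (intro eventually_nhds_in_open) auto
  thus "\<forall>\<^sub>F z in nhds 0. eval_fps (theta_fps d) z = theta (z ^ d :: complex)"
    by eventually_elim (use theta_coeff_sums assms in \<open>auto simp: eval_fps_def sums_iff\<close>)
qed

text \<open>theta has no zeros in the unit disc, so the reciprocal is holomorphic there and its
  Taylor series converges on the whole disc. That series is the formal inverse, because the map from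
  functions to expansions respects products.\<close>

lemma cubic_overpartition_sums:
  assumes "norm (q :: complex) < 1"
  shows "(\<lambda>n. of_real (cubic_overpartition n) * q ^ n) sums (1 / (theta q * theta (q\<^sup>2)))"
    "summable (\<lambda>n. norm (complex_of_real (cubic_overpartition n) * q ^ n))"
proof -
  define T where "T = (theta_fps 1 * theta_fps 2 :: complex fps)"
  define G where "G q = inverse (theta q * theta (q\<^sup>2))" for q :: complex
  have 1: "(\<lambda>q. theta q * theta (q\<^sup>2)) has_fps_expansion T"
    using has_fps_expansion_mult[OF theta_has_fps_expansion[of 1] theta_has_fps_expansion[of 2]] by (simp add: T_def)
  have "G has_fps_expansion inverse T"
    unfolding G_def by (rule has_fps_expansion_inverse[OF 1]) (simp add: T_def)
  have sq: "norm (w\<^sup>2) < 1" if "norm w < 1" for w :: complex using that by (simp add: norm_power power_less_one_iff)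
  have hol: "G holomorphic_on ball 0 1"
  proof -
    have "(\<lambda>q. theta (q\<^sup>2)) holomorphic_on ball (0::complex) 1"
      by (rule holomorphic_on_compose_gen[OF _ theta_holomorphic, unfolded o_def])
        (use sq in \<open>auto intro!: holomorphic_intros\<close>)
    thus ?thesis unfolding G_def using theta_nz sq
      by (intro holomorphic_intros theta_holomorphic) auto
  qed
  have "G has_fps_expansion fps_expansion G 0"
    by (rule has_fps_expansion_fps_expansion[OF _ _ hol]) auto
  with \<open>G has_fps_expansion inverse T\<close> have eq: "inverse T = fps_expansion G 0"
    by (rule fps_expansion_unique_complex)
  define R where "R f = Abs_fps (\<lambda>n. complex_of_real (fps_nth f n))" for f
  have Rm: "R (f * g) = R f * R g" for f g
    by (simp add: R_def fps_eq_iff fps_mult_nth)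
  have Rt: "R (theta_fps d) = theta_fps d" for d
    by (simp add: R_def fps_eq_iff theta_coeff_def)
  define Tr where "Tr = (theta_fps 1 * theta_fps 2 :: real fps)"
  have "Tr * inverse Tr = 1" using inverse_mult_eq_1'[of Tr] by (simp add: Tr_def)
  hence "R (Tr * inverse Tr) = 1" by (simp add: R_def fps_eq_iff)
  hence "T * R (inverse Tr) = 1" by (simp add: Rm Tr_def Rt T_def)
  hence "R (inverse Tr) = inverse T" using fps_inverse_unique by metis
  hence "fps_nth (R (inverse Tr)) n = fps_nth (fps_expansion G 0) n" for n using eq by simp
  hence coeff: "complex_of_real (cubic_overpartition n) = fps_nth (fps_expansion G 0) n" for n
    by (simp add: R_def cubic_overpartition_eq Tr_def)
  have rad: "fps_conv_radius (fps_expansion G 0) \<ge> ereal 1"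
    by (rule conv_radius_fps_expansion) (use hol in \<open>simp add: eball_def ball_def\<close>)
  have q: "ereal (norm q) < fps_conv_radius (fps_expansion G 0)"
    using assms rad by (metis ereal_less(3) less_le_trans less_ereal.simps(1) one_ereal_def)
  show "(\<lambda>n. of_real (cubic_overpartition n) * q ^ n) sums (1 / (theta q * theta (q\<^sup>2)))"
  proof -
    have "(\<lambda>n. fps_nth (fps_expansion G 0) n * q ^ n) sums eval_fps (fps_expansion G 0) q"
      by (rule sums_eval_fps[OF q])
    also have "eval_fps (fps_expansion G 0) q = G q"
      using eval_fps_expansion'[of G 0 1 q] hol assms by (simp add: eball_def ball_def one_ereal_def)
    also have "G q = 1 / (theta q * theta (q\<^sup>2))" by (simp add: G_def inverse_eq_divide)
    finally show ?thesis unfolding coeff .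
  qed
  show "summable (\<lambda>n. norm (complex_of_real (cubic_overpartition n) * q ^ n))"
    unfolding coeff by (rule norm_summable_fps[OF q])
qed

section \<open>The generating function on a vertical line\<close>

text \<open>The sum pi^2/4 + pi^2/8 of the exponents in the inversion formula at z and at 2 z. The
  factor \<open>cop_scale\<close> below is 1/(4 sqrt(1/2) pi), from the prefactors of the same two
  formulas.\<close>

definition cop_rate :: real where "cop_rate = 3 * pi\<^sup>2 / 8"
definition cop_scale :: real where "cop_scale = sqrt 2 / (4 * pi)"

definition cop_fun :: "complex \<Rightarrow> complex" where
  "cop_fun z = 1 / (theta (exp (- z)) * theta ((exp (- z))\<^sup>2))"

definition cop_main :: "complex \<Rightarrow> complex" where
  "cop_main z = of_real cop_scale * z * exp (of_real cop_rate / z)"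

lemma cop_scale_pos: "cop_scale > 0" by (simp add: cop_scale_def)

lemma cop_rate_bounds: "3.7008 \<le> cop_rate" "cop_rate \<le> 3.7012"
proof -
  have "3.1415\<^sup>2 \<le> pi\<^sup>2" using pi_approx by (intro power_mono) auto
  moreover have "pi\<^sup>2 \<le> 3.1416\<^sup>2" using pi_approx by (intro power_mono) auto
  ultimately show "3.7008 \<le> cop_rate" "cop_rate \<le> 3.7012" by (simp_all add: cop_rate_def power2_eq_square)
qed

text \<open>Comparison with a geometric series in |q|^2, as k (k + 1) >= 2 k for k >= 1.\<close>

lemma norm_psi_minus_1:
  fixes q :: complex
  assumes "norm q < 1"
  shows "norm (psi q - 1) \<le> (norm q)\<^sup>2 / (1 - (norm q)\<^sup>2)"
proof -
  define P where "P = (norm q)\<^sup>2"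
  have P: "0 \<le> P" "P < 1" using assms by (auto simp: P_def power_less_one_iff)
  have "(\<lambda>k. q ^ (k * (k + 1))) sums psi q"
    unfolding psi_def using assms by (intro summable_sums summable_psi)
  hence s: "(\<lambda>k. q ^ (Suc k * (Suc k + 1))) sums (psi q - 1)"
    by (subst sums_Suc_iff) simp
  have "norm (\<Sum>k. q ^ (Suc k * (Suc k + 1))) \<le> (\<Sum>k. P * P ^ k)"
  proof (rule norm_suminf_le)
    show "summable (\<lambda>k. P * P ^ k)" using P by (intro summable_mult summable_geometric) auto
    fix k
    have "norm (q ^ (Suc k * (Suc k + 1))) \<le> norm q ^ (2 * Suc k)"
      unfolding norm_power using assms by (intro power_decreasing) auto
    thus "norm (q ^ (Suc k * (Suc k + 1))) \<le> P * P ^ k" unfolding power_mult P_def by simp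
  qed
  also have "(\<Sum>k. P * P ^ k) = P / (1 - P)"
    using P by (subst suminf_mult) (auto simp: suminf_geometric summable_geometric)
  finally show ?thesis using sums_unique[OF s] by (simp add: P_def)
qed

lemma csqrt_of_real_mult:
  assumes "a \<ge> 0"
  shows "csqrt (of_real a * w) = of_real (sqrt a) * csqrt w"
proof (cases "a = 0")
  case False
  hence "a > 0" using assms by simp
  have "csqrt ((of_real (sqrt a) * csqrt w)\<^sup>2) = of_real (sqrt a) * csqrt w"
    using csqrt_principal[of w] \<open>a > 0\<close> by (intro csqrt_square) (auto simp del: csqrt.sel)
  moreover have "(of_real (sqrt a) * csqrt w)\<^sup>2 = of_real a * w"
    using assms by (simp add: power_mult_distrib flip: of_real_power)
  ultimately show ?thesis by simp
qed simp

text \<open>(exp(-z))^2 belongs to the argument 2 z, and the positive factor 1/2 can be drawn out of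
  \<open>csqrt\<close>, so the same root occurs twice and squares to pi/z.\<close>

lemma cop_fun_eq:
  assumes "Re z > 0"
  shows "cop_fun z = cop_main z / (psi (exp (- (of_real (pi\<^sup>2) / z))) * psi (exp (- (of_real (pi\<^sup>2 / 2) / z))))"
proof -
  have z: "z \<noteq> 0" using assms by auto
  define w where "w = of_real pi / z"
  define p1 where "p1 = psi (exp (- (of_real (pi\<^sup>2) / z)))"
  define p2 where "p2 = psi (exp (- (of_real (pi\<^sup>2 / 2) / z)))"
  have 1: "theta (exp (- z)) = 2 * csqrt w * exp (- (of_real (pi\<^sup>2 / 4) / z)) * p1"
    using theta_inversion[OF assms] by (simp add: w_def p1_def)
  have "(exp (- z))\<^sup>2 = exp (- (2 * z))" by (simp add: power2_eq_square flip: exp_add)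
  hence "theta ((exp (- z))\<^sup>2) = 2 * csqrt (of_real pi / (2 * z)) * exp (- (of_real (pi\<^sup>2 / 4) / (2 * z))) *
     psi (exp (- (of_real (pi\<^sup>2) / (2 * z))))"
    using theta_inversion[of "2 * z"] assms by simp
  also have "of_real pi / (2 * z) = of_real (1/2) * w" by (simp add: w_def)
  also have "of_real (pi\<^sup>2 / 4) / (2 * z) = of_real (pi\<^sup>2 / 8) / z" by simp
  also have "of_real (pi\<^sup>2) / (2 * z) = of_real (pi\<^sup>2 / 2) / z" by simp
  also have "csqrt (of_real (1/2) * w) = of_real (sqrt (1/2)) * csqrt w" by (rule csqrt_of_real_mult) simp
  finally have 2: "theta ((exp (- z))\<^sup>2) = 2 * (of_real (sqrt (1/2)) * csqrt w) * exp (- (of_real (pi\<^sup>2 / 8) / z)) * p2"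
    by (simp only: p2_def)
  have e: "exp (- (of_real (pi\<^sup>2 / 4) / z)) * exp (- (of_real (pi\<^sup>2 / 8) / z)) = exp (- (of_real cop_rate / z))"
    by (simp add: cop_rate_def flip: exp_add)
  have "theta (exp (- z)) * theta ((exp (- z))\<^sup>2) = 4 * of_real (sqrt (1/2)) * (csqrt w * csqrt w) *
      (exp (- (of_real (pi\<^sup>2 / 4) / z)) * exp (- (of_real (pi\<^sup>2 / 8) / z))) * (p1 * p2)"
    unfolding 1 2 by (simp only: mult_ac) simp
  also have "csqrt w * csqrt w = w" by (simp flip: power2_eq_square)
  also have "4 * complex_of_real (sqrt (1/2)) * w = 1 / (of_real cop_scale * z)"
  proof -
    have "4 * sqrt (1/2) * pi = 1 / cop_scale" by (simp add: cop_scale_def real_sqrt_divide field_simps)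
    hence "complex_of_real (4 * sqrt (1/2) * pi) = of_real (1 / cop_scale)" by (simp only:)
    hence "4 * complex_of_real (sqrt (1/2)) * complex_of_real pi = 1 / of_real cop_scale" by simp
    thus ?thesis by (simp add: w_def field_simps)
  qed
  also note e
  finally have "theta (exp (- z)) * theta ((exp (- z))\<^sup>2) = 1 / (of_real cop_scale * z) * exp (- (of_real cop_rate / z)) * (p1 * p2)" .
  thus ?thesis unfolding cop_fun_def cop_main_def p1_def[symmetric] p2_def[symmetric]
    by (simp add: exp_minus divide_inverse mult_ac)
qed

text \<open>With R = Re (1/z) both psi factors are 1 + O(rho), rho = exp(-pi^2 R), which beats the
  growth exp(c R) of the main term since c < pi^2. The bound R >= 1/10 gives rho <= 2/5, just enough
  to keep the psi factors away from 0.\<close>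

lemma cop_fun_inner:
  assumes "Re z > 0" "Re (1 / z) \<ge> 1 / 10"
  shows "norm (cop_fun z - cop_main z) \<le> 10 * cop_scale * norm z"
proof -
  define p1 where "p1 = psi (exp (- (of_real (pi\<^sup>2) / z)))"
  define p2 where "p2 = psi (exp (- (of_real (pi\<^sup>2 / 2) / z)))"
  define R where "R = Re (1 / z)"
  define \<rho> where "\<rho> = exp (- (pi\<^sup>2 * R))"
  have \<rho>0: "\<rho> > 0" by (simp add: \<rho>_def)
  have n1: "norm (exp (- (complex_of_real (pi\<^sup>2) / z))) = \<rho>"
    unfolding norm_exp_eq_Re \<rho>_def R_def uminus_complex.sel Re_real_divide ..
  have n2: "(norm (exp (- (complex_of_real (pi\<^sup>2 / 2) / z))))\<^sup>2 = \<rho>"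
    unfolding norm_exp_eq_Re \<rho>_def R_def uminus_complex.sel Re_real_divide
    by (simp add: power2_eq_square flip: exp_add)
  have \<rho>: "\<rho> \<le> 2/5"
  proof -
    have "9.8 \<le> pi\<^sup>2" using power_mono[of "3.14" pi 2] pi_approx by (simp add: power2_eq_square)
    hence "0.98 \<le> pi\<^sup>2 * R" using assms(2) mult_mono[of "9.8" "pi\<^sup>2" "1/10" R] by (simp add: R_def)
    hence "\<rho> \<le> exp (- 0.98)" by (simp add: \<rho>_def)
    also have "\<dots> \<le> 2/5"
    proof -
      have "1 + 0.49 + 0.49\<^sup>2 / 2 \<le> exp (0.49::real)" by (rule exp_lower_Taylor_quadratic) simp
      hence "1.6\<^sup>2 \<le> (exp (0.49::real))\<^sup>2" by (intro power_mono) (auto simp: power2_eq_square)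
      also have "(exp (0.49::real))\<^sup>2 = exp 0.98" by (simp add: power2_eq_square flip: exp_add)
      finally have "5/2 \<le> exp (0.98::real)" by (simp add: power2_eq_square)
      thus ?thesis by (simp add: exp_minus field_simps)
    qed
    finally show ?thesis .
  qed
  have b1: "norm (p1 - 1) \<le> 0.48 * \<rho>"
  proof -
    have "norm (p1 - 1) \<le> \<rho>\<^sup>2 / (1 - \<rho>\<^sup>2)"
      unfolding p1_def using norm_psi_minus_1[of "exp (- (complex_of_real (pi\<^sup>2) / z))"] \<rho> unfolding n1 by simp
    also have "\<rho>\<^sup>2 \<le> \<rho> * (2/5)" using \<rho> \<rho>0 by (simp add: power2_eq_square)
    hence "\<rho>\<^sup>2 / (1 - \<rho>\<^sup>2) \<le> (\<rho> * (2/5)) / (21/25)" using \<rho> \<rho>0 by (intro frac_le) auto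
    also have "\<dots> \<le> 0.48 * \<rho>" using \<rho>0 by simp
    finally show ?thesis .
  qed
  have b2: "norm (p2 - 1) \<le> 5/3 * \<rho>"
  proof -
    have "norm (exp (- (complex_of_real (pi\<^sup>2 / 2) / z))) < 1"
    proof (rule power2_less_imp_less)
      show "(norm (exp (- (complex_of_real (pi\<^sup>2 / 2) / z))))\<^sup>2 < 1\<^sup>2" unfolding n2 using \<rho> by simp
    qed simp
    hence "norm (p2 - 1) \<le> \<rho> / (1 - \<rho>)"
      unfolding p2_def using norm_psi_minus_1[of "exp (- (complex_of_real (pi\<^sup>2 / 2) / z))"] unfolding n2 by simp
    also have "\<dots> \<le> \<rho> / (3/5)" using \<rho> \<rho>0 by (intro divide_left_mono) auto
    finally show ?thesis by simp
  qed
  have l1: "norm p1 \<ge> 0.808"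
    using b1 \<rho> norm_triangle_ineq2[of 1 "1 - p1"] by (simp add: norm_minus_commute)
  have l2: "norm p2 \<ge> 1/3" and u2: "norm p2 \<le> 5/3"
    using b2 \<rho> norm_triangle_ineq2[of 1 "1 - p2"] norm_triangle_ineq[of 1 "p2 - 1"]
    by (simp_all add: norm_minus_commute)
  have nz: "p1 \<noteq> 0" "p2 \<noteq> 0" using l1 l2 by auto
  have num: "norm (1 - p1 * p2) \<le> 2.47 * \<rho>"
  proof -
    have "1 - p1 * p2 = - ((p1 - 1) * p2 + (p2 - 1))" by (simp add: algebra_simps)
    hence "norm (1 - p1 * p2) \<le> norm (p1 - 1) * norm p2 + norm (p2 - 1)"
      by (metis norm_minus_cancel norm_mult norm_triangle_ineq)
    also have "\<dots> \<le> (0.48 * \<rho>) * (5/3) + 5/3 * \<rho>"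
      using b1 b2 u2 \<rho>0 by (intro add_mono mult_mono) auto
    finally show ?thesis using \<rho>0 by simp
  qed
  have den: "0.26 \<le> norm (p1 * p2)"
    using mult_mono[OF l1 l2] by (simp add: norm_mult)
  have "norm ((1 - p1 * p2) / (p1 * p2)) \<le> (2.47 * \<rho>) / 0.26"
    unfolding norm_divide using num den \<rho>0 by (intro frac_le) auto
  hence q: "norm ((1 - p1 * p2) / (p1 * p2)) \<le> 10 * \<rho>" using \<rho>0 by simp
  have "cop_fun z - cop_main z = cop_main z * ((1 - p1 * p2) / (p1 * p2))"
    unfolding cop_fun_eq[OF assms(1)] p1_def[symmetric] p2_def[symmetric] using nz by (simp add: field_simps)
  hence "norm (cop_fun z - cop_main z) = norm (cop_main z) * norm ((1 - p1 * p2) / (p1 * p2))"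
    by (simp only: norm_mult)
  also have "\<dots> \<le> norm (cop_main z) * (10 * \<rho>)" using q by (intro mult_left_mono) auto
  finally have "norm (cop_fun z - cop_main z) \<le> norm (cop_main z) * (10 * \<rho>)" .
  also have "norm (cop_main z) = cop_scale * norm z * exp (cop_rate * R)"
    unfolding cop_main_def norm_mult norm_exp_eq_Re Re_real_divide R_def using cop_scale_pos by simp
  also have "cop_scale * norm z * exp (cop_rate * R) * (10 * \<rho>) = 10 * cop_scale * norm z * exp (cop_rate * R - pi\<^sup>2 * R)"
    by (simp add: \<rho>_def mult_exp_exp mult_ac)
  also have "\<dots> \<le> 10 * cop_scale * norm z * 1"
  proof -
    have "cop_rate * R - pi\<^sup>2 * R = - (5 * pi\<^sup>2 * R / 8)" by (simp add: cop_rate_def algebra_simps)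
    also have "\<dots> \<le> 0" using assms by (simp add: R_def)
    finally show ?thesis using cop_scale_pos by (intro mult_left_mono) auto
  qed
  finally show ?thesis by simp
qed

section \<open>Bounds away from the real axis\<close>

lemma theta_norm_ge:
  assumes "norm (q :: complex) < 1"
  shows "theta (norm q) \<le> norm (theta q)"
proof -
  define r where "r = norm q"
  have r: "0 \<le> r" "r < 1" using assms by (auto simp: r_def)
  have "Re (1 / (1 - q)) \<le> norm (1 / (1 - q))" by (rule complex_Re_le_cmod)
  also have "\<dots> = 1 / norm (1 - q)" by (simp add: norm_divide)
  also have "1 - r \<le> norm (1 - q)" using norm_triangle_ineq2[of 1 q] by (simp add: r_def)
  hence "1 / norm (1 - q) \<le> 1 / (1 - r)" using r by (intro divide_left_mono) (auto intro!: mult_pos_pos)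
  finally have "Re (1 / (1 - q)) - 1 \<le> 1 / (1 - r) - 1" by simp
  moreover have "1 - q \<noteq> 0" using assms by auto
  hence "q / (1 - q) = 1 / (1 - q) - 1" by (simp add: field_simps)
  moreover have "r / (1 - r) = 1 / (1 - r) - 1"
    using r by (simp add: field_simps)
  ultimately have "Re (q / (1 - q)) \<le> r / (1 - r)" by simp
  hence "exp (2 * Re (q / (1 - q)) - 2 * r / (1 - r)) \<le> 1" by simp
  hence "norm (theta q) * exp (2 * Re (q / (1 - q)) - 2 * r / (1 - r)) \<le> norm (theta q) * 1"
    by (intro mult_left_mono) auto
  thus ?thesis using theta_saving[OF assms] by (simp add: r_def)
qed

lemma theta_exp_ge:
  assumes "x > (0::real)"
  shows "theta (exp (- x)) \<ge> 2 * sqrt (pi / x) * exp (- (pi\<^sup>2 / (4 * x)))"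
proof -
  have "psi (exp (- (pi\<^sup>2 / x))) \<ge> 1" using assms by (intro psi_ge_1) auto
  hence "2 * sqrt (pi / x) * exp (- (pi\<^sup>2 / (4 * x))) * 1 \<le> 2 * sqrt (pi / x) * exp (- (pi\<^sup>2 / (4 * x))) * psi (exp (- (pi\<^sup>2 / x)))"
    using assms by (intro mult_left_mono) auto
  thus ?thesis using theta_inversion_real[OF assms] by simp
qed

text \<open>Only theta(q) is treated with the saving; for theta(q^2) the value at the real point suffices.\<close>

lemma cop_fun_saving:
  assumes "Re z > 0"
  shows "norm (cop_fun z) \<le> cop_scale * Re z * exp ((cop_rate - 2) / Re z + 2 / norm (1 - exp (- z)))"
proof -
  define x where "x = Re z"
  define q where "q = exp (- z)"
  define r where "r = exp (- x)"
  have x: "x > 0" using assms by (simp add: x_def)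
  have nq: "norm q = r" by (simp add: q_def r_def x_def norm_exp_eq_Re)
  have r: "0 < r" "r < 1" using x by (auto simp: r_def)
  have nq2: "norm (q\<^sup>2) = exp (- (2 * x))" unfolding norm_power nq r_def by (simp add: power2_eq_square flip: exp_add)
  define E where "E = exp (2 * Re (q / (1 - q)) - 2 * r / (1 - r))"
  have t1: "2 * sqrt (pi / x) * exp (- (pi\<^sup>2 / (4 * x))) \<le> norm (theta q) * E"
    using theta_exp_ge[OF x] theta_saving[of q] nq r by (simp add: E_def r_def)
  have t2: "2 * sqrt (pi / (2 * x)) * exp (- (pi\<^sup>2 / (4 * (2 * x)))) \<le> norm (theta (q\<^sup>2))"
    using theta_exp_ge[of "2 * x"] theta_norm_ge[of "q\<^sup>2"] nq2 x by simp
  have "(2 * sqrt (pi / x) * exp (- (pi\<^sup>2 / (4 * x)))) * (2 * sqrt (pi / (2 * x)) * exp (- (pi\<^sup>2 / (4 * (2 * x)))))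
     \<le> (norm (theta q) * E) * norm (theta (q\<^sup>2))"
    using x by (intro mult_mono t1 t2) (auto simp: E_def)
  also have "(2 * sqrt (pi / x) * exp (- (pi\<^sup>2 / (4 * x)))) * (2 * sqrt (pi / (2 * x)) * exp (- (pi\<^sup>2 / (4 * (2 * x)))))
     = 1 / (cop_scale * x * exp (cop_rate / x))"
  proof -
    have "sqrt (pi / x) * sqrt (pi / (2 * x)) = sqrt ((pi / x)\<^sup>2 / 2)"
      by (simp add: power2_eq_square flip: real_sqrt_mult)
    also have "\<dots> = pi / x / sqrt 2" using x by (simp add: real_sqrt_divide)
    finally have s: "sqrt (pi / x) * sqrt (pi / (2 * x)) = pi / x / sqrt 2" .
    have "exp (- (pi\<^sup>2 / (4 * x))) * exp (- (pi\<^sup>2 / (4 * (2 * x)))) = exp (- (cop_rate / x))"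
      using x by (simp add: cop_rate_def flip: exp_add)
    hence "(2 * sqrt (pi / x) * exp (- (pi\<^sup>2 / (4 * x)))) * (2 * sqrt (pi / (2 * x)) * exp (- (pi\<^sup>2 / (4 * (2 * x)))))
      = 4 * (sqrt (pi / x) * sqrt (pi / (2 * x))) * exp (- (cop_rate / x))" by (simp add: mult_ac)
    also have "\<dots> = 1 / (cop_scale * x * exp (cop_rate / x))"
      unfolding s using x by (simp add: cop_scale_def exp_minus field_simps)
    finally show ?thesis .
  qed
  finally have main: "1 / (cop_scale * x * exp (cop_rate / x)) \<le> norm (theta q * theta (q\<^sup>2)) * E" by (simp add: norm_mult mult_ac)
  have pos: "norm (theta q * theta (q\<^sup>2)) > 0" using theta_nz nq nq2 r x by simp
  have "norm (cop_fun z) = 1 / norm (theta q * theta (q\<^sup>2))" by (simp add: cop_fun_def q_def norm_divide)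
  also have "\<dots> \<le> cop_scale * x * exp (cop_rate / x) * E"
    using main pos x cop_scale_pos by (simp add: field_simps)
  also have "exp (cop_rate / x) * E = exp (cop_rate / x + (2 * Re (q / (1 - q)) - 2 * r / (1 - r)))"
    by (simp add: E_def exp_add)
  hence "cop_scale * x * exp (cop_rate / x) * E = cop_scale * x * exp (cop_rate / x + (2 * Re (q / (1 - q)) - 2 * r / (1 - r)))" by simp
  also have "\<dots> \<le> cop_scale * x * exp ((cop_rate - 2) / x + 2 / norm (1 - q))"
  proof -
    have "1 - r \<le> x" using exp_ge_add_one_self[of "- x"] by (simp add: r_def)
    hence "1 / x \<le> 1 / (1 - r)" using r by (intro divide_left_mono) (auto intro!: mult_pos_pos x)
    moreover have "r / (1 - r) = 1 / (1 - r) - 1" using r by (simp add: field_simps)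
    moreover have "Re (1 / (1 - q)) \<le> 1 / norm (1 - q)"
      using complex_Re_le_cmod[of "1 / (1 - q)"] by (simp add: norm_divide)
    moreover have "1 - q \<noteq> 0" using nq r by auto
    hence "q / (1 - q) = 1 / (1 - q) - 1" by (simp add: field_simps)
    ultimately have "2 * Re (q / (1 - q)) - 2 * (r / (1 - r)) \<le> 2 * (1 / norm (1 - q)) - 2 * (1 / x)"
      by simp
    hence "cop_rate / x + (2 * Re (q / (1 - q)) - 2 * r / (1 - r)) \<le> (cop_rate - 2) / x + 2 / norm (1 - q)"
      by (simp add: diff_divide_distrib)
    thus ?thesis using cop_scale_pos x by (intro mult_left_mono) auto
  qed
  finally show ?thesis by (simp add: x_def q_def)
qed

lemma sin_lower:
  assumes "0 \<le> y" "y \<le> pi"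
  shows "y / pi \<le> sin (y / 2)"
proof -
  have "concave_on {0..pi/2} sin"
  proof (rule f''_le0_imp_concave)
    show "(sin has_real_derivative cos x) (at x)" if "x \<in> {0..pi/2}" for x by simp
    show "(cos has_real_derivative - sin x) (at x)" if "x \<in> {0..pi/2}" for x by simp
    show "- sin x \<le> 0" if "x \<in> {0..pi/2}" for x using that by (auto intro: sin_ge_zero)
  qed auto
  hence "(1 - y / pi) * sin 0 + (y / pi) * sin (pi / 2) \<le> sin ((1 - y / pi) * 0 + (y / pi) * (pi / 2))"
    using concave_onD[of "{0..pi/2}" sin "y / pi" 0 "pi/2"] assms by simp
  thus ?thesis by simp
qed

text \<open>With r = exp(-x) one has |1 - exp(-z)|^2 = (1 - r)^2 + 4 r sin(y/2)^2. Then 1 - r >= x r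
  and the chord bound for the sine on one period give the multiple of |z|.\<close>

lemma norm_one_minus_exp_lower:
  assumes "0 < Re z" "\<bar>Im z\<bar> \<le> pi"
  shows "norm (1 - exp (- z)) \<ge> (2 / pi) * exp (- Re z) * norm z"
proof -
  define x y r where "x = Re z" and "y = Im z" and "r = exp (- x)"
  have r: "0 < r" "r < 1" using assms by (auto simp: r_def x_def)
  have "x * r \<le> 1 - r" using exp_ge_add_one_self[of x] by (simp add: r_def exp_minus field_simps)
  hence a: "(x * r)\<^sup>2 \<le> (1 - r)\<^sup>2" using assms r by (intro power_mono) (auto simp: x_def)
  have "(\<bar>y\<bar> / pi)\<^sup>2 \<le> (sin (\<bar>y\<bar> / 2))\<^sup>2" using assms by (intro power_mono sin_lower) (auto simp: y_def)
  hence b: "(y / pi)\<^sup>2 \<le> (sin (y / 2))\<^sup>2" by (cases "y \<ge> 0") (auto simp: power_divide)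
  have cosy: "cos y = 1 - 2 * (sin (y / 2))\<^sup>2" using cos_double_sin[of "y / 2"] by simp
  have "(norm (1 - exp (- z)))\<^sup>2 = (1 - r * cos y)\<^sup>2 + (r * sin y)\<^sup>2"
    unfolding cmod_power2 by (simp add: Re_exp Im_exp r_def x_def y_def)
  also have "\<dots> = 1 - 2 * r * cos y + r\<^sup>2 * ((sin y)\<^sup>2 + (cos y)\<^sup>2)"
    by algebra
  also have "\<dots> = (1 - r)\<^sup>2 + 4 * r * (sin (y / 2))\<^sup>2"
    unfolding sin_cos_squared_add unfolding cosy by (simp add: power2_eq_square algebra_simps)
  also have "\<dots> \<ge> (x * r)\<^sup>2 + 4 * r\<^sup>2 * (y / pi)\<^sup>2"
  proof -
    have "r\<^sup>2 \<le> r" using r by (simp add: power2_eq_square)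
    hence "4 * r\<^sup>2 * (y / pi)\<^sup>2 \<le> 4 * r * (sin (y / 2))\<^sup>2" using b r by (intro mult_mono) auto
    thus ?thesis using a by simp
  qed
  also have "(x * r)\<^sup>2 + 4 * r\<^sup>2 * (y / pi)\<^sup>2 \<ge> ((2 / pi) * r * norm z)\<^sup>2"
  proof -
    have "2 / pi \<le> 1" using pi_ge_two by simp
    hence "(2 / pi)\<^sup>2 \<le> 1" by (simp add: power_le_one)
    hence "(2 / pi)\<^sup>2 * (x * r)\<^sup>2 \<le> 1 * (x * r)\<^sup>2" by (intro mult_right_mono) auto
    thus ?thesis unfolding power_mult_distrib cmod_power2 x_def[symmetric] y_def[symmetric]
      by (simp add: power_divide algebra_simps add_divide_distrib)
  qed
  finally have "((2 / pi) * r * norm z)\<^sup>2 \<le> (norm (1 - exp (- z)))\<^sup>2" .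
  hence "(2 / pi) * r * norm z \<le> norm (1 - exp (- z))" by (rule power2_le_imp_le) simp
  thus ?thesis by (simp only: r_def x_def)
qed

text \<open>Re (1/z) < 1/10 means |z|^2 > 10 x. Hence |1 - exp(-z)| is at least (20/11) sqrt x, and
  the term 2/|1 - exp(-z)| left over by the saving is only of order 1/sqrt x.\<close>

lemma cop_fun_outer:
  assumes "0 < Re z" "Re z \<le> 1 / 15" "\<bar>Im z\<bar> \<le> pi" "Re (1 / z) < 1 / 10"
  shows "norm (cop_fun z) \<le> cop_scale * (Re z * exp ((cop_rate - 2) / Re z + 1.1 / sqrt (Re z)))"
proof -
  define x where "x = Re z"
  have x: "0 < x" "x \<le> 1/15" using assms by (auto simp: x_def)
  have "Re (1 / z) = x / (norm z)\<^sup>2" by (simp add: Re_divide x_def cmod_power2)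
  moreover have "norm z > 0" using assms by auto
  ultimately have "10 * x \<le> (norm z)\<^sup>2" using assms(4) by (simp add: field_simps)
  hence "sqrt (10 * x) \<le> norm z" by (simp add: real_le_lsqrt)
  moreover have "3.16 * sqrt x \<le> sqrt (10 * x)"
    unfolding real_sqrt_mult using x by (intro mult_right_mono real_le_rsqrt) (auto simp: power2_eq_square)
  ultimately have nz: "3.16 * sqrt x \<le> norm z" by simp
  have "0.636 \<le> 2 / pi" using pi_approx by (simp add: field_simps)
  moreover have "0.93 \<le> exp (- x)" using exp_ge_add_one_self[of "- x"] x by simp
  ultimately have "0.636 * 0.93 * (3.16 * sqrt x) \<le> (2 / pi) * exp (- x) * norm z"
    using nz x by (intro mult_mono) auto
  also have "\<dots> \<le> norm (1 - exp (- z))"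
    using norm_one_minus_exp_lower[of z] assms by (simp add: x_def)
  finally have "0.636 * 0.93 * (3.16 * sqrt x) \<le> norm (1 - exp (- z))" .
  moreover have "(20 / 11) * sqrt x \<le> 0.636 * 0.93 * (3.16 * sqrt x)" using x by simp
  ultimately have "(20 / 11) * sqrt x \<le> norm (1 - exp (- z))" by linarith
  hence "2 / norm (1 - exp (- z)) \<le> 2 / ((20 / 11) * sqrt x)"
    using x by (intro divide_left_mono) (auto intro!: mult_pos_pos)
  also have "\<dots> = 1.1 / sqrt x" by simp
  finally have "cop_scale * x * exp ((cop_rate - 2) / x + 2 / norm (1 - exp (- z))) \<le> cop_scale * x * exp ((cop_rate - 2) / x + 1.1 / sqrt x)"
    using x cop_scale_pos by (intro mult_left_mono) auto
  thus ?thesis using cop_fun_saving[OF assms(1)] by (simp add: x_def mult.assoc)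
qed

lemma cop_fun_approx:
  assumes "0 < Re z" "Re z \<le> 1 / 15" "\<bar>Im z\<bar> \<le> pi"
  shows "norm (cop_fun z - cop_main z) \<le> cop_scale * (35 + Re z * exp ((cop_rate - 2) / Re z + 1.1 / sqrt (Re z)))"
proof -
  define X where "X = Re z * exp ((cop_rate - 2) / Re z + 1.1 / sqrt (Re z))"
  have X: "X \<ge> 0" using assms by (simp add: X_def)
  have pi32: "pi \<le> 3.2" using pi_approx by simp
  have "\<bar>Re z\<bar> \<le> 1 / 15" using assms by simp
  hence nz: "norm z \<le> 3.5"
    using cmod_le[of z] pi32 assms(3) by linarith
  show ?thesis
  proof (cases "Re (1 / z) \<ge> 1 / 10")
    case True
    have "norm (cop_fun z - cop_main z) \<le> 10 * cop_scale * norm z" by (rule cop_fun_inner) (use assms True in auto)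
    also have "\<dots> \<le> 10 * cop_scale * 3.5" using nz cop_scale_pos by (intro mult_left_mono) auto
    also have "\<dots> \<le> cop_scale * (35 + X)" using X cop_scale_pos by (simp add: algebra_simps)
    finally show ?thesis by (simp add: X_def)
  next
    case False
    have "norm (cop_main z) = cop_scale * norm z * exp (cop_rate * Re (1 / z))"
      unfolding cop_main_def norm_mult norm_exp_eq_Re Re_real_divide using cop_scale_pos by simp
    also have "\<dots> \<le> cop_scale * 3.5 * 2"
    proof (intro mult_mono)
      have "cop_rate * Re (1 / z) \<le> cop_rate * (1/10)" using False cop_rate_bounds by (intro mult_left_mono) auto
      also have "\<dots> \<le> 1/2" using cop_rate_bounds by simp
      finally have "exp (cop_rate * Re (1 / z)) \<le> exp (1/2)" by simp
      also have "exp (1/2::real) \<le> 2"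
        using exp_bound_half[of "1/2::real"] by simp
      finally show "exp (cop_rate * Re (1 / z)) \<le> 2" .
    qed (use nz cop_scale_pos in auto)
    finally have 1: "norm (cop_main z) \<le> cop_scale * 35" using cop_scale_pos by simp
    have "norm (cop_fun z) \<le> cop_scale * X" unfolding X_def by (rule cop_fun_outer) (use False assms in auto)
    hence "norm (cop_fun z - cop_main z) \<le> cop_scale * X + cop_scale * 35"
      using norm_triangle_ineq4[of "cop_fun z" "cop_main z"] 1 by linarith
    thus ?thesis by (simp add: X_def algebra_simps)
  qed
qed

section \<open>A power series of Bessel type\<close>

text \<open>In terms of the modified Bessel function, \<open>bess y\<close> is I_2(2 sqrt y) / y.\<close>

definition bess_coeff :: "nat \<Rightarrow> real" where "bess_coeff k = 1 / (fact k * fact (k + 2))"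

definition bess :: "real \<Rightarrow> real" where "bess x = (\<Sum>k. bess_coeff k * x ^ k)"

lemma bess_coeff_rec: "real (Suc k) * real (k + 3) * bess_coeff (Suc k) = bess_coeff k"
proof -
  have "fact (Suc k + 2) = real (k + 3) * fact (k + 2)" by simp
  thus ?thesis unfolding bess_coeff_def fact_Suc by (simp add: divide_simps del: fact_Suc)
qed

lemma bess_coeff_pos: "bess_coeff k > 0"
  by (simp add: bess_coeff_def)

lemma bess_coeff_le: "bess_coeff k \<le> inverse (fact k)"
proof -
  have "(fact k :: real) * 1 \<le> fact k * fact (k + 2)"
    by (intro mult_left_mono fact_ge_1) auto
  hence "1 / (fact k * fact (k + 2)) \<le> 1 / (fact k :: real)"
    by (intro divide_left_mono) (auto simp del: fact_Suc)
  thus ?thesis by (simp only: bess_coeff_def inverse_eq_divide)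
qed

lemma summable_bess: "summable (\<lambda>k. bess_coeff k * x ^ k)"
proof (rule summable_comparison_test')
  show "summable (\<lambda>k. inverse (fact k) * \<bar>x\<bar> ^ k)" by (rule summable_exp)
  show "norm (bess_coeff k * x ^ k) \<le> inverse (fact k) * \<bar>x\<bar> ^ k" if "k \<ge> 0" for k
    using bess_coeff_le[of k] bess_coeff_pos[of k]
    by (auto simp: abs_mult power_abs intro!: mult_right_mono)
qed

definition bess1 :: "real \<Rightarrow> real" where "bess1 x = (\<Sum>k. diffs bess_coeff k * x ^ k)"
definition bess2 :: "real \<Rightarrow> real" where "bess2 x = (\<Sum>k. diffs (diffs bess_coeff) k * x ^ k)"

lemma summable_bess1: "summable (\<lambda>k. diffs bess_coeff k * x ^ k)"
  by (rule termdiff_converges_all) (rule summable_bess)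

lemma summable_bess2: "summable (\<lambda>k. diffs (diffs bess_coeff) k * x ^ k)"
  by (rule termdiff_converges_all) (rule summable_bess1)

lemma DERIV_bess: "(bess has_real_derivative bess1 x) (at x)"
  unfolding bess_def bess1_def by (rule termdiffs_strong_converges_everywhere) (rule summable_bess)

lemma DERIV_bess1: "(bess1 has_real_derivative bess2 x) (at x)"
  unfolding bess1_def bess2_def by (rule termdiffs_strong_converges_everywhere) (rule summable_bess1)

text \<open>Coefficientwise this is the recursion (k + 1)(k + 3) c(k + 1) = c(k).\<close>

lemma bess_ode: "x * bess2 x + 3 * bess1 x = bess x"
proof -
  define c where "c = bess_coeff"
  have "(\<lambda>k. diffs (diffs c) k * x ^ k) sums bess2 x"
    unfolding bess2_def c_def using summable_bess2 by (rule summable_sums)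
  hence "(\<lambda>k. x * (diffs (diffs c) k * x ^ k)) sums (x * bess2 x)" by (rule sums_mult)
  moreover have "x * (diffs (diffs c) k * x ^ k) = real (Suc k) * diffs c (Suc k) * x ^ Suc k" for k
    by (simp add: diffs_def)
  ultimately have "(\<lambda>k. real (Suc k) * diffs c (Suc k) * x ^ Suc k) sums (x * bess2 x)" by simp
  hence 1: "(\<lambda>k. real k * diffs c k * x ^ k) sums (x * bess2 x)"
    by (subst (asm) sums_Suc_iff) simp
  have 2: "(\<lambda>k. 3 * (diffs c k * x ^ k)) sums (3 * bess1 x)"
    unfolding bess1_def c_def using summable_bess1 by (intro sums_mult summable_sums)
  have "(\<lambda>k. real k * diffs c k * x ^ k + 3 * (diffs c k * x ^ k)) sums (x * bess2 x + 3 * bess1 x)"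
    by (rule sums_add[OF 1 2])
  moreover have "real k * diffs c k * x ^ k + 3 * (diffs c k * x ^ k) = c k * x ^ k" for k
  proof -
    have "(real k + 3) * diffs c k = c k"
      using bess_coeff_rec[of k] by (simp add: diffs_def c_def algebra_simps)
    hence "c k * x ^ k = (real k + 3) * diffs c k * x ^ k" by simp
    thus ?thesis by (simp add: algebra_simps)
  qed
  ultimately have "(\<lambda>k. c k * x ^ k) sums (x * bess2 x + 3 * bess1 x)" by simp
  moreover have "(\<lambda>k. c k * x ^ k) sums bess x"
    unfolding bess_def c_def using summable_bess by (rule summable_sums)
  ultimately show ?thesis by (rule sums_unique2)
qed

lemma bess_pos: "x \<ge> 0 \<Longrightarrow> bess x > 0"
proof -
  assume x: "x \<ge> 0"
  have "0 \<le> bess_coeff k * x ^ k" for k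
    using x bess_coeff_pos[of k] by (intro mult_nonneg_nonneg) auto
  hence "bess_coeff 0 * x ^ 0 \<le> bess x"
    unfolding bess_def using sum_le_suminf[OF summable_bess[of x], of "{0}"] by auto
  thus ?thesis by (simp add: bess_coeff_def)
qed

lemma bess1_pos: "x \<ge> 0 \<Longrightarrow> bess1 x > 0"
proof -
  assume x: "x \<ge> 0"
  have "0 \<le> diffs bess_coeff k * x ^ k" for k
    using x bess_coeff_pos[of "Suc k"] unfolding diffs_def by (intro mult_nonneg_nonneg) auto
  hence "diffs bess_coeff 0 * x ^ 0 \<le> bess1 x"
    unfolding bess1_def using sum_le_suminf[OF summable_bess1[of x], of "{0}"] by auto
  thus ?thesis by (simp add: bess_coeff_def diffs_def)
qed

section \<open>The logarithmic derivative and log-concavity\<close>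

definition bess_log :: "real \<Rightarrow> real" where "bess_log x = bess1 x / bess x"

lemma bess_log_pos: "x \<ge> 0 \<Longrightarrow> bess_log x > 0"
  by (simp add: bess_log_def bess_pos bess1_pos)

text \<open>The logarithmic derivative u of the Bessel function satisfies a Riccati equation, and
  w = - x u' = x u^2 + 3 u - 1 satisfies w' + (2 u + 3/x) w = u^2. A barrier argument with
  the comparison function x u^2 / (2 x u + 4) bounds w from below.\<close>

definition bess_conc :: "real \<Rightarrow> real" where "bess_conc x = x * (bess_log x)\<^sup>2 + 3 * bess_log x - 1"

lemma DERIV_bess_log:
  assumes "x > 0"
  shows "(bess_log has_real_derivative - bess_conc x / x) (at x)"
proof -
  have p: "bess x > 0" using assms bess_pos by simp
  have "(bess_log has_real_derivative (bess2 x * bess x - bess1 x * bess1 x) / (bess x * bess x)) (at x)"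
    unfolding bess_log_def[abs_def] using p
    by (auto intro!: derivative_eq_intros DERIV_bess DERIV_bess1)
  also have "bess2 x = (bess x - 3 * bess1 x) / x"
    using bess_ode[of x] assms by (simp add: field_simps)
  also have "((bess x - 3 * bess1 x) / x * bess x - bess1 x * bess1 x) / (bess x * bess x) = - bess_conc x / x"
    using p assms by (simp add: bess_conc_def bess_log_def field_simps power2_eq_square)
  finally show ?thesis .
qed

text \<open>With v = x u and omega = x w the left side is x^2 times the derivative of w minus the
  barrier. After clearing m = 2 v + 4 it is a decreasing linear function of omega m, and at the
  barrier value omega m = v^2 the positive remainder v^2 (6 v^2 + 16 v) is left.\<close>

lemma barrier_ineq:
  fixes v \<omega> :: real
  assumes "v > 0" "\<omega> < v\<^sup>2 / (2 * v + 4)"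
  shows "v\<^sup>2 - (2 * v + 3) * \<omega> - (4 * v\<^sup>2 - 2 * v\<^sup>2 * \<omega> - 8 * v * \<omega>) / (2 * v + 4)\<^sup>2 > 0"
proof -
  define m where "m = 2 * v + 4"
  have m: "m > 4" using assms by (simp add: m_def)
  have v: "v = (m - 4) / 2" by (simp add: m_def)
  have "\<omega> * m < v\<^sup>2" using assms m by (simp add: m_def field_simps)
  have c: "(m - 1) * m\<^sup>2 - 2 * v\<^sup>2 - 8 * v > 0"
  proof -
    have "2 * v\<^sup>2 + 8 * v \<le> m\<^sup>2" using assms by (simp add: m_def power2_eq_square algebra_simps)
    also have "1 * m\<^sup>2 < (m - 1) * m\<^sup>2" using m by (intro mult_strict_right_mono) auto
    ultimately show ?thesis by simp
  qed
  have "m * ((v\<^sup>2 - (m - 1) * \<omega>) * m\<^sup>2 - (4 * v\<^sup>2 - 2 * v\<^sup>2 * \<omega> - 8 * v * \<omega>)) =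
     v\<^sup>2 * m * (m\<^sup>2 - 4) - (\<omega> * m) * ((m - 1) * m\<^sup>2 - 2 * v\<^sup>2 - 8 * v)"
    by (simp add: algebra_simps power2_eq_square)
  also have "\<dots> > v\<^sup>2 * m * (m\<^sup>2 - 4) - v\<^sup>2 * ((m - 1) * m\<^sup>2 - 2 * v\<^sup>2 - 8 * v)"
    using mult_strict_right_mono[OF \<open>\<omega> * m < v\<^sup>2\<close> c] by linarith
  also have "v\<^sup>2 * m * (m\<^sup>2 - 4) - v\<^sup>2 * ((m - 1) * m\<^sup>2 - 2 * v\<^sup>2 - 8 * v) = v\<^sup>2 * (6 * v\<^sup>2 + 16 * v)"
    unfolding m_def by (simp add: algebra_simps power2_eq_square)
  finally have "m * ((v\<^sup>2 - (m - 1) * \<omega>) * m\<^sup>2 - (4 * v\<^sup>2 - 2 * v\<^sup>2 * \<omega> - 8 * v * \<omega>)) > v\<^sup>2 * (6 * v\<^sup>2 + 16 * v)" .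
  moreover have "v\<^sup>2 * (6 * v\<^sup>2 + 16 * v) \<ge> 0" using assms by auto
  ultimately have "m * ((v\<^sup>2 - (m - 1) * \<omega>) * m\<^sup>2 - (4 * v\<^sup>2 - 2 * v\<^sup>2 * \<omega> - 8 * v * \<omega>)) > 0" by linarith
  hence "(v\<^sup>2 - (m - 1) * \<omega>) * m\<^sup>2 - (4 * v\<^sup>2 - 2 * v\<^sup>2 * \<omega> - 8 * v * \<omega>) > 0"
    using m by (simp add: zero_less_mult_iff)
  hence "(v\<^sup>2 - (m - 1) * \<omega>) - (4 * v\<^sup>2 - 2 * v\<^sup>2 * \<omega> - 8 * v * \<omega>) / m\<^sup>2 > 0"
    using m by (simp add: field_simps)
  moreover have "m - 1 = 2 * v + 3" by (simp add: m_def)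
  ultimately show ?thesis by (simp only: m_def)
qed

text \<open>Freezing u in the equation for w suggests x u^2/(2 x u + 3); the 4 in place of 3 matches
  w ~ x u^2/4 near x = 0. If the difference D were negative somewhere, its minimum on [0, x] would
  lie at some y > 0 because D 0 = 0. But D has positive derivative wherever it is negative, so it is
  still smaller just to the left of y.\<close>

lemma bess_conc_lower:
  assumes "x > 0"
  shows "bess_conc x \<ge> x * (bess_log x)\<^sup>2 / (2 * (x * bess_log x) + 4)"
proof (rule ccontr)
  define u where "u = bess_log"
  define b where "b = (\<lambda>x. x * (u x)\<^sup>2 / (2 * (x * u x) + 4))"
  define D where "D = (\<lambda>x. bess_conc x - b x)"
  assume "\<not> ?thesis"
  hence neg: "D x < 0" by (simp add: D_def b_def u_def)
  have u: "u x > 0" if "x \<ge> 0" for x using bess_log_pos that by (simp add: u_def)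
  have conc: "bess_conc = (\<lambda>x. x * (u x)\<^sup>2 + 3 * u x - 1)"
    by (simp add: fun_eq_iff bess_conc_def u_def)
  have "continuous_on {0..x} bess" "continuous_on {0..x} bess1"
    by (rule DERIV_continuous_on, rule has_field_derivative_at_within, rule DERIV_bess DERIV_bess1)+
  hence "continuous_on {0..x} u"
    unfolding u_def bess_log_def[abs_def] using bess_pos
    by (intro continuous_on_divide) (auto simp: less_imp_neq[symmetric])
  moreover have "2 * (y * u y) + 4 \<noteq> 0" if "y \<in> {0..x}" for y
  proof -
    have "0 \<le> y * u y" using u[of y] that by auto
    thus ?thesis by linarith
  qed
  ultimately have "continuous_on {0..x} D"
    unfolding D_def b_def conc by (intro continuous_intros) auto
  then obtain y where y: "y \<in> {0..x}" "\<And>z. z \<in> {0..x} \<Longrightarrow> D y \<le> D z"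
    using continuous_attains_inf[of "{0..x}" D] assms by auto
  have "D 0 = 0"
    using bess_ode[of 0] bess_pos[of 0] by (simp add: D_def b_def bess_conc_def bess_log_def)
  hence y0: "y > 0" "D y < 0" proof -
    show "D y < 0" using y(2)[of x] neg assms by simp
    with \<open>D 0 = 0\<close> have "y \<noteq> 0" by auto
    thus "y > 0" using y(1) by simp
  qed
  define U where "U = u y"
  define W where "W = bess_conc y"
  define v where "v = y * U"
  define \<omega> where "\<omega> = y * W"
  have U: "U > 0" using u y0 by (simp add: U_def)
  hence v: "v > 0" using y0 by (simp add: v_def)
  have du: "(u has_real_derivative - W / y) (at y)"
    unfolding u_def W_def using y0 by (intro DERIV_bess_log)
  have dw: "(bess_conc has_real_derivative U\<^sup>2 - (2 * U + 3 / y) * W) (at y)"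
    unfolding conc using y0
    by (auto intro!: derivative_eq_intros du simp: U_def field_simps power2_eq_square)
  have db: "(b has_real_derivative ((U\<^sup>2 + y * (2 * U * (- W / y))) * (2 * v + 4) -
      y * U\<^sup>2 * (2 * (U + y * (- W / y)))) / (2 * v + 4)\<^sup>2) (at y)"
    unfolding b_def using y0 v
    by (auto intro!: derivative_eq_intros du simp: U_def v_def power2_eq_square algebra_simps)
  define D' where "D' = U\<^sup>2 - (2 * U + 3 / y) * W - ((U\<^sup>2 + y * (2 * U * (- W / y))) * (2 * v + 4) -
      y * U\<^sup>2 * (2 * (U + y * (- W / y)))) / (2 * v + 4)\<^sup>2"
  have dD: "(D has_real_derivative D') (at y)"
    unfolding D_def D'_def by (rule DERIV_diff[OF dw db])
  have "D' > 0"
  proof -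
    have "y\<^sup>2 * D' = v\<^sup>2 - (2 * v + 3) * \<omega> - (y\<^sup>2 * ((U\<^sup>2 + y * (2 * U * (- W / y))) * (2 * v + 4) -
      y * U\<^sup>2 * (2 * (U + y * (- W / y))))) / (2 * v + 4)\<^sup>2"
      unfolding D'_def right_diff_distrib
      using y0 by (simp add: v_def \<omega>_def power2_eq_square algebra_simps)
    also have "y\<^sup>2 * ((U\<^sup>2 + y * (2 * U * (- W / y))) * (2 * v + 4) - y * U\<^sup>2 * (2 * (U + y * (- W / y))))
       = 4 * v\<^sup>2 - 2 * v\<^sup>2 * \<omega> - 8 * v * \<omega>"
      using y0 by (simp add: v_def \<omega>_def power2_eq_square algebra_simps)
    also have "v\<^sup>2 - (2 * v + 3) * \<omega> - (4 * v\<^sup>2 - 2 * v\<^sup>2 * \<omega> - 8 * v * \<omega>) / (2 * v + 4)\<^sup>2 > 0"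
    proof (rule barrier_ineq[OF v])
      have "W < b y" using y0 by (simp add: D_def W_def)
      hence "y * W < y * b y" using y0 by simp
      also have "y * b y = v\<^sup>2 / (2 * v + 4)" by (simp add: b_def v_def U_def power2_eq_square)
      finally show "\<omega> < v\<^sup>2 / (2 * v + 4)" by (simp add: \<omega>_def)
    qed
    finally show ?thesis using y0 by (simp add: zero_less_mult_iff)
  qed
  then obtain d where d: "d > 0" "\<And>h. 0 < h \<Longrightarrow> h < d \<Longrightarrow> D (y - h) < D y"
    using DERIV_pos_inc_left[OF dD] by auto
  define h where "h = min y d / 2"
  have "0 < h" "h < d" "y - h \<in> {0..x}" using y0 y d(1) by (auto simp: h_def)
  thus False using d(2)[of h] y(2)[of "y - h"] by simp
qed

text \<open>Nonnegativity of \<open>bess_conc\<close> says z u^2 + 3 u >= 1, while the claimed bound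
  inserted for u gives only 1 - 9/(4 z).\<close>

lemma bess_log_lower:
  assumes "z > 0"
  shows "bess_log z \<ge> 1 / sqrt z - 3 / (2 * z)"
proof (rule ccontr)
  define u where "u = bess_log z"
  define r where "r = sqrt z"
  have r: "r > 0" "z = r\<^sup>2" using assms by (auto simp: r_def)
  have u: "u > 0" using bess_log_pos[of z] assms by (simp add: u_def)
  define a where "a = 1 / r - 3 / (2 * r\<^sup>2)"
  assume "\<not> ?thesis"
  hence ua: "u < a" by (simp add: u_def a_def r_def[symmetric] r(2)[symmetric])
  have "0 \<le> z * u\<^sup>2 / (2 * (z * u) + 4)" using u assms by auto
  hence "1 \<le> z * u\<^sup>2 + 3 * u"
    using bess_conc_lower[OF assms] by (simp add: bess_conc_def u_def)
  also have "\<dots> < z * a\<^sup>2 + 3 * a"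
    using ua u assms by (intro add_strict_mono mult_strict_left_mono power_strict_mono) auto
  also have "\<dots> = 1 - 9 / (4 * r\<^sup>2)"
    using r by (simp add: a_def field_simps power2_eq_square)
  finally show False using r by simp
qed

text \<open>u^2/(2 z u + 4) increases with u, so a lower bound for u suffices. From sqrt z >= 30 on,
  3/(2 sqrt z) <= 0.05, so u >= 0.95/sqrt z; the constant 0.44 then lies slightly below the limiting
  value 1/2.\<close>

lemma bess_log_decay:
  assumes "z \<ge> 900"
  shows "bess_conc z / z \<ge> 0.44 / sqrt z ^ 3"
proof -
  define u where "u = bess_log z"
  define r where "r = sqrt z"
  have r: "r \<ge> 30" using real_sqrt_le_mono[OF assms] by (simp add: r_def)
  have z: "z = r\<^sup>2" using assms by (simp add: r_def)
  define w where "w = 0.95 / r"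
  have "1 / r * (3 / (2 * r)) \<le> 1 / r * 0.05"
    using r by (intro mult_left_mono) (auto simp: field_simps)
  hence "w \<le> 1 / r - 3 / (2 * z)" by (simp add: w_def z power2_eq_square field_simps)
  also have "\<dots> \<le> u" using bess_log_lower[of z] assms by (simp add: u_def r_def)
  finally have wu: "w \<le> u" .
  have w: "w > 0" using r by (simp add: w_def)
  have u: "u > 0" using w wu by simp
  have "0.44 / r ^ 3 \<le> w\<^sup>2 / (2 * (z * w) + 4)"
  proof -
    have "2 * (z * w) + 4 = 1.9 * r + 4" using r by (simp add: z w_def power2_eq_square)
    also have "\<dots> \<le> 2.04 * r" using r by simp
    finally have "w\<^sup>2 / (2.04 * r) \<le> w\<^sup>2 / (2 * (z * w) + 4)"
      using w r assms by (intro divide_left_mono) (auto intro!: mult_pos_pos add_pos_pos)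
    moreover have "0.44 / r ^ 3 \<le> w\<^sup>2 / (2.04 * r)"
      using r by (simp add: w_def field_simps power2_eq_square power3_eq_cube)
    ultimately show ?thesis by simp
  qed
  also have "\<dots> \<le> u\<^sup>2 / (2 * (z * u) + 4)"
  proof -
    have "w\<^sup>2 * u \<le> u\<^sup>2 * w" using wu w u by (simp add: power2_eq_square)
    hence "2 * z * (w\<^sup>2 * u) \<le> 2 * z * (u\<^sup>2 * w)" using assms by (intro mult_left_mono) auto
    moreover have "w\<^sup>2 \<le> u\<^sup>2" using wu w by (intro power_mono) auto
    ultimately have "w\<^sup>2 * (2 * (z * u) + 4) \<le> u\<^sup>2 * (2 * (z * w) + 4)" by (simp add: algebra_simps)
    moreover have "2 * (z * u) + 4 > 0" "2 * (z * w) + 4 > 0" using u w assms by (auto intro!: add_pos_pos)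
    ultimately show ?thesis by (simp add: divide_le_eq le_divide_eq mult_ac)
  qed
  also have "\<dots> \<le> bess_conc z / z"
    using bess_conc_lower[of z] assms by (simp add: u_def le_divide_eq mult_ac)
  finally show ?thesis by (simp add: r_def)
qed

text \<open>\<open>bess_conc z / z\<close> is minus the second derivative of log bess. Its lower
  bound m on the interval makes ln bess (y + h) + ln bess (y - h) + m h^2 decrease in h from h = 0
  to c, and exp (m c^2) >= 1 + m c^2.\<close>

lemma bess_log_concave:
  assumes "c > 0" "y - c \<ge> 900"
  shows "bess (y - c) * bess (y + c) * (1 + 0.44 * c\<^sup>2 / sqrt (y + c) ^ 3) \<le> (bess y)\<^sup>2"
proof -
  define m where "m = 0.44 / sqrt (y + c) ^ 3"
  have m0: "m \<ge> 0" using assms by (simp add: m_def)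
  have m: "bess_conc z / z \<ge> m" if "z \<ge> 900" "z \<le> y + c" for z
  proof -
    have "m \<le> 0.44 / sqrt z ^ 3"
      unfolding m_def using that by (intro divide_left_mono power_mono) auto
    thus ?thesis using bess_log_decay[OF that(1)] by linarith
  qed
  define F where "F h = ln (bess (y + h)) + ln (bess (y - h)) + m * h\<^sup>2" for h
  have D: "((\<lambda>x. ln (bess x)) has_real_derivative bess_log x) (at x)" if "x \<ge> 900" for x
    using bess_pos[of x] that
    by (auto intro!: derivative_eq_intros DERIV_bess simp: bess_log_def field_simps)
  have G: "bess_log b + m * b \<le> bess_log a + m * a" if "900 \<le> a" "a \<le> b" "b \<le> y + c" for a b
  proof (rule DERIV_nonpos_imp_nonincreasing[OF that(2)])
    fix x assume "a \<le> x" "x \<le> b"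
    moreover from this have "((\<lambda>x. bess_log x + m * x) has_real_derivative - bess_conc x / x + m) (at x)"
      using that by (auto intro!: derivative_eq_intros DERIV_bess_log)
    ultimately show "\<exists>z. ((\<lambda>x. bess_log x + m * x) has_real_derivative z) (at x) \<and> z \<le> 0"
      using m[of x] that by (intro exI[of _ "- bess_conc x / x + m"]) auto
  qed
  have "F c \<le> F 0"
  proof (rule DERIV_nonpos_imp_nonincreasing[where f = F and a = 0 and b = c])
    show "0 \<le> c" using assms by simp
    fix h assume h: "0 \<le> h" "h \<le> c"
    have "(F has_real_derivative bess_log (y + h) - bess_log (y - h) + 2 * m * h) (at h)"
    proof -
      have "((\<lambda>h. ln (bess (y + h))) has_real_derivative bess_log (y + h) * 1) (at h)"
        by (rule DERIV_chain2[OF D]) (use h assms in \<open>auto intro!: derivative_eq_intros\<close>)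
      moreover have "((\<lambda>h. ln (bess (y - h))) has_real_derivative bess_log (y - h) * (-1)) (at h)"
        by (rule DERIV_chain2[OF D]) (use h assms in \<open>auto intro!: derivative_eq_intros\<close>)
      moreover have "((\<lambda>h. m * h\<^sup>2) has_real_derivative 2 * m * h) (at h)"
        by (auto intro!: derivative_eq_intros)
      ultimately have "(F has_real_derivative bess_log (y + h) * 1 + bess_log (y - h) * (-1) + 2 * m * h) (at h)"
        unfolding F_def[abs_def] by (intro DERIV_add)
      thus ?thesis by simp
    qed
    moreover have "bess_log (y + h) - bess_log (y - h) + 2 * m * h \<le> 0"
      using G[of "y - h" "y + h"] h assms by (simp add: algebra_simps)
    ultimately show "\<exists>z. (F has_real_derivative z) (at h) \<and> z \<le> 0" by blast
  qed
  hence "ln (bess (y + c)) + ln (bess (y - c)) + m * c\<^sup>2 \<le> 2 * ln (bess y)" by (simp add: F_def)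
  hence "exp (ln (bess (y + c)) + ln (bess (y - c)) + m * c\<^sup>2) \<le> exp (2 * ln (bess y))" by simp
  hence "bess (y + c) * bess (y - c) * exp (m * c\<^sup>2) \<le> (bess y)\<^sup>2"
    using assms bess_pos by (simp add: exp_add exp_double)
  moreover have "bess (y + c) * bess (y - c) * (1 + m * c\<^sup>2) \<le> bess (y + c) * bess (y - c) * exp (m * c\<^sup>2)"
    using assms bess_pos[of "y + c"] bess_pos[of "y - c"]
    by (intro mult_left_mono exp_ge_add_one_self) auto
  ultimately show ?thesis by (simp add: m_def mult_ac)
qed

section \<open>Growth and size of the Bessel series\<close>

text \<open>The recursion gives (k + 3) times the k-th coefficient of bess' as that of bess, hence
  bess' <= bess/3 termwise, and exp(-x/3) bess x decreases.\<close>

lemma bess_growth: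
  assumes "y \<ge> 0" "c \<ge> 0"
  shows "bess y \<le> bess (y + c)" "bess (y + c) \<le> exp (c / 3) * bess y"
proof -
  have le: "bess1 x \<le> bess x / 3" if "x \<ge> 0" for x
  proof -
    have "diffs bess_coeff k * x ^ k \<le> bess_coeff k * x ^ k / 3" for k
    proof -
      have "bess_coeff k = (real k + 3) * diffs bess_coeff k"
        using bess_coeff_rec[of k] by (simp add: diffs_def algebra_simps)
      also have "\<dots> \<ge> 3 * diffs bess_coeff k"
        using bess_coeff_pos[of "Suc k"] by (intro mult_right_mono) (auto simp: diffs_def)
      finally have "3 * diffs bess_coeff k * x ^ k \<le> bess_coeff k * x ^ k"
        using that by (intro mult_right_mono) auto
      thus ?thesis by simp
    qed
    hence "bess1 x \<le> (\<Sum>k. bess_coeff k * x ^ k / 3)"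
      unfolding bess1_def by (intro suminf_le summable_bess1 summable_divide summable_bess)
    also have "\<dots> = bess x / 3" unfolding bess_def by (rule suminf_divide[OF summable_bess])
    finally show ?thesis .
  qed
  show "bess y \<le> bess (y + c)"
  proof (rule DERIV_nonneg_imp_nondecreasing[where f = bess])
    fix x assume "y \<le> x"
    thus "\<exists>z. (bess has_real_derivative z) (at x) \<and> 0 \<le> z"
      using DERIV_bess[of x] bess1_pos[of x] assms by (intro exI[of _ "bess1 x"]) auto
  qed (use assms in auto)
  have "exp (- (y + c) / 3) * bess (y + c) \<le> exp (- y / 3) * bess y"
  proof (rule DERIV_nonpos_imp_nonincreasing[of y "y + c" "\<lambda>x. exp (- x / 3) * bess x"])
    fix x assume "y \<le> x"
    moreover have "((\<lambda>x. exp (- x / 3) * bess x) has_real_derivative exp (- x / 3) * (bess1 x - bess x / 3)) (at x)"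
      by (auto intro!: derivative_eq_intros DERIV_bess simp: algebra_simps)
    moreover have "exp (- x / 3) * (bess1 x - bess x / 3) \<le> 0"
      using le[of x] assms calculation by (intro mult_nonneg_nonpos) auto
    ultimately show "\<exists>z. ((\<lambda>x. exp (- x / 3) * bess x) has_real_derivative z) (at x) \<and> z \<le> 0" by blast
  qed (use assms in auto)
  hence "exp ((y + c) / 3) * (exp (- (y + c) / 3) * bess (y + c)) \<le> exp ((y + c) / 3) * (exp (- y / 3) * bess y)"
    by (intro mult_left_mono) auto
  thus "bess (y + c) \<le> exp (c / 3) * bess y"
    by (simp add: mult.assoc[symmetric] exp_add[symmetric] add_divide_distrib diff_divide_distrib)
qed

text \<open>Termwise comparison of y bess y with sinh t / t - 1. A factor of order sqrt t is lost
  against the true size exp t / (y sqrt(2 pi t)), which the exponential margin can afford.\<close>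

lemma bess_lower:
  assumes "y > 0" "t = 2 * sqrt y" "t \<ge> 4"
  shows "bess y \<ge> 3 * exp t / (16 * y * t)"
proof -
  have t2: "t\<^sup>2 = 4 * y" using assms by (simp add: power_mult_distrib)
  \<comment> \<open>The factor 3 is fixed by equality at k = 0; it becomes the 3/4 in front of sinh
    t / t - 1, whose constant term is removed so that its series starts with t^2 = 4 y.\<close>
  have fact_ineq: "3 * 4 ^ k * (fact k * fact (k + 2)) \<le> (fact (2 * k + 3) :: real)" for k
  proof (induction k)
    case 0
    show ?case by (simp add: fact_numeral eval_nat_numeral)
  next
    case (Suc k)
    have "3 * 4 ^ Suc k * (fact (Suc k) * fact (Suc k + 2)) =
       (4 * (real k + 1) * (real k + 3)) * (3 * 4 ^ k * (fact k * fact (k + 2)) :: real)"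
      by (simp add: algebra_simps)
    also have "\<dots> \<le> (4 * (real k + 1) * (real k + 3)) * fact (2 * k + 3)"
      by (intro mult_left_mono Suc.IH) auto
    also have "\<dots> \<le> ((2 * real k + 5) * (2 * real k + 4)) * fact (2 * k + 3)"
      by (intro mult_right_mono) (auto simp: algebra_simps)
    also have "\<dots> = fact (2 * Suc k + 3)"
    proof -
      have "2 * Suc k + 3 = Suc (Suc (2 * k + 3))" by simp
      thus ?thesis by (simp only: fact_Suc) (simp add: algebra_simps)
    qed
    finally show ?case .
  qed
  have "(\<lambda>n. if even n then 0 else t ^ n /\<^sub>R fact n) sums sinh t" by (rule sinh_converges)
  hence "(\<lambda>k. if even (2 * k + 1) then 0 else t ^ (2 * k + 1) /\<^sub>R fact (2 * k + 1)) sums sinh t"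
    by (subst sums_mono_reindex) (auto simp: strict_mono_def image_iff elim!: oddE)
  hence "(\<lambda>k. t ^ (2 * k + 1) / fact (2 * k + 1)) sums sinh t"
    by (simp add: divide_inverse mult_ac del: fact_Suc)
  hence "(\<lambda>k. t ^ (2 * k + 1) / fact (2 * k + 1) / t) sums (sinh t / t)" by (rule sums_divide)
  hence "(\<lambda>k. t ^ (2 * k) / fact (2 * k + 1)) sums (sinh t / t)" using assms by simp
  hence "(\<lambda>k. t ^ (2 * Suc k) / fact (2 * Suc k + 1)) sums (sinh t / t - 1)"
    by (subst sums_Suc_iff) simp
  hence "(\<lambda>k. 3/4 * (t ^ (2 * Suc k) / fact (2 * Suc k + 1))) sums (3/4 * (sinh t / t - 1))"
    by (rule sums_mult)
  moreover have "3/4 * (t ^ (2 * Suc k) / fact (2 * Suc k + 1)) = 3 * 4 ^ k * y ^ Suc k / fact (2 * k + 3)" for k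
  proof -
    have "t ^ (2 * Suc k) = 4 ^ Suc k * y ^ Suc k"
      unfolding power_mult t2 by (simp add: power_mult_distrib)
    moreover have "2 * Suc k + 1 = 2 * k + 3" by simp
    ultimately show ?thesis by (simp only:) simp
  qed
  ultimately have s1: "(\<lambda>k. 3 * 4 ^ k * y ^ Suc k / fact (2 * k + 3)) sums (3/4 * (sinh t / t - 1))" by simp
  have s2: "(\<lambda>k. y * (bess_coeff k * y ^ k)) sums (y * bess y)"
    unfolding bess_def by (intro sums_mult summable_sums summable_bess)
  have "3/4 * (sinh t / t - 1) \<le> y * bess y"
  proof (rule sums_le[OF _ s1 s2])
    fix k
    have "3 * 4 ^ k / fact (2 * k + 3) \<le> bess_coeff k"
      using fact_ineq[of k] unfolding bess_coeff_def
      by (simp add: divide_le_eq le_divide_eq del: fact_Suc add_2_eq_Suc')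
    hence "3 * 4 ^ k / fact (2 * k + 3) * y ^ Suc k \<le> bess_coeff k * y ^ Suc k"
      using assms by (intro mult_right_mono) auto
    thus "3 * 4 ^ k * y ^ Suc k / fact (2 * k + 3) \<le> y * (bess_coeff k * y ^ k)"
      by (simp add: mult_ac del: fact_Suc)
  qed
  moreover have "exp t / (4 * t) \<le> sinh t / t - 1"
  proof -
    have "1 + t / 2 + (t / 2)\<^sup>2 / 2 \<le> exp (t / 2)"
      using assms by (intro exp_lower_Taylor_quadratic) auto
    moreover have "t * 4 \<le> t * t" using assms by (intro mult_left_mono) auto
    ultimately have "1 + t \<le> exp (t / 2)" by (simp add: power2_eq_square)
    hence "(1 + t)\<^sup>2 \<le> (exp (t / 2))\<^sup>2" using assms by (intro power_mono) auto
    also have "\<dots> = exp t" by (simp add: power2_eq_square flip: exp_add)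
    finally have "1 + 6 * t \<le> exp t" using \<open>t * 4 \<le> t * t\<close> by (simp add: power2_eq_square algebra_simps)
    moreover have "exp (-t) \<le> 1" using assms by simp
    ultimately have "4 * t + 2 * exp (- t) \<le> exp t" using assms by linarith
    thus ?thesis using assms by (simp add: sinh_def field_simps)
  qed
  hence "3/4 * (exp t / (4 * t)) \<le> 3/4 * (sinh t / t - 1)" by (intro mult_left_mono) auto
  ultimately have "3/4 * (exp t / (4 * t)) \<le> y * bess y" by (rule order_trans[rotated])
  thus ?thesis using assms by (simp add: field_simps)
qed

section \<open>Contour integrals\<close>

text \<open>Expansion of exp(c/z): the terms j = 0 and j = 1 have no pole because of the factor z,
  and for j >= 2 Cauchy's formula picks the coefficient of z^(j-2) in exp(y z). With j = k + 2 the
  results form the series \<open>bess\<close>.\<close>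

lemma bess_circle_integral:
  fixes c y :: real
  shows "contour_integral (circlepath 0 1) (\<lambda>z. z * exp (of_real c / z + of_real y * z)) =
    2 * pi * \<i> * of_real (c\<^sup>2 * bess (c * y))"
proof -
  define T where "T j z = (of_real c / z) ^ j /\<^sub>R fact j * (z * exp (of_real y * z))" for j and z :: complex
  define I where "I j = (if j < 2 then 0 else 2 * pi * \<i> * of_real (c ^ j * y ^ (j - 2) / (fact j * fact (j - 2))))" for j
  have hol: "(\<lambda>z. exp (of_real y * z)) holomorphic_on S" for S :: "complex set" by (intro holomorphic_intros)
  have T0: "(T 0 has_contour_integral 0) (circlepath 0 1)"
    unfolding T_def by (rule Cauchy_theorem_convex_simple[where S = UNIV]) (auto intro!: holomorphic_intros)
  have T1: "(T 1 has_contour_integral 0) (circlepath 0 1)"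
  proof (rule has_contour_integral_eq)
    show "((\<lambda>z. of_real c * exp (of_real y * z)) has_contour_integral 0) (circlepath 0 1)"
      by (rule Cauchy_theorem_convex_simple[where S = UNIV]) (auto intro!: holomorphic_intros)
  qed (auto simp: T_def)
  have Tk: "(T (Suc (Suc k)) has_contour_integral I (Suc (Suc k))) (circlepath 0 1)" for k
  proof (rule has_contour_integral_eq)
    have "(deriv ^^ k) (\<lambda>z. exp (complex_of_real y * z)) 0 / fact k = of_real y ^ k / fact k"
      using fps_nth_fps_expansion[OF has_fps_expansion_exp[of "complex_of_real y"], of k] by simp
    hence d: "(deriv ^^ k) (\<lambda>z. exp (complex_of_real y * z)) 0 = of_real y ^ k" by simp
    have "((\<lambda>u. exp (of_real y * u) / (u - 0) ^ Suc k) has_contour_integral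
       (2 * pi * \<i>) / fact k * (deriv ^^ k) (\<lambda>z. exp (complex_of_real y * z)) 0) (circlepath 0 1)"
      by (rule Cauchy_has_contour_integral_higher_derivative_circlepath)
         (auto intro!: continuous_intros hol)
    from has_contour_integral_lmul[OF this, of "of_real c ^ Suc (Suc k) / fact (Suc (Suc k))"]
    show "((\<lambda>u. of_real c ^ Suc (Suc k) / fact (Suc (Suc k)) * (exp (of_real y * u) / (u - 0) ^ Suc k))
       has_contour_integral I (Suc (Suc k))) (circlepath 0 1)"
      unfolding d by (rule back_subst[of "\<lambda>i. (_ has_contour_integral i) _"])
        (simp add: I_def field_simps del: fact_Suc power_Suc)
    fix x :: complex assume "x \<in> path_image (circlepath 0 1)"
    hence "x \<noteq> 0" by auto
    thus "of_real c ^ Suc (Suc k) / fact (Suc (Suc k)) * (exp (of_real y * x) / (x - 0) ^ Suc k) = T (Suc (Suc k)) x"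
      by (simp add: T_def power_divide scaleR_conv_of_real field_simps del: fact_Suc)
  qed
  have TI: "(T j has_contour_integral I j) (circlepath 0 1)" for j
  proof (cases "j < 2")
    case True
    hence "j = 0 \<or> j = 1" by auto
    thus ?thesis using T0 T1 by (auto simp: I_def)
  next
    case False
    then obtain k where "j = Suc (Suc k)" by (intro that[of "j - 2"]) auto
    thus ?thesis using Tk by simp
  qed
  have Tsum: "(\<lambda>j. T j z) sums (z * exp (of_real c / z + of_real y * z))" for z
  proof -
    have "(\<lambda>j. T j z) sums (exp (of_real c / z) * (z * exp (of_real y * z)))"
      unfolding T_def by (intro sums_mult2 exp_converges)
    thus ?thesis by (simp add: exp_add mult_ac)
  qed
  have unif: "uniform_limit (sphere 0 1) (\<lambda>N z. \<Sum>j<N. T j z) (\<lambda>z. \<Sum>j. T j z) sequentially"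
  proof (rule Weierstrass_m_test)
    show "summable (\<lambda>j. \<bar>c\<bar> ^ j /\<^sub>R fact j * exp \<bar>y\<bar>)"
      by (intro summable_mult2 summable_exp_generic)
    fix j and z :: complex assume "z \<in> sphere 0 1"
    hence z: "norm z = 1" by simp
    have "Re (of_real y * z) \<le> \<bar>y\<bar>" using complex_Re_le_cmod[of "of_real y * z"] z by (simp add: norm_mult)
    hence "norm (exp (of_real y * z)) \<le> exp \<bar>y\<bar>" by (simp add: norm_exp_eq_Re)
    thus "norm (T j z) \<le> \<bar>c\<bar> ^ j /\<^sub>R fact j * exp \<bar>y\<bar>"
      unfolding T_def by (simp add: norm_mult norm_divide norm_power z mult_left_mono)
  qed
  have "(\<lambda>N. contour_integral (circlepath 0 1) (\<lambda>z. \<Sum>j<N. T j z)) \<longlonglongrightarrow>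
      contour_integral (circlepath 0 1) (\<lambda>z. \<Sum>j. T j z)"
    by (rule contour_integral_uniform_limit_circlepath[OF _ unif])
       (auto intro!: always_eventually contour_integrable_sum has_contour_integral_integrable[OF TI])
  also have "(\<lambda>z. \<Sum>j. T j z) = (\<lambda>z. z * exp (of_real c / z + of_real y * z))"
    using sums_unique[OF Tsum] by simp
  also have "(\<lambda>N. contour_integral (circlepath 0 1) (\<lambda>z. \<Sum>j<N. T j z)) = (\<lambda>N. \<Sum>j<N. I j)"
    by (intro ext contour_integral_unique has_contour_integral_sum TI) auto
  finally have lim: "(\<lambda>N. \<Sum>j<N. I j) \<longlonglongrightarrow>
      contour_integral (circlepath 0 1) (\<lambda>z. z * exp (of_real c / z + of_real y * z))" .
  have "(\<lambda>k. c\<^sup>2 * (bess_coeff k * (c * y) ^ k)) sums (c\<^sup>2 * bess (c * y))"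
    unfolding bess_def by (intro sums_mult summable_sums summable_bess)
  hence "(\<lambda>k. 2 * pi * \<i> * of_real (c\<^sup>2 * (bess_coeff k * (c * y) ^ k))) sums (2 * pi * \<i> * of_real (c\<^sup>2 * bess (c * y)))"
    by (rule sums_mult[OF sums_of_real])
  moreover have "2 * pi * \<i> * of_real (c\<^sup>2 * (bess_coeff k * (c * y) ^ k)) = I (k + 2)" for k
  proof -
    have "c\<^sup>2 * (bess_coeff k * (c * y) ^ k) = c ^ (k + 2) * y ^ (k + 2 - 2) / (fact (k + 2) * fact (k + 2 - 2))"
      unfolding bess_coeff_def power_add power_mult_distrib by (simp add: mult_ac del: fact_Suc)
    thus ?thesis unfolding I_def by (simp only: ) simp
  qed
  ultimately have "(\<lambda>k. I (k + 2)) sums (2 * pi * \<i> * of_real (c\<^sup>2 * bess (c * y)))" by (simp only:)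
  hence "I sums (2 * pi * \<i> * of_real (c\<^sup>2 * bess (c * y)))"
    by (subst (asm) sums_iff_shift) (simp add: I_def numeral_2_eq_2)
  hence "(\<lambda>N. \<Sum>j<N. I j) \<longlonglongrightarrow> 2 * pi * \<i> * of_real (c\<^sup>2 * bess (c * y))" by (simp add: sums_def)
  with lim show ?thesis by (rule LIMSEQ_unique)
qed

text \<open>0 is the only singularity and has winding number 1 for both paths, so by the residue
  theorem the rectangle and the circle give the same value; the residue at the essential singularity
  need not be computed.\<close>

lemma bess_rect_integral:
  fixes c y :: real
  assumes "0 \<in> box a b"
  shows "contour_integral (rectpath a b) (\<lambda>z. z * exp (of_real c / z + of_real y * z)) =
    2 * pi * \<i> * of_real (c\<^sup>2 * bess (c * y))"
proof -
  define f where "f = (\<lambda>z. z * exp (complex_of_real c / z + of_real y * z))"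
  have hol: "f holomorphic_on UNIV - {0}" unfolding f_def by (intro holomorphic_intros) auto
  have le: "Re a \<le> Re b" "Im a \<le> Im b" using assms by (auto simp: in_box_complex_iff)
  have "contour_integral (rectpath a b) f = of_real (2 * pi) * \<i> * (\<Sum>p\<in>{0}. winding_number (rectpath a b) p * residue f p)"
    using assms path_image_rectpath_cbox_minus_box[OF le]
    by (intro Residue_theorem[of UNIV, OF _ _ _ hol]) auto
  also have "\<dots> = of_real (2 * pi) * \<i> * (\<Sum>p\<in>{0}. winding_number (circlepath 0 1) p * residue f p)"
    using winding_number_rectpath[OF assms] by (simp add: winding_number_circlepath_centre)
  also have "\<dots> = contour_integral (circlepath 0 1) f"
    by (intro Residue_theorem[of UNIV, OF _ _ _ hol, symmetric]) auto
  finally show ?thesis unfolding f_def bess_circle_integral .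
qed

text \<open>The segment is one period of z to exp(-z), so integrals over it extract coefficients.\<close>

lemma segment_exp_integral:
  fixes x :: real and m :: int
  shows "((\<lambda>z. exp (of_int m * z)) has_contour_integral (if m = 0 then 2 * pi * \<i> else 0))
     (linepath (Complex x (- pi)) (Complex x pi))"
proof (cases "m = 0")
  case True
  have "Complex x pi - Complex x (- pi) = 2 * pi * \<i>" by (simp add: complex_eq_iff)
  hence "((\<lambda>z. 1) has_contour_integral 2 * pi * \<i>) (linepath (Complex x (- pi)) (Complex x pi))"
    using has_contour_integral_const_linepath[of 1 "Complex x pi" "Complex x (- pi)"] by (simp only: mult_1)
  thus ?thesis unfolding True by (simp only: of_int_0 mult_zero_left exp_zero if_True refl)
next
  case False
  have "((\<lambda>z. exp (of_int m * z)) has_contour_integral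
     exp (of_int m * Complex x pi) / of_int m - exp (of_int m * Complex x (- pi)) / of_int m)
     (linepath (Complex x (- pi)) (Complex x pi))"
  proof -
    have "((\<lambda>z. exp (of_int m * z) / of_int m) has_field_derivative exp (of_int m * z)) (at z within UNIV)" for z :: complex
      using False by (auto intro!: derivative_eq_intros)
    from contour_integral_primitive[OF this, of "linepath (Complex x (- pi)) (Complex x pi)"]
    show ?thesis by simp
  qed
  moreover have "exp (of_int m * Complex x pi) = exp (of_int m * Complex x (- pi))"
    unfolding exp_eq by (intro exI[of _ m]) (simp add: complex_eq_iff)
  ultimately show ?thesis using False by simp
qed

text \<open>The power series in exp(-z) converges absolutely and uniformly on the line Re z = x, so
  it can be integrated term by term and only k = n survives.\<close>

lemma cubic_overpartition_integral:
  assumes x: "x > 0"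
  shows "(\<lambda>z. cop_fun z * exp (of_nat n * z)) contour_integrable_on linepath (Complex x (- pi)) (Complex x pi)"
    and "contour_integral (linepath (Complex x (- pi)) (Complex x pi)) (\<lambda>z. cop_fun z * exp (of_nat n * z)) =
      2 * pi * \<i> * of_real (cubic_overpartition n)"
proof -
  define L where "L = linepath (Complex x (- pi)) (Complex x pi)"
  define r where "r = exp (- x)"
  have r: "0 < r" "r < 1" using x by (auto simp: r_def)
  define a where "a = (\<lambda>k. complex_of_real (cubic_overpartition k))"
  define T where "T k z = a k * exp (of_int (int n - int k) * z)" for k and z :: complex
  have TI: "(T k has_contour_integral (if k = n then 2 * pi * \<i> * a n else 0)) L" for k
    using has_contour_integral_lmul[OF segment_exp_integral[of "int n - int k" x], of "a k"]
    unfolding T_def[abs_def] L_def by (auto simp: mult_ac)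
  have Re_L: "Re z = x" if "z \<in> path_image L" for z
    using that by (auto simp: L_def in_segment complex_eq_iff algebra_simps)
  have Teq: "T k z = a k * exp (- z) ^ k * exp (of_nat n * z)" for k z
    by (simp add: T_def exp_of_nat_mult[symmetric] algebra_simps flip: exp_add)
  have Tsum: "(\<lambda>k. T k z) sums (cop_fun z * exp (of_nat n * z))" if "Re z = x" for z
  proof -
    have "norm (exp (- z)) < 1" using that x by (simp add: norm_exp_eq_Re)
    hence "(\<lambda>k. a k * exp (- z) ^ k * exp (of_nat n * z)) sums (cop_fun z * exp (of_nat n * z))"
      unfolding a_def cop_fun_def by (intro sums_mult2 cubic_overpartition_sums)
    thus ?thesis by (simp only: Teq)
  qed
  have unif: "uniform_limit (path_image L) (\<lambda>N z. \<Sum>k<N. T k z) (\<lambda>z. cop_fun z * exp (of_nat n * z)) sequentially"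
  proof (rule uniform_limit_cong'[THEN iffD1])
    show "uniform_limit (path_image L) (\<lambda>N z. \<Sum>k<N. T k z) (\<lambda>z. \<Sum>k. T k z) sequentially"
    proof (rule Weierstrass_m_test)
      show "summable (\<lambda>k. norm (a k * of_real r ^ k) * exp (real n * x))"
        unfolding a_def using cubic_overpartition_sums(2)[of "of_real r"] r by (intro summable_mult2) auto
      fix k z assume z: "z \<in> path_image L"
      have "Re z = x" using Re_L[OF z] .
      thus "norm (T k z) \<le> norm (a k * of_real r ^ k) * exp (real n * x)"
        unfolding Teq by (simp add: norm_mult norm_power r_def)
    qed
  qed (use Re_L sums_unique[OF Tsum] in auto)
  have B: "norm (vector_derivative L (at t)) \<le> 2 * pi" for t
  proof -
    have "Complex x pi - Complex x (- pi) = Complex 0 (2 * pi)" by (simp add: complex_eq_iff)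
    moreover have "norm (Complex 0 (2 * pi)) = 2 * pi" by (simp add: cmod_def real_sqrt_mult)
    ultimately show ?thesis by (simp add: L_def vector_derivative_linepath_at)
  qed
  have int: "eventually (\<lambda>N. (\<lambda>z. \<Sum>k<N. T k z) contour_integrable_on L) sequentially"
    by (intro always_eventually allI contour_integrable_sum has_contour_integral_integrable[OF TI]) auto
  show "(\<lambda>z. cop_fun z * exp (of_nat n * z)) contour_integrable_on linepath (Complex x (- pi)) (Complex x pi)"
    using contour_integral_uniform_limit(1)[OF int unif B] by (simp add: L_def)
  have "(\<lambda>N. contour_integral L (\<lambda>z. \<Sum>k<N. T k z)) \<longlonglongrightarrow> contour_integral L (\<lambda>z. cop_fun z * exp (of_nat n * z))"
    using contour_integral_uniform_limit(2)[OF int unif B] by (simp add: L_def)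
  moreover have "contour_integral L (\<lambda>z. \<Sum>k<N. T k z) = 2 * pi * \<i> * a n" if "N \<ge> Suc n" for N
  proof -
    have "contour_integral L (\<lambda>z. \<Sum>k<N. T k z) = (\<Sum>k<N. if k = n then 2 * pi * \<i> * a n else 0)"
      by (intro contour_integral_unique has_contour_integral_sum TI) auto
    thus ?thesis using that by simp
  qed
  hence "(\<lambda>N. contour_integral L (\<lambda>z. \<Sum>k<N. T k z)) \<longlonglongrightarrow> 2 * pi * \<i> * a n"
    by (intro tendsto_eventually eventually_sequentiallyI[of "Suc n"])
  ultimately show "contour_integral (linepath (Complex x (- pi)) (Complex x pi)) (\<lambda>z. cop_fun z * exp (of_nat n * z)) =
      2 * pi * \<i> * of_real (cubic_overpartition n)"
    unfolding L_def[symmetric] a_def using LIMSEQ_unique by blast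
qed

text \<open>The main term does not contain x, which stays free for later optimisation. The right
  side of the rectangle is the coefficient integral up to \<open>cop_fun_approx\<close>; the other
  three sides enter as error.\<close>

lemma cubic_overpartition_approx:
  assumes x: "0 < x" "x \<le> 1 / 15"
  shows "\<bar>cubic_overpartition n / cop_scale - cop_rate\<^sup>2 * bess (cop_rate * real n)\<bar> \<le>
     exp (real n * x) * (41 + x * exp ((cop_rate - 2) / x + 1.1 / sqrt x))"
proof -
  \<comment> \<open>The left side is Re z = -1, where both c/z and n z have negative real part. On
    the horizontal sides |Im z| = pi keeps Re (1/z) below 1/135.\<close>
  define A B C D where "A = Complex (-1) (- pi)" and "B = Complex x (- pi)"
    and "C = Complex x pi" and "D = Complex (-1) pi"
  note pts = A_def B_def C_def D_def
  define M where "M = (\<lambda>z. z * exp (complex_of_real cop_rate / z + of_real (real n) * z))"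
  define E where "E = exp (real n * x)"
  define X where "X = 35 + x * exp ((cop_rate - 2) / x + 1.1 / sqrt x)"
  have E: "E \<ge> 1" using x by (simp add: E_def)
  have X: "X \<ge> 0" using x by (simp add: X_def)
  have segAB: "Im z = - pi" "-1 \<le> Re z" "Re z \<le> x" if "z \<in> closed_segment A B" for z
    using that closed_segment_same_Im[of A B] x by (auto simp: pts closed_segment_eq_real_ivl split: if_splits)
  have segBC: "Re z = x" "\<bar>Im z\<bar> \<le> pi" if "z \<in> closed_segment B C" for z
    using that closed_segment_same_Re[of B C] by (auto simp: pts closed_segment_eq_real_ivl split: if_splits)
  have segCD: "Im z = pi" "-1 \<le> Re z" "Re z \<le> x" if "z \<in> closed_segment C D" for z
    using that closed_segment_same_Im[of C D] x by (auto simp: pts closed_segment_eq_real_ivl split: if_splits)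
  have segDA: "Re z = -1" "\<bar>Im z\<bar> \<le> pi" if "z \<in> closed_segment D A" for z
    using that closed_segment_same_Re[of D A] by (auto simp: pts closed_segment_eq_real_ivl split: if_splits)
  have contM: "M contour_integrable_on linepath u v" if "0 \<notin> closed_segment u v" for u v
    unfolding M_def using that by (intro contour_integrable_continuous_linepath continuous_intros) auto
  have nz: "0 \<notin> closed_segment A B" "0 \<notin> closed_segment B C" "0 \<notin> closed_segment C D" "0 \<notin> closed_segment D A"
    using segAB(1)[of 0] segBC(1)[of 0] segCD(1)[of 0] segDA(1)[of 0] x by auto
  note intM = contM[OF nz(1)] contM[OF nz(2)] contM[OF nz(3)] contM[OF nz(4)]
  define iM where "iM u v = contour_integral (linepath u v) M" for u v
  have rect: "iM A B + iM B C + iM C D + iM D A = 2 * pi * \<i> * of_real (cop_rate\<^sup>2 * bess (cop_rate * real n))"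
  proof -
    have "rectpath A C = linepath A B +++ linepath B C +++ linepath C D +++ linepath D A"
      by (simp add: rectpath_def Let_def pts)
    hence "contour_integral (rectpath A C) M = iM A B + (iM B C + (iM C D + iM D A))"
      using intM by (simp add: iM_def)
    moreover have "0 \<in> box A C" using x by (simp add: in_box_complex_iff pts)
    ultimately show ?thesis using bess_rect_integral[of A C cop_rate "real n"] by (simp add: M_def add.assoc)
  qed
  have nM: "norm (M z) = norm z * exp (cop_rate * Re (1 / z) + real n * Re z)" for z
    unfolding M_def norm_mult norm_exp_eq_Re plus_complex.sel Re_real_divide by simp
  have pi32: "pi \<le> 3.2" "pi \<ge> 3.1" using pi_approx by simp_all
  have horiz: "norm (M z) \<le> 4.6 * E" if "\<bar>Im z\<bar> = pi" "-1 \<le> Re z" "Re z \<le> x" for z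
  proof -
    have "\<bar>Re z\<bar> \<le> 1" using that x by auto
    hence "norm z \<le> 4.2" using cmod_le[of z] that(1) pi32 by linarith
    moreover have "cop_rate * Re (1 / z) + real n * Re z \<le> 0.03 + real n * x"
    proof -
      have "pi\<^sup>2 \<ge> 9" using power_mono[of 3 pi 2] pi32 by simp
      moreover have "(Im z)\<^sup>2 = pi\<^sup>2" using that(1) by (metis power2_abs)
      ultimately have "(norm z)\<^sup>2 \<ge> 9" by (simp add: cmod_power2 add_increasing)
      have "Re (1 / z) = Re z / (norm z)\<^sup>2" by (simp add: Re_divide cmod_power2)
      also have "\<dots> \<le> (1/15) / 9"
      proof (cases "Re z \<ge> 0")
        case True
        thus ?thesis using that x \<open>(norm z)\<^sup>2 \<ge> 9\<close> by (intro frac_le) auto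
      next
        case False
        hence "Re z / (norm z)\<^sup>2 \<le> 0" by (simp add: divide_nonpos_nonneg)
        thus ?thesis by (rule order_trans) simp
      qed
      finally have "cop_rate * Re (1 / z) \<le> cop_rate * ((1/15) / 9)"
        using cop_rate_bounds by (intro mult_left_mono) auto
      also have "\<dots> \<le> 0.03" using cop_rate_bounds by simp
      finally have "cop_rate * Re (1 / z) \<le> 0.03" .
      moreover have "real n * Re z \<le> real n * x" using that by (intro mult_left_mono) auto
      ultimately show ?thesis by simp
    qed
    hence "exp (cop_rate * Re (1 / z) + real n * Re z) \<le> exp 0.03 * E" by (simp add: E_def flip: exp_add)
    ultimately have "norm (M z) \<le> 4.2 * (exp 0.03 * E)" unfolding nM by (intro mult_mono) auto
    moreover have "exp (0.03::real) \<le> 1 + 2 * 0.03" using exp_bound_lemma[of "0.03::real"] by simp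
    hence "exp 0.03 * E \<le> 1.06 * E" using E by (intro mult_right_mono) auto
    ultimately have "norm (M z) \<le> 4.2 * (1.06 * E)" by linarith
    thus ?thesis using E by simp
  qed
  have AB: "norm (iM A B) \<le> 4.6 * E * 1.1"
  proof -
    have "norm (B - A) \<le> 1.1" using x by (simp add: pts complex_diff cmod_def)
    have "norm (iM A B) \<le> 4.6 * E * norm (B - A)"
      unfolding iM_def by (rule contour_integral_bound_linepath[OF intM(1)]) (use horiz segAB E in auto)
    also have "\<dots> \<le> 4.6 * E * 1.1"
      using E \<open>norm (B - A) \<le> 1.1\<close> by (intro mult_left_mono) auto
    finally show ?thesis .
  qed
  have CD: "norm (iM C D) \<le> 4.6 * E * 1.1"
  proof -
    have "norm (D - C) \<le> 1.1" using x by (simp add: pts complex_diff cmod_def)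
    have "norm (iM C D) \<le> 4.6 * E * norm (D - C)"
      unfolding iM_def by (rule contour_integral_bound_linepath[OF intM(3)]) (use horiz segCD E in auto)
    also have "\<dots> \<le> 4.6 * E * 1.1"
      using E \<open>norm (D - C) \<le> 1.1\<close> by (intro mult_left_mono) auto
    finally show ?thesis .
  qed
  have DA: "norm (iM D A) \<le> 4.2 * E * (2 * pi)"
  proof -
    have "norm (A - D) = 2 * pi" by (simp add: pts complex_diff cmod_def real_sqrt_mult)
    moreover have "norm (iM D A) \<le> 4.2 * E * norm (A - D)"
      unfolding iM_def
    proof (rule contour_integral_bound_linepath)
      fix z assume z: "z \<in> closed_segment D A"
      have "norm z \<le> 4.2" using cmod_le[of z] segDA[OF z] pi32 by simp
      moreover have "exp (cop_rate * Re (1 / z) + real n * Re z) \<le> 1"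
      proof -
        have "Re (1 / z) \<le> 0" using segDA(1)[OF z] by (simp add: Re_divide divide_nonpos_nonneg)
        hence "cop_rate * Re (1 / z) \<le> 0" using cop_rate_bounds by (simp add: mult_nonneg_nonpos)
        thus ?thesis using segDA(1)[OF z] by simp
      qed
      ultimately have "norm (M z) \<le> 4.2 * 1" unfolding nM by (intro mult_mono) auto
      thus "norm (M z) \<le> 4.2 * E" using E by simp
    qed (use intM E in auto)
    ultimately show ?thesis by simp
  qed
  have main_eq: "cop_main z * exp (of_nat n * z) = of_real cop_scale * M z" for z
    by (simp add: cop_main_def M_def exp_add)
  have diff: "norm (2 * pi * \<i> * of_real (cubic_overpartition n) - of_real cop_scale * iM B C) \<le> cop_scale * X * E * (2 * pi)"
  proof -
    have i1: "((\<lambda>z. cop_fun z * exp (of_nat n * z)) has_contour_integral 2 * pi * \<i> * of_real (cubic_overpartition n)) (linepath B C)"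
      using cubic_overpartition_integral[OF x(1), of n] has_contour_integral_integral by (metis B_def C_def)
    have i2: "((\<lambda>z. of_real cop_scale * M z) has_contour_integral of_real cop_scale * iM B C) (linepath B C)"
      unfolding iM_def by (intro has_contour_integral_lmul has_contour_integral_integral intM)
    have "norm (2 * pi * \<i> * of_real (cubic_overpartition n) - of_real cop_scale * iM B C) \<le> cop_scale * X * E * norm (C - B)"
    proof (rule has_contour_integral_bound_linepath[OF has_contour_integral_diff[OF i1 i2]])
      show "0 \<le> cop_scale * X * E" using cop_scale_pos X E by simp
      fix z assume z: "z \<in> closed_segment B C"
      have "norm (cop_fun z * exp (of_nat n * z) - of_real cop_scale * M z) = norm (cop_fun z - cop_main z) * E"
        unfolding main_eq[symmetric] left_diff_distrib[symmetric] norm_mult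
        using segBC(1)[OF z] by (simp add: norm_exp_eq_Re E_def)
      also have "\<dots> \<le> cop_scale * X * E"
        using cop_fun_approx[of z] segBC[OF z] x E by (intro mult_right_mono) (auto simp: X_def)
      finally show "norm (cop_fun z * exp (of_nat n * z) - of_real cop_scale * M z) \<le> cop_scale * X * E" .
    qed
    moreover have "norm (C - B) = 2 * pi" by (simp add: pts complex_diff cmod_def real_sqrt_mult)
    ultimately show ?thesis by simp
  qed
  define \<Delta> where "\<Delta> = cubic_overpartition n / cop_scale - cop_rate\<^sup>2 * bess (cop_rate * real n)"
  have "cop_scale * (2 * pi * \<bar>\<Delta>\<bar>) = norm (of_real cop_scale * (2 * pi * \<i> * of_real \<Delta>))"
    using cop_scale_pos by (simp add: norm_mult)
  also have "of_real cop_scale * (2 * pi * \<i> * of_real \<Delta>) =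
     2 * pi * \<i> * of_real (cubic_overpartition n) - of_real cop_scale * (2 * pi * \<i> * of_real (cop_rate\<^sup>2 * bess (cop_rate * real n)))"
    using cop_scale_pos by (simp add: \<Delta>_def field_simps)
  also have "\<dots> = (2 * pi * \<i> * of_real (cubic_overpartition n) - of_real cop_scale * iM B C)
      - of_real cop_scale * (iM A B + iM C D + iM D A)"
    unfolding rect[symmetric] by (simp add: algebra_simps)
  also have "norm \<dots> \<le> norm (2 * pi * \<i> * of_real (cubic_overpartition n) - of_real cop_scale * iM B C) +
      norm (of_real cop_scale * (iM A B + iM C D + iM D A))" by (rule norm_triangle_ineq4)
  also have "\<dots> \<le> cop_scale * X * E * (2 * pi) + cop_scale * (4.6 * E * 1.1 + 4.6 * E * 1.1 + 4.2 * E * (2 * pi))"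
  proof (rule add_mono[OF diff])
    have "norm (iM A B + iM C D + iM D A) \<le> 4.6 * E * 1.1 + 4.6 * E * 1.1 + 4.2 * E * (2 * pi)"
      using AB CD DA norm_triangle_ineq[of "iM A B + iM C D" "iM D A"] norm_triangle_ineq[of "iM A B" "iM C D"]
      by linarith
    thus "norm (of_real cop_scale * (iM A B + iM C D + iM D A)) \<le> cop_scale * (4.6 * E * 1.1 + 4.6 * E * 1.1 + 4.2 * E * (2 * pi))"
      using cop_scale_pos by (simp add: norm_mult)
  qed
  \<comment> \<open>The three remaining sides together cost at most 6 E times 2 pi, which raises 35
    to 41.\<close>
  also have "\<dots> \<le> cop_scale * (2 * pi * (E * (X + 6)))"
  proof -
    have "2 * 4.6 * 1.1 + 4.2 * (2 * pi) \<le> 2 * pi * 6" using pi32 by simp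
    hence "cop_scale * E * (2 * 4.6 * 1.1 + 4.2 * (2 * pi)) \<le> cop_scale * E * (2 * pi * 6)"
      using cop_scale_pos E by (intro mult_left_mono) auto
    thus ?thesis by (simp add: algebra_simps)
  qed
  finally have "\<bar>\<Delta>\<bar> \<le> E * (X + 6)" using cop_scale_pos by simp
  thus ?thesis by (simp add: \<Delta>_def E_def X_def)
qed

section \<open>Comparison of gap and error\<close>

lemma exp_20: "exp (20::real) \<ge> 4 * 10 ^ 8"
proof -
  have "1 + 1/8 + (1/8)\<^sup>2 / 2 \<le> exp (1/8::real)" by (rule exp_lower_Taylor_quadratic) simp
  hence "(1 + 1/8 + (1/8)\<^sup>2 / 2) ^ 8 \<le> exp (1/8::real) ^ 8" by (intro power_mono) auto
  also have "exp (1/8::real) ^ 8 = exp 1" by (simp flip: exp_of_nat_mult)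
  finally have "2.7 \<le> exp (1::real)" by (rule order_trans[rotated]) (simp add: power2_eq_square power_divide)
  hence "2.7 ^ 20 \<le> exp (1::real) ^ 20" by (intro power_mono) auto
  also have "exp (1::real) ^ 20 = exp 20" by (simp flip: exp_of_nat_mult)
  finally show ?thesis by (rule order_trans[rotated]) (simp add: power_divide)
qed

text \<open>Here s = sqrt n, and 1.1308 = 3.8474 - 2.7166 is the difference of the growth rates of
  main term and error. The factor 96 exceeds 14.3/(0.84 * 0.1803), the quotient of the constants in
  the final comparison.\<close>

lemma exp_dominates_power5:
  assumes s: "s \<ge> (20::real)"
  shows "96 * s ^ 5 \<le> exp (1.1308 * s - 2.223)"
proof -
  have "s / 20 \<le> exp (s / 20 - 1)" using exp_ge_add_one_self[of "s / 20 - 1"] by simp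
  hence "(s / 20) ^ 5 \<le> exp (s / 20 - 1) ^ 5" using s by (intro power_mono) auto
  also have "\<dots> = exp ((s - 20) / 4)" by (simp flip: exp_of_nat_mult)
  finally have "s ^ 5 \<le> 20 ^ 5 * exp ((s - 20) / 4)" by (simp add: power_divide)
  hence "96 * s ^ 5 \<le> (96 * 20 ^ 5) * exp ((s - 20) / 4)" by simp
  also have "\<dots> \<le> exp 20 * exp ((s - 20) / 4)" using exp_20 by (intro mult_right_mono) auto
  also have "\<dots> = exp (20 + (s - 20) / 4)" by (simp only: exp_add)
  also have "20 + (s - 20) / 4 \<le> 1.1308 * s - 2.223" using s by (simp add: field_simps)
  hence "exp (20 + (s - 20) / 4) \<le> exp (1.1308 * s - 2.223)" by simp
  finally show ?thesis .
qed

text \<open>The value 1.3 is close to sqrt(c - 2) = 1.304..., the minimiser of a + (c - 2)/a. The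
  rate 2.7166 is 1.3 + 1.3087 + 0.1079, the last part coming from the term in 1/sqrt x.\<close>

lemma error_exponent:
  assumes s: "s \<ge> (20::real)" and x: "x = 1.3 / s"
  shows "exp ((s\<^sup>2 + 1) * x) * (41 + x * exp ((cop_rate - 2) / x + 1.1 / sqrt x)) \<le> 1.43 / s * exp (2.7166 * s + 2.223)"
proof -
  have x0: "x > 0" using s x by simp
  have 1: "(s\<^sup>2 + 1) * x \<le> 1.3 * s + 0.065"
  proof -
    have "(s\<^sup>2 + 1) * x = 1.3 * s + 1.3 / s" using s by (simp add: x power2_eq_square field_simps)
    moreover have "1.3 / s \<le> 1.3 / 20" using s by (intro divide_left_mono) auto
    ultimately show ?thesis by simp
  qed
  have 2: "(cop_rate - 2) / x + 1.1 / sqrt x \<le> 1.4166 * s + 2.158"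
  proof -
    have "(cop_rate - 2) / x = (cop_rate - 2) / 1.3 * s" using s by (simp add: x)
    also have "\<dots> \<le> 1.3087 * s" using s cop_rate_bounds by (intro mult_right_mono) auto
    finally have a: "(cop_rate - 2) / x \<le> 1.3087 * s" .
    have "1.1 / sqrt x \<le> 0.965 * sqrt s"
    proof -
      have "sqrt x = sqrt 1.3 / sqrt s" by (simp only: x real_sqrt_divide)
      hence "1.1 / sqrt x = 1.1 / sqrt 1.3 * sqrt s" by simp
      moreover have "1.14 \<le> sqrt 1.3" by (rule real_le_rsqrt) (simp add: power2_eq_square)
      hence "1.1 / sqrt 1.3 \<le> 1.1 / 1.14" by (intro divide_left_mono) auto
      hence "1.1 / sqrt 1.3 \<le> 0.965" by simp
      hence "1.1 / sqrt 1.3 * sqrt s \<le> 0.965 * sqrt s" using s by (intro mult_right_mono) auto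
      ultimately show ?thesis by (simp only:)
    qed
    also have "\<dots> \<le> 0.965 * ((s + 20) / 8.944)"
    proof -
      \<comment> \<open>The square root of s is replaced by its tangent at s = 20, the left end of
        the range.\<close>
      have "0 \<le> (sqrt s - sqrt 20)\<^sup>2" by simp
      also have "\<dots> = s + 20 - 2 * (sqrt s * sqrt 20)" using s by (simp add: power2_diff)
      finally have "2 * (sqrt s * sqrt 20) \<le> s + 20" by simp
      moreover have "4.472 \<le> sqrt 20" by (rule real_le_rsqrt) (simp add: power2_eq_square)
      hence "2 * (sqrt s * 4.472) \<le> 2 * (sqrt s * sqrt 20)" using s by (intro mult_left_mono) auto
      ultimately show ?thesis by simp
    qed
    also have "\<dots> \<le> 0.1079 * s + 2.158" using s by simp
    finally have b: "1.1 / sqrt x \<le> 0.1079 * s + 2.158" .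
    have "1.3087 * s + (0.1079 * s + 2.158) = 1.4166 * s + 2.158" by simp
    thus ?thesis using add_mono[OF a b] by (simp only:)
  qed
  \<comment> \<open>The constant is absorbed as a tenth of the exponential term, turning 1.3 into
    1.43.\<close>
  have 3: "41 \<le> 0.1 * (1.3 / s * exp (1.4166 * s + 2.158))"
  proof -
    have "1 + s / 4 \<le> exp (s / 4)" by (rule exp_ge_add_one_self)
    hence "(1 + s / 4) ^ 4 \<le> exp (s / 4) ^ 4" using s by (intro power_mono) auto
    also have "exp (s / 4) ^ 4 = exp s" by (simp flip: exp_of_nat_mult)
    also have "(1 + s / 4) ^ 4 = (1 + s / 4) ^ 3 * (1 + s / 4)" by (simp add: eval_nat_numeral)
    finally have "(1 + s / 4) ^ 3 * (1 + s / 4) \<le> exp s" .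
    moreover have "6 ^ 3 * (s / 4) \<le> (1 + s / 4) ^ 3 * (1 + s / 4)"
      using s by (intro mult_mono power_mono) auto
    ultimately have "54 * s \<le> exp s" by simp
    moreover have "61 \<le> exp (10::real)" using exp_lower_Taylor_quadratic[of "10::real"] by simp
    ultimately have "61 * (54 * s) \<le> exp 10 * exp s" using s by (intro mult_mono) auto
    also have "\<dots> \<le> exp (1.4166 * s + 2.158)" using s by (simp flip: exp_add)
    finally show ?thesis using s by (simp add: field_simps)
  qed
  have "exp ((cop_rate - 2) / x + 1.1 / sqrt x) \<le> exp (1.4166 * s + 2.158)" using 2 by simp
  hence "x * exp ((cop_rate - 2) / x + 1.1 / sqrt x) \<le> 1.3 / s * exp (1.4166 * s + 2.158)"
    unfolding x[symmetric] using x0 by (intro mult_left_mono) auto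
  hence "41 + x * exp ((cop_rate - 2) / x + 1.1 / sqrt x) \<le> 1.43 / s * exp (1.4166 * s + 2.158)" using 3 by simp
  moreover have "exp ((s\<^sup>2 + 1) * x) \<le> exp (1.3 * s + 0.065)" using 1 by simp
  ultimately have "exp ((s\<^sup>2 + 1) * x) * (41 + x * exp ((cop_rate - 2) / x + 1.1 / sqrt x)) \<le>
      exp (1.3 * s + 0.065) * (1.43 / s * exp (1.4166 * s + 2.158))"
    using x0 by (intro mult_mono) (auto intro: add_nonneg_nonneg)
  also have "\<dots> = 1.43 / s * exp (2.7166 * s + 2.223)" by (simp add: mult_exp_exp)
  finally show ?thesis .
qed

text \<open>The right side is gap times main term. With g = sqrt c and s = sqrt n the gap is at
  least 0.84/s^3 and, by \<open>bess_lower\<close> at t = 2 g s, the main term at least 0.1803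
  exp(3.8474 s)/s^3; the factor 10 on the left is what \<open>log_concave_perturb\<close>
  demands.\<close>

lemma error_small:
  assumes n: "n \<ge> (400::real)" and x: "x = 1.3 / sqrt n"
  shows "10 * (exp ((n + 1) * x) * (41 + x * exp ((cop_rate - 2) / x + 1.1 / sqrt x))) \<le>
    0.44 * cop_rate\<^sup>2 / sqrt (cop_rate * n + cop_rate) ^ 3 * (cop_rate\<^sup>2 * bess (cop_rate * n))"
proof -
  define s where "s = sqrt n"
  define g where "g = sqrt cop_rate"
  have s: "s \<ge> 20" unfolding s_def by (rule real_le_rsqrt) (use n in simp)
  have ns: "n = s\<^sup>2" using n by (simp add: s_def)
  have g: "1.9237 \<le> g" "g \<le> 1.924"
  proof -
    show "1.9237 \<le> g" unfolding g_def by (rule real_le_rsqrt) (use cop_rate_bounds in \<open>simp add: power2_eq_square\<close>)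
    show "g \<le> 1.924" unfolding g_def by (rule real_le_lsqrt) (use cop_rate_bounds in \<open>simp_all add: power2_eq_square\<close>)
  qed
  have cg: "cop_rate = g\<^sup>2" using cop_rate_bounds by (simp add: g_def)
  define t where "t = 2 * g * s"
  have t: "t = 2 * sqrt (cop_rate * n)" by (simp add: t_def g_def s_def real_sqrt_mult)
  have t4: "t \<ge> 4" using mult_mono[of 2 "2 * g" 20 s] s g by (simp add: t_def)
  have "bess (cop_rate * n) \<ge> 3 * exp t / (16 * (cop_rate * n) * t)"
    using bess_lower[OF _ t t4] cop_rate_bounds n by simp
  hence "cop_rate\<^sup>2 * bess (cop_rate * n) \<ge> cop_rate\<^sup>2 * (3 * exp t / (16 * (cop_rate * n) * t))"
    by (intro mult_left_mono) auto
  also have "cop_rate\<^sup>2 * (3 * exp t / (16 * (cop_rate * n) * t)) = 3 * g / 32 * (exp t / s ^ 3)"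
    using g s unfolding cg ns t_def by (simp add: field_simps power2_eq_square power3_eq_cube)
  also have "\<dots> \<ge> 0.1803 * (exp (3.8474 * s) / s ^ 3)"
  proof (intro mult_mono divide_right_mono)
    have "3.8474 * s \<le> t" unfolding t_def using g s by (intro mult_right_mono) auto
    thus "exp (3.8474 * s) \<le> exp t" by simp
  qed (use g s in auto)
  finally have f: "0.1803 * (exp (3.8474 * s) / s ^ 3) \<le> cop_rate\<^sup>2 * bess (cop_rate * n)" .
  have d: "0.84 / s ^ 3 \<le> 0.44 * cop_rate\<^sup>2 / sqrt (cop_rate * n + cop_rate) ^ 3"
  proof -
    have "sqrt (cop_rate * n + cop_rate) = g * sqrt (s\<^sup>2 + 1)"
      by (simp add: g_def ns algebra_simps flip: real_sqrt_mult)
    also have "sqrt (s\<^sup>2 + 1) \<le> 1.00125 * s"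
    proof (rule real_le_lsqrt)
      have "400 \<le> s\<^sup>2" using power_mono[of 20 s 2] s by simp
      thus "s\<^sup>2 + 1 \<le> (1.00125 * s)\<^sup>2" by (simp add: power_mult_distrib) (simp add: power2_eq_square)
    qed (use s in auto)
    hence "g * sqrt (s\<^sup>2 + 1) \<le> g * (1.00125 * s)" using g by (intro mult_left_mono) auto
    finally have "sqrt (cop_rate * n + cop_rate) ^ 3 \<le> (g * (1.00125 * s)) ^ 3"
      using cop_rate_bounds n by (intro power_mono) auto
    moreover have "0 < cop_rate * n + cop_rate" using cop_rate_bounds n by (intro add_pos_pos mult_pos_pos) auto
    ultimately have "0.44 * cop_rate\<^sup>2 / (g * (1.00125 * s)) ^ 3 \<le> 0.44 * cop_rate\<^sup>2 / sqrt (cop_rate * n + cop_rate) ^ 3"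
      using cop_rate_bounds n s g by (intro divide_left_mono) (auto intro!: mult_pos_pos)
    moreover have "0.44 * cop_rate\<^sup>2 / (g * (1.00125 * s)) ^ 3 = 0.44 / 1.00125 ^ 3 * g / s ^ 3"
      using s g unfolding cg by (simp add: field_simps power2_eq_square power3_eq_cube)
    moreover have "0.84 \<le> 0.44 / 1.00125 ^ 3 * g" using g by (simp add: power3_eq_cube)
    hence "0.84 / s ^ 3 \<le> 0.44 / 1.00125 ^ 3 * g / s ^ 3" using s by (intro divide_right_mono) auto
    ultimately show ?thesis by linarith
  qed
  have "10 * (exp ((n + 1) * x) * (41 + x * exp ((cop_rate - 2) / x + 1.1 / sqrt x))) \<le> 10 * (1.43 / s * exp (2.7166 * s + 2.223))"
    unfolding ns using error_exponent[OF s, of x] x by (simp add: s_def)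
  also have "\<dots> \<le> 0.84 / s ^ 3 * (0.1803 * (exp (3.8474 * s) / s ^ 3))"
  proof -
    have "96 * s ^ 5 * exp (2.7166 * s + 2.223) \<le> exp (1.1308 * s - 2.223) * exp (2.7166 * s + 2.223)"
      using exp_dominates_power5[OF s] by (intro mult_right_mono) auto
    also have "\<dots> = exp (3.8474 * s)" by (simp add: mult_exp_exp)
    finally have *: "96 * (s ^ 5 * exp (2.7166 * s + 2.223)) \<le> exp (3.8474 * s)" by (simp only: mult.assoc)
    have "0 \<le> s ^ 5 * exp (2.7166 * s + 2.223)" using s by simp
    with * have "14.3 * s ^ 5 * exp (2.7166 * s + 2.223) \<le> 0.84 * 0.1803 * exp (3.8474 * s)"
      by simp
    hence "14.3 * s ^ 5 * exp (2.7166 * s + 2.223) / s ^ 6 \<le> 0.84 * 0.1803 * exp (3.8474 * s) / s ^ 6"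
      using s by (intro divide_right_mono) auto
    moreover have "14.3 * s ^ 5 * exp (2.7166 * s + 2.223) / s ^ 6 = 10 * (1.43 / s * exp (2.7166 * s + 2.223))"
      using s by (simp add: field_simps eval_nat_numeral)
    moreover have "0.84 * 0.1803 * exp (3.8474 * s) / s ^ 6 = 0.84 / s ^ 3 * (0.1803 * (exp (3.8474 * s) / s ^ 3))"
      by (simp add: eval_nat_numeral)
    ultimately show ?thesis by simp
  qed
  also have "\<dots> \<le> 0.44 * cop_rate\<^sup>2 / sqrt (cop_rate * n + cop_rate) ^ 3 * (cop_rate\<^sup>2 * bess (cop_rate * n))"
    by (rule mult_mono[OF d f]) (use s cop_rate_bounds n in auto)
  finally show ?thesis .
qed

text \<open>The gap leaves 0.9 d f1^2, as (1 + d)(1 - 0.9 d) >= 1 for d <= 0.1. Since f0 + f2 <= 6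
  f1, the perturbations cost about 8.01 E f1, which is at most 0.801 d f1^2.\<close>

lemma log_concave_perturb:
  fixes f0 f1 f2 a0 a1 a2 :: real
  assumes f: "0 < f0" "0 < f1" "0 < f2" "f0 * f2 * (1 + d) \<le> f1\<^sup>2" "f0 \<le> f1" "f1 \<le> f2" "f2 \<le> 5 * f1"
    and d: "0 < d" "d \<le> 0.1" and E: "10 * E \<le> d * f1"
    and a: "\<bar>a0 - f0\<bar> \<le> E" "\<bar>a1 - f1\<bar> \<le> E" "\<bar>a2 - f2\<bar> \<le> E"
  shows "0 < a1" "a0 * a2 < a1\<^sup>2"
proof -
  have E0: "E \<ge> 0" using a by linarith
  have "d * f1 \<le> 1 / 10 * f1" using f d by (intro mult_right_mono) auto
  hence Ef: "E \<le> 1 / 100 * f1" using E by simp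
  thus "0 < a1" using a f by linarith
  have "a2 > 0" using a f Ef by linarith
  hence "a0 * a2 \<le> (f0 + E) * (f2 + E)" using a f E0 by (intro mult_mono) auto
  also have "\<dots> \<le> f1\<^sup>2 - 0.9 * d * f1\<^sup>2 + E * (6 * f1) + E * (1 / 100 * f1)"
  proof -
    have "f0 * f2 * (1 + d) * (1 - 0.9 * d) \<le> f1\<^sup>2 * (1 - 0.9 * d)" using f d by (intro mult_right_mono) auto
    moreover have "f0 * f2 * 1 \<le> f0 * f2 * ((1 + d) * (1 - 0.9 * d))"
    proof (intro mult_left_mono)
      have "0.9 * d * d \<le> 0.1 * d" using d by simp
      thus "1 \<le> (1 + d) * (1 - 0.9 * d)" by (simp add: algebra_simps)
    qed (use f in auto)
    ultimately have "f0 * f2 \<le> f1\<^sup>2 * (1 - 0.9 * d)" by (simp only: mult.assoc mult_1_right)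
    hence "f0 * f2 \<le> f1\<^sup>2 - 0.9 * d * f1\<^sup>2" by (simp add: algebra_simps)
    moreover have "E * (f0 + f2) \<le> E * (6 * f1)" using f E0 by (intro mult_left_mono) auto
    moreover have "E * E \<le> E * (1 / 100 * f1)" using Ef E0 by (intro mult_left_mono) auto
    ultimately show ?thesis by (simp add: algebra_simps)
  qed
  also have "\<dots> < (f1 - E)\<^sup>2"
  proof -
    define p q where "p = E * f1" and "q = d * f1\<^sup>2"
    have "f1 * (10 * E) \<le> f1 * (d * f1)" using E f by (intro mult_left_mono) auto
    hence pq: "10 * p \<le> q" by (simp add: p_def q_def power2_eq_square mult_ac)
    have q: "q > 0" using d f by (simp add: q_def)
    have "(f1 - E)\<^sup>2 = f1\<^sup>2 - 2 * p + E\<^sup>2" by (simp add: p_def power2_diff mult_ac)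
    moreover have "f1\<^sup>2 - 0.9 * d * f1\<^sup>2 + E * (6 * f1) + E * (1 / 100 * f1) = f1\<^sup>2 - 9/10 * q + 601/100 * p"
      by (simp add: p_def q_def algebra_simps)
    moreover have "f1\<^sup>2 - 9/10 * q + 601/100 * p < f1\<^sup>2 - 2 * p + E\<^sup>2"
      using pq q zero_le_power2[of E] by linarith
    ultimately show ?thesis by (simp only:)
  qed
  also have "\<dots> \<le> a1\<^sup>2" using a f Ef by (intro power_mono) auto
  finally show "a0 * a2 < a1\<^sup>2" .
qed

section \<open>Decreasing quotients\<close>

text \<open>One abscissa x, adapted to n, serves all three coefficients; dividing by
  \<open>cop_scale\<close> does not affect log-concavity.\<close>

lemma cubic_overpartition_log_concave_large:
  assumes n: "n \<ge> 400"
  shows "0 < cubic_overpartition n"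
    "cubic_overpartition (n - 1) * cubic_overpartition (n + 1) < cubic_overpartition n ^ 2"
proof -
  define x where "x = 1.3 / sqrt n"
  have s: "20 \<le> sqrt n" by (rule real_le_rsqrt) (use n in simp)
  have "x \<le> 1.3 / 20" unfolding x_def by (rule frac_le) (use s in auto)
  moreover have "0 < x" unfolding x_def using n by (intro divide_pos_pos) auto
  ultimately have x: "0 < x" "x \<le> 1 / 15" by simp_all
  define f where "f k = cop_rate\<^sup>2 * bess (cop_rate * real k)" for k
  define X where "X = 41 + x * exp ((cop_rate - 2) / x + 1.1 / sqrt x)"
  \<comment> \<open>n + 1 rather than n makes the same bound valid for the indices n - 1, n and n +
    1.\<close>
  define E where "E = exp ((real n + 1) * x) * X"
  define d where "d = 0.44 * cop_rate\<^sup>2 / sqrt (cop_rate * n + cop_rate) ^ 3"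
  define a where "a k = cubic_overpartition k / cop_scale" for k
  have X: "X \<ge> 0" using x by (simp add: X_def)
  have approx: "\<bar>a k - f k\<bar> \<le> E" if "k \<le> n + 1" for k
  proof -
    have "\<bar>a k - f k\<bar> \<le> exp (real k * x) * X"
      using cubic_overpartition_approx[OF x, of k] by (simp add: a_def f_def X_def)
    also have "\<dots> \<le> E" unfolding E_def using X x that by (intro mult_right_mono) auto
    finally show ?thesis .
  qed
  have f_pos: "f k > 0" for k
    unfolding f_def using cop_rate_bounds by (intro mult_pos_pos bess_pos) auto
  have shift: "cop_rate * real (n - 1) = cop_rate * n - cop_rate" "cop_rate * real (n + 1) = cop_rate * n + cop_rate"
    using n by (auto simp: algebra_simps of_nat_diff)
  have 900: "cop_rate * n - cop_rate \<ge> 900"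
    using mult_mono[of "3.7" cop_rate 399 "real (n - 1)"] n cop_rate_bounds unfolding shift(1)[symmetric] by simp
  have lc: "f (n - 1) * f (n + 1) * (1 + d) \<le> (f n)\<^sup>2"
  proof -
    have "(cop_rate\<^sup>2)\<^sup>2 * (bess (cop_rate * n - cop_rate) * bess (cop_rate * n + cop_rate) * (1 + d)) \<le> (cop_rate\<^sup>2)\<^sup>2 * (bess (cop_rate * n))\<^sup>2"
      unfolding d_def using bess_log_concave[OF _ 900] cop_rate_bounds by (intro mult_left_mono) auto
    thus ?thesis unfolding f_def shift by (simp add: power2_eq_square mult_ac)
  qed
  have f01: "f (n - 1) \<le> f n"
    using bess_growth(1)[of "cop_rate * n - cop_rate" cop_rate] 900 cop_rate_bounds unfolding f_def shift
    by (intro mult_left_mono) auto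
  have f12: "f n \<le> f (n + 1)"
    using bess_growth(1)[of "cop_rate * n" cop_rate] cop_rate_bounds unfolding f_def shift
    by (intro mult_left_mono) auto
  have f2: "f (n + 1) \<le> 5 * f n"
  proof -
    have "exp (cop_rate / 3) \<le> exp (5/8 + 5/8)" using cop_rate_bounds by simp
    also have "\<dots> = exp (5/8) * exp (5/8::real)" by (simp only: exp_add)
    also have "exp (5/8::real) \<le> 1 + 5/8 + (5/8)\<^sup>2" by (rule exp_bound) auto
    hence "exp (5/8) * exp (5/8::real) \<le> (1 + 5/8 + (5/8)\<^sup>2) * (1 + 5/8 + (5/8)\<^sup>2)" by (intro mult_mono) auto
    also have "\<dots> \<le> (5::real)" by (simp add: power2_eq_square)
    finally have "exp (cop_rate / 3) * bess (cop_rate * n) \<le> 5 * bess (cop_rate * n)"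
      using bess_pos[of "cop_rate * n"] cop_rate_bounds by (intro mult_right_mono) auto
    hence "bess (cop_rate * n + cop_rate) \<le> 5 * bess (cop_rate * n)"
      using bess_growth(2)[of "cop_rate * n" cop_rate] cop_rate_bounds by auto
    hence "cop_rate\<^sup>2 * bess (cop_rate * n + cop_rate) \<le> cop_rate\<^sup>2 * (5 * bess (cop_rate * n))" by (intro mult_left_mono) auto
    thus ?thesis unfolding f_def shift by simp
  qed
  have d: "0 < d" "d \<le> 0.1"
  proof -
    have "30 \<le> sqrt (cop_rate * n + cop_rate)" by (rule real_le_rsqrt) (use 900 cop_rate_bounds in simp)
    hence "30 ^ 3 \<le> sqrt (cop_rate * n + cop_rate) ^ 3" by (intro power_mono) auto
    moreover have "cop_rate\<^sup>2 \<le> 16" using power_mono[of cop_rate 4 2] cop_rate_bounds by simp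
    ultimately have "d \<le> 0.44 * 16 / 30 ^ 3" unfolding d_def by (intro frac_le) auto
    thus "d \<le> 0.1" by simp
    show "0 < d" unfolding d_def using cop_rate_bounds n by (intro divide_pos_pos zero_less_power) (auto intro!: add_pos_pos mult_pos_pos)
  qed
  have E: "10 * E \<le> d * f n"
    using error_small[of "real n" x] n by (simp add: E_def X_def d_def f_def x_def)
  note perturb = log_concave_perturb[OF f_pos f_pos f_pos lc f01 f12 f2 d E approx approx approx]
  show "0 < cubic_overpartition n" using perturb(1) cop_scale_pos by (simp add: a_def zero_less_divide_iff)
  have "a (n - 1) * a (n + 1) * cop_scale\<^sup>2 < (a n)\<^sup>2 * cop_scale\<^sup>2"
    using perturb(2) cop_scale_pos by (intro mult_strict_right_mono) auto
  thus "cubic_overpartition (n - 1) * cubic_overpartition (n + 1) < cubic_overpartition n ^ 2"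
    using cop_scale_pos by (simp add: a_def power2_eq_square)
qed

section \<open>Exact values and the range below 400\<close>

lemma cop_int_small_list:
  "down_list cop_int 18 = [16836, 11290, 7456, 4896, 3152, 2020, 1260, 784, 470, 282, 160, 92, 48, 26, 12, 6, 2, 1]"
proof -
  have "cop_list 17 [1] [1] = [16836, 11290, 7456, 4896, 3152, 2020, 1260, 784, 470, 282, 160, 92, 48, 26, 12, 6, 2, 1]"
    by code_simp
  thus ?thesis using cop_list_cop_int[of 17] by simp
qed

text \<open>Of the indices 401 down to 0 the first 393 entries keep those from 9 on, so the middle
  indices are 10 to 400. The cut cannot be later in the list: 470^2 < 282 * 784 at the middle index
  9.\<close>

lemma cop_int_log_concave_list: "log_concave_list (take 393 (down_list cop_int 402))"
proof -
  have "cop_list 401 [1] [1] = down_list cop_int 402"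
    using cop_list_cop_int[of 401] by simp
  moreover have "log_concave_list (take 393 (cop_list 401 [1] [1]))" by code_simp
  ultimately show ?thesis by simp
qed

lemma cop_int_small:
  "cop_int 0 = 1" "cop_int 1 = 2" "cop_int 2 = 6" "cop_int 3 = 12" "cop_int 4 = 26" "cop_int 5 = 48"
  "cop_int 6 = 92" "cop_int 7 = 160" "cop_int 8 = 282" "cop_int 9 = 470" "cop_int 10 = 784" "cop_int 11 = 1260"
  "cop_int 12 = 2020" "cop_int 13 = 3152" "cop_int 14 = 4896" "cop_int 15 = 7456" "cop_int 16 = 11290"
  "cop_int 17 = 16836"
proof -
  have "rev [0..<18] = [17, 16, 15, 14, 13, 12, 11, 10, 9, 8, 7, 6, 5, 4, 3, 2, 1, 0 :: nat]" by code_simp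
  thus "cop_int 0 = 1" "cop_int 1 = 2" "cop_int 2 = 6" "cop_int 3 = 12" "cop_int 4 = 26" "cop_int 5 = 48"
    "cop_int 6 = 92" "cop_int 7 = 160" "cop_int 8 = 282" "cop_int 9 = 470" "cop_int 10 = 784" "cop_int 11 = 1260"
    "cop_int 12 = 2020" "cop_int 13 = 3152" "cop_int 14 = 4896" "cop_int 15 = 7456" "cop_int 16 = 11290"
    "cop_int 17 = 16836"
    using cop_int_small_list unfolding down_list_def by simp_all
qed

lemma cubic_overpartition_log_concave:
  assumes "n \<ge> 10"
  shows "cubic_overpartition (n - 1) * cubic_overpartition (n + 1) < cubic_overpartition n ^ 2"
proof (cases "n \<ge> 400")
  case True
  thus ?thesis by (rule cubic_overpartition_log_concave_large)
next
  case False
  hence "cop_int (n + 1) * cop_int (n - 1) < cop_int n * cop_int n"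
    using log_concave_list_down_list[OF cop_int_log_concave_list, of n] assms by simp
  hence "real_of_int (cop_int (n + 1) * cop_int (n - 1)) < real_of_int (cop_int n * cop_int n)"
    by (simp only: of_int_less_iff)
  thus ?thesis by (simp add: cubic_overpartition_cop_int power2_eq_square mult.commute)
qed

lemma less_10_cases: "(k::nat) < 10 \<Longrightarrow> k \<in> {0, 1, 2, 3, 4, 5, 6, 7, 8, 9}"
  by auto

lemma cubic_overpartition_pos: "cubic_overpartition n > 0"
proof -
  consider "n \<ge> 400" | "11 \<le> n" "n < 400" | "n < 10" | "n = 10" by linarith
  thus ?thesis
  proof cases
    case 1
    thus ?thesis by (rule cubic_overpartition_log_concave_large)
  next
    case 2
    thus ?thesis
      using log_concave_list_down_list[OF cop_int_log_concave_list, of "n - 1"]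
      by (simp add: cubic_overpartition_cop_int)
  next
    case 3
    from less_10_cases[OF this] show ?thesis
      unfolding cubic_overpartition_cop_int by (auto simp: cop_int_small simp del: One_nat_def)
  next
    case 4
    thus ?thesis by (simp add: cubic_overpartition_cop_int cop_int_small)
  qed
qed

section \<open>Quotients of consecutive coefficients\<close>

definition cop_ratio :: "nat \<Rightarrow> real" where
  "cop_ratio k = cubic_overpartition (k + 1) / cubic_overpartition k"

lemma cop_ratio_pos: "cop_ratio k > 0"
  by (simp add: cop_ratio_def cubic_overpartition_pos)

lemma cop_ratio_Suc:
  assumes "9 \<le> k"
  shows "cop_ratio (Suc k) < cop_ratio k"
  using cubic_overpartition_log_concave[of "Suc k"] assms cubic_overpartition_pos[of k] cubic_overpartition_pos[of "Suc k"]
  by (simp add: cop_ratio_def field_simps power2_eq_square)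

lemma cop_ratio_decreasing:
  assumes "9 \<le> k" "k < j"
  shows "cop_ratio j < cop_ratio k"
  using assms(2)
proof (induction j)
  case (Suc j)
  show ?case
  proof (cases "k = j")
    case True
    thus ?thesis using cop_ratio_Suc assms by simp
  next
    case False
    hence "k < j" using Suc.prems by simp
    thus ?thesis using Suc.IH cop_ratio_Suc[of j] assms by simp
  qed
qed simp

text \<open>The early quotients are not monotone (470/282 < 784/470), but each of them exceeds
  \<open>cop_ratio 10\<close>, which bounds all quotients from index 10 on.\<close>

lemma cop_ratio_less:
  assumes "10 \<le> n" "k < n" "n \<le> j"
  shows "cop_ratio j < cop_ratio k"
proof (cases "9 \<le> k")
  case True
  thus ?thesis using cop_ratio_decreasing assms by simp
next
  case False
  hence "k \<in> {0, 1, 2, 3, 4, 5, 6, 7, 8}" by auto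
  hence "cop_ratio 10 < cop_ratio k"
    unfolding cop_ratio_def cubic_overpartition_cop_int
    by (auto simp: cop_int_small simp del: One_nat_def)
  moreover have "cop_ratio j \<le> cop_ratio 10"
    using cop_ratio_decreasing[of 10 j] assms by (cases "j = 10") auto
  ultimately show ?thesis by simp
qed

lemma cubic_overpartition_quotient:
  "cubic_overpartition (k + m) = cubic_overpartition k * (\<Prod>i<m. cop_ratio (k + i))"
  by (induction m) (auto simp: cop_ratio_def cubic_overpartition_pos less_imp_neq[symmetric])

theorem theorem2p7:
  fixes n m :: nat
  assumes "1 < m" and "m < n"
  shows "cubic_overpartition n ^ 2 > cubic_overpartition (n - m) * cubic_overpartition (n + m)"
proof (cases "10 \<le> n")
  case True
  define k where "k = n - m"
  have n: "n = k + m" using assms by (simp add: k_def)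
  \<comment> \<open>The two sides are a(n+m)/a(n) and a(n)/a(n-m). They are compared factor by
    factor: every index k + i lies below n and every index n + i does not.\<close>
  have "(\<Prod>i<m. cop_ratio (n + i)) < (\<Prod>i<m. cop_ratio (k + i))"
  proof (rule prod_mono_strict[of 0])
    have less: "cop_ratio (n + i) < cop_ratio (k + i)" if "i < m" for i
      using True assms n that by (intro cop_ratio_less) auto
    show "cop_ratio (n + 0) < cop_ratio (k + 0)" using less[of 0] assms by simp
    show "0 \<le> cop_ratio (n + i) \<and> cop_ratio (n + i) \<le> cop_ratio (k + i)" if "i \<in> {..<m}" for i
      using less[of i] that cop_ratio_pos[of "n + i"] by auto
  qed (use assms cop_ratio_pos in auto)
  hence "cubic_overpartition k * cubic_overpartition n * (\<Prod>i<m. cop_ratio (n + i)) <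
      cubic_overpartition k * cubic_overpartition n * (\<Prod>i<m. cop_ratio (k + i))"
    using cubic_overpartition_pos by (intro mult_strict_left_mono) auto
  thus ?thesis
    using cubic_overpartition_quotient[of k m] cubic_overpartition_quotient[of n m]
    by (simp add: n[symmetric] k_def[symmetric] power2_eq_square mult_ac)
next
  case False
  \<comment> \<open>Finitely many pairs remain. Distance 1, where the inequality fails for n = 3, 5,
    7 and 9, is not among them.\<close>
  hence "n \<in> {3, 4, 5, 6, 7, 8, 9}" "m \<in> {2, 3, 4, 5, 6, 7, 8}" using assms by auto
  thus ?thesis unfolding cubic_overpartition_cop_int using assms(2)
    by (auto simp: cop_int_small cop_int_small(2)[unfolded One_nat_def] power2_eq_square simp del: One_nat_def)
qed

end
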